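(* For any $x\in\mathbb{C}$ there exists a unique, up to unitary equivalence, irreducible well-behaved representation of $A_{2,x}$; it acts on $l_2(\mathbb{Z}_+)^{\otimes2}$ and is given by $$a_1=a\otimes\mathbf{1},\qquad a_2=\sqrt{1+|x|^2}\;\mathbf{1}\otimes a+x\,a^*\otimes\mathbf{1}.$$
   Context: $A_{2,x}$ is the unital $*$-algebra generated by $a_1,a_2$ with relations $a_i^*a_i-a_ia_i^*=\mathbf{1}$ ($i=1,2$), $a_1^*a_2=a_2a_1^*$, $a_2a_1-a_1a_2=x\mathbf{1}$. In particular $A_{2,0}$ is the $*$-algebra of the CCR with two degrees of freedom, with generators denoted $c_1,c_2$: $c_i^*c_i-c_ic_i^*=1$, $c_1^*c_2=c_2c_1^*$, $c_2c_1=c_1c_2$. There is a $*$-isomorphism $A_{2,x}\to A_{2,0}$ with $a_1\mapsto c_1$, $a_2\mapsto(1+|x|^2)^{1/2}c_2+x c_1^*$. A (generally unbounded) $*$-representation of $A_{2,0}$ is well-behaved if it is integrable, i.e. it is the differential, on the space of smooth vectors, of a strongly continuous unitary representation of the (5-dimensional) Heisenberg Lie group. A $*$-representation of $A_{2,x}$ is well-behaved if the representation of $A_{2,0}$ corresponding to it under the $*$-isomorphism $A_{2,x}\to A_{2,0}$ with $a_1\mapsto c_1$, $a_2\mapsto(1+|x|^2)^{1/2}c_2+x c_1^*$ is well-behaved. $l_2(\mathbb{Z}_+)$ has standard orthonormal basis $\{e_n\}_{n\ge0}$, and $a e_n=\sqrt{n+1}\,e_{n+1}$, so $a^*e_n=\sqrt{n}\,e_{n-1}$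 and $a^*e_0=0$; the formulas are understood on the corresponding domain of smooth vectors (rapidly decreasing sequences). *)

theory Defs
  imports "HOL-Analysis.Analysis" "HOL-Algebra.Module"
begin

section \<open>Complex Hilbert spaces\<close>

text \<open>The inner product is antilinear in its first argument. Positive definiteness follows from
  the last axiom, because the norm is one.\<close>

class complex_hilbert = banach +
  fixes scaleC :: "complex \<Rightarrow> 'a \<Rightarrow> 'a" (infixr \<open>*\<^sub>C\<close> 75)
    and cinner :: "'a \<Rightarrow> 'a \<Rightarrow> complex"
  assumes scaleC_add_right: "c *\<^sub>C (u + v) = c *\<^sub>C u + c *\<^sub>C v"
    and scaleC_add_left: "(c + d) *\<^sub>C u = c *\<^sub>C u + d *\<^sub>C u"
    and scaleC_scaleC: "c *\<^sub>C (d *\<^sub>C u) = (c * d) *\<^sub>C u"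
    and scaleR_scaleC: "r *\<^sub>R u = complex_of_real r *\<^sub>C u"
    and cinner_commute: "cinner u v = cnj (cinner v u)"
    and cinner_add_right: "cinner u (v + w) = cinner u v + cinner u w"
    and cinner_scaleC_right: "cinner u (c *\<^sub>C v) = c * cinner u v"
    and norm_eq_sqrt_cinner: "norm u = sqrt (Re (cinner u u))"

definition complex_subspace :: "'a::complex_hilbert set \<Rightarrow> bool" where
  "complex_subspace D \<longleftrightarrow> 0 \<in> D \<and> (\<forall>u\<in>D. \<forall>v\<in>D. u + v \<in> D) \<and> (\<forall>c. \<forall>u\<in>D. c *\<^sub>C u \<in> D)"

definition unitary :: "('a::complex_hilbert \<Rightarrow> 'b::complex_hilbert) \<Rightarrow> bool" where
  "unitary T \<longleftrightarrow> (\<forall>u v. T (u + v) = T u + T v) \<and> (\<forall>c u. T (c *\<^sub>C u) = c *\<^sub>C T u) \<and>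
     (\<forall>u v. cinner (T u) (T v) = cinner u v) \<and> surj T"


section \<open>Unital complex star-algebras given by generators and relations\<close>

record 'a star_algebra = "(complex, 'a) module" +
  star :: "'a \<Rightarrow> 'a"

definition star_algebra_iso ::
    "('a, 'm) star_algebra_scheme \<Rightarrow> ('b, 'n) star_algebra_scheme \<Rightarrow> ('a \<Rightarrow> 'b) \<Rightarrow> bool" where
  "star_algebra_iso A B \<Phi> \<longleftrightarrow> bij_betw \<Phi> (carrier A) (carrier B) \<and>
     \<Phi> \<one>\<^bsub>A\<^esub> = \<one>\<^bsub>B\<^esub> \<and>
     (\<forall>u\<in>carrier A. \<forall>v\<in>carrier A. \<Phi> (u \<oplus>\<^bsub>A\<^esub> v) = \<Phi> u \<oplus>\<^bsub>B\<^esub> \<Phi> v) \<and>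
     (\<forall>u\<in>carrier A. \<forall>v\<in>carrier A. \<Phi> (u \<otimes>\<^bsub>A\<^esub> v) = \<Phi> u \<otimes>\<^bsub>B\<^esub> \<Phi> v) \<and>
     (\<forall>c. \<forall>u\<in>carrier A. \<Phi> (c \<odot>\<^bsub>A\<^esub> u) = c \<odot>\<^bsub>B\<^esub> \<Phi> u) \<and>
     (\<forall>u\<in>carrier A. \<Phi> (star A u) = star B (\<Phi> u))"

text \<open>The star-algebra presented by generators and relations is the algebra of formal
  star-polynomial expressions modulo the least congruence that contains the relations and the
  axioms of unital complex star-algebras.\<close>

datatype 'g sterm =
    Gen 'g
  | Zero
  | One
  | Add "'g sterm" "'g sterm"
  | Mult "'g sterm" "'g sterm"
  | Scale complex "'g sterm"
  | Star "'g sterm"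

abbreviation Sub :: "'g sterm \<Rightarrow> 'g sterm \<Rightarrow> 'g sterm" where
  "Sub s t \<equiv> Add s (Scale (-1) t)"

inductive star_cong :: "('g sterm \<times> 'g sterm) set \<Rightarrow> 'g sterm \<Rightarrow> 'g sterm \<Rightarrow> bool"
  for R :: "('g sterm \<times> 'g sterm) set" where
  rel: "(s, t) \<in> R \<Longrightarrow> star_cong R s t"
| refl: "star_cong R s s"
| sym: "star_cong R s t \<Longrightarrow> star_cong R t s"
| trans: "star_cong R s t \<Longrightarrow> star_cong R t u \<Longrightarrow> star_cong R s u"
| cong_add: "star_cong R s s' \<Longrightarrow> star_cong R t t' \<Longrightarrow> star_cong R (Add s t) (Add s' t')"
| cong_mult: "star_cong R s s' \<Longrightarrow> star_cong R t t' \<Longrightarrow> star_cong R (Mult s t) (Mult s' t')"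
| cong_scale: "star_cong R s s' \<Longrightarrow> star_cong R (Scale c s) (Scale c s')"
| cong_star: "star_cong R s s' \<Longrightarrow> star_cong R (Star s) (Star s')"
| add_assoc: "star_cong R (Add (Add s t) u) (Add s (Add t u))"
| add_comm: "star_cong R (Add s t) (Add t s)"
| add_zero: "star_cong R (Add Zero s) s"
| add_neg: "star_cong R (Sub s s) Zero"
| scale_add_right: "star_cong R (Scale c (Add s t)) (Add (Scale c s) (Scale c t))"
| scale_add_left: "star_cong R (Scale (c + d) s) (Add (Scale c s) (Scale d s))"
| scale_scale: "star_cong R (Scale c (Scale d s)) (Scale (c * d) s)"
| scale_one: "star_cong R (Scale 1 s) s"
| mult_assoc: "star_cong R (Mult (Mult s t) u) (Mult s (Mult t u))"
| mult_one_left: "star_cong R (Mult One s) s"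
| mult_one_right: "star_cong R (Mult s One) s"
| mult_add_left: "star_cong R (Mult (Add s t) u) (Add (Mult s u) (Mult t u))"
| mult_add_right: "star_cong R (Mult u (Add s t)) (Add (Mult u s) (Mult u t))"
| mult_scale_left: "star_cong R (Mult (Scale c s) t) (Scale c (Mult s t))"
| mult_scale_right: "star_cong R (Mult s (Scale c t)) (Scale c (Mult s t))"
| star_star: "star_cong R (Star (Star s)) s"
| star_add: "star_cong R (Star (Add s t)) (Add (Star s) (Star t))"
| star_mult: "star_cong R (Star (Mult s t)) (Mult (Star t) (Star s))"
| star_scale: "star_cong R (Star (Scale c s)) (Scale (cnj c) (Star s))"

definition term_class :: "('g sterm \<times> 'g sterm) set \<Rightarrow> 'g sterm \<Rightarrow> 'g sterm set" where
  "term_class R s = {t. star_cong R s t}"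

definition presented_star_algebra ::
    "('g sterm \<times> 'g sterm) set \<Rightarrow> 'g sterm set star_algebra" where
  "presented_star_algebra R =
     \<lparr>carrier = range (term_class R),
      monoid.mult = (\<lambda>u v. \<Union>s\<in>u. \<Union>t\<in>v. term_class R (Mult s t)),
      one = term_class R One,
      zero = term_class R Zero,
      add = (\<lambda>u v. \<Union>s\<in>u. \<Union>t\<in>v. term_class R (Add s t)),
      smult = (\<lambda>c u. \<Union>s\<in>u. term_class R (Scale c s)),
      star = (\<lambda>u. \<Union>s\<in>u. term_class R (Star s))\<rparr>"

lemma term_class_eq_iff: "term_class R s = term_class R t \<longleftrightarrow> star_cong R s t"
  unfolding term_class_def set_eq_iff mem_Collect_eq
  by (meson star_cong.refl star_cong.sym star_cong.trans)

lemma presented_star_algebra_simps: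
  "carrier (presented_star_algebra R) = range (term_class R)"
  "\<one>\<^bsub>presented_star_algebra R\<^esub> = term_class R One"
  "\<zero>\<^bsub>presented_star_algebra R\<^esub> = term_class R Zero"
  "term_class R s \<otimes>\<^bsub>presented_star_algebra R\<^esub> term_class R t = term_class R (Mult s t)"
  "term_class R s \<oplus>\<^bsub>presented_star_algebra R\<^esub> term_class R t = term_class R (Add s t)"
  "c \<odot>\<^bsub>presented_star_algebra R\<^esub> term_class R s = term_class R (Scale c s)"
  "star (presented_star_algebra R) (term_class R s) = term_class R (Star s)"
proof -
  have UN: "(\<Union>s'\<in>term_class R s. f s') = f s"
    if "\<And>s'. star_cong R s s' \<Longrightarrow> f s = f s'" for s and f :: "'a sterm \<Rightarrow> 'a sterm set"
    using that star_cong.refl[of R s] unfolding term_class_def by blast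
  have UN2: "(\<Union>s'\<in>term_class R s. \<Union>t'\<in>term_class R t. term_class R (f s' t')) = term_class R (f s t)"
    if f: "\<And>s s' t t'. star_cong R s s' \<Longrightarrow> star_cong R t t' \<Longrightarrow> star_cong R (f s t) (f s' t')"
    for s t and f :: "'a sterm \<Rightarrow> 'a sterm \<Rightarrow> 'a sterm"
  proof -
    have "(\<Union>t'\<in>term_class R t. term_class R (f s' t')) = term_class R (f s' t)" for s'
      by (rule UN) (rule iffD2[OF term_class_eq_iff f[OF star_cong.refl]])
    moreover have "(\<Union>s'\<in>term_class R s. term_class R (f s' t)) = term_class R (f s t)"
      by (rule UN[of _ "\<lambda>s. term_class R (f s t)"])
        (rule iffD2[OF term_class_eq_iff f[OF _ star_cong.refl]])
    ultimately show ?thesis by (simp only:)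
  qed
  show "term_class R s \<otimes>\<^bsub>presented_star_algebra R\<^esub> term_class R t = term_class R (Mult s t)"
    using UN2[where f = Mult and s = s and t = t, OF star_cong.cong_mult] by (simp add: presented_star_algebra_def)
  show "term_class R s \<oplus>\<^bsub>presented_star_algebra R\<^esub> term_class R t = term_class R (Add s t)"
    using UN2[where f = Add and s = s and t = t, OF star_cong.cong_add] by (simp add: presented_star_algebra_def)
  show "c \<odot>\<^bsub>presented_star_algebra R\<^esub> term_class R s = term_class R (Scale c s)"
    using UN[of s "\<lambda>s. term_class R (Scale c s)", OF iffD2[OF term_class_eq_iff star_cong.cong_scale]]
    by (simp add: presented_star_algebra_def)
  show "star (presented_star_algebra R) (term_class R s) = term_class R (Star s)"
    using UN[of s "\<lambda>s. term_class R (Star s)", OF iffD2[OF term_class_eq_iff star_cong.cong_star]]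
    by (simp add: presented_star_algebra_def)
qed (simp_all add: presented_star_algebra_def)

lemmas star_cong_ring_axioms =
  star_cong.add_assoc star_cong.add_comm star_cong.add_zero star_cong.mult_assoc
  star_cong.mult_one_left star_cong.mult_one_right star_cong.mult_add_left star_cong.mult_add_right

lemma ring_presented_star_algebra: "ring (presented_star_algebra R)"
proof (rule ringI)
  show "abelian_group (presented_star_algebra R)"
  proof (rule abelian_groupI)
    fix u assume "u \<in> carrier (presented_star_algebra R)"
    then obtain s where u: "u = term_class R s" by (auto simp: presented_star_algebra_simps)
    have "star_cong R (Add (Scale (-1) s) s) Zero"
      using star_cong.add_neg star_cong.add_comm star_cong.trans by blast
    then show "\<exists>v\<in>carrier (presented_star_algebra R).
        v \<oplus>\<^bsub>presented_star_algebra R\<^esub> u = \<zero>\<^bsub>presented_star_algebra R\<^esub>"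
      by (intro bexI[of _ "term_class R (Scale (-1) s)"])
        (auto simp: u presented_star_algebra_simps term_class_eq_iff)
  qed (auto simp: presented_star_algebra_simps term_class_eq_iff intro: rangeI star_cong_ring_axioms
        del: equalityI)
  show "monoid (presented_star_algebra R)"
    by (rule monoidI)
      (auto simp: presented_star_algebra_simps term_class_eq_iff intro: rangeI star_cong_ring_axioms
        del: equalityI)
qed (auto simp: presented_star_algebra_simps term_class_eq_iff intro: rangeI star_cong_ring_axioms
        del: equalityI)

datatype two = G1 | G2

abbreviation Gen_star :: "'g \<Rightarrow> 'g sterm" where
  "Gen_star g \<equiv> Star (Gen g)"

definition A2_relations :: "complex \<Rightarrow> (two sterm \<times> two sterm) set" where
  "A2_relations x =
     {(Sub (Mult (Gen_star G1) (Gen G1)) (Mult (Gen G1) (Gen_star G1)), One),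
      (Sub (Mult (Gen_star G2) (Gen G2)) (Mult (Gen G2) (Gen_star G2)), One),
      (Mult (Gen_star G1) (Gen G2), Mult (Gen G2) (Gen_star G1)),
      (Sub (Mult (Gen G2) (Gen G1)) (Mult (Gen G1) (Gen G2)), Scale x One)}"

definition A2 :: "complex \<Rightarrow> two sterm set star_algebra" where
  "A2 x = presented_star_algebra (A2_relations x)"

definition A2_gen :: "complex \<Rightarrow> two \<Rightarrow> two sterm set" where
  "A2_gen x g = term_class (A2_relations x) (Gen g)"


section \<open>Unbounded star-representations\<close>

text \<open>A representation is given by its dense domain \<open>D\<close> and the family \<open>\<pi>\<close> of operators;
  the values of \<open>\<pi> u\<close> outside of \<open>D\<close> carry no information.\<close>

definition star_rep ::
    "('b, 'm) star_algebra_scheme \<Rightarrow> 'a::complex_hilbert set \<Rightarrow> ('b \<Rightarrow> 'a \<Rightarrow> 'a) \<Rightarrow> bool" where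
  "star_rep A D \<pi> \<longleftrightarrow> complex_subspace D \<and> closure D = UNIV \<and>
     (\<forall>u\<in>carrier A. \<forall>v\<in>D. \<pi> u v \<in> D) \<and>
     (\<forall>u\<in>carrier A. \<forall>v\<in>D. \<forall>w\<in>D. \<pi> u (v + w) = \<pi> u v + \<pi> u w) \<and>
     (\<forall>u\<in>carrier A. \<forall>c. \<forall>v\<in>D. \<pi> u (c *\<^sub>C v) = c *\<^sub>C \<pi> u v) \<and>
     (\<forall>v\<in>D. \<pi> \<one>\<^bsub>A\<^esub> v = v) \<and>
     (\<forall>u\<in>carrier A. \<forall>u'\<in>carrier A. \<forall>v\<in>D. \<pi> (u \<oplus>\<^bsub>A\<^esub> u') v = \<pi> u v + \<pi> u' v) \<and>
     (\<forall>u\<in>carrier A. \<forall>u'\<in>carrier A. \<forall>v\<in>D. \<pi> (u \<otimes>\<^bsub>A\<^esub> u') v = \<pi> u (\<pi> u' v)) \<and>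
     (\<forall>c. \<forall>u\<in>carrier A. \<forall>v\<in>D. \<pi> (c \<odot>\<^bsub>A\<^esub> u) v = c *\<^sub>C \<pi> u v) \<and>
     (\<forall>u\<in>carrier A. \<forall>v\<in>D. \<forall>w\<in>D. cinner (\<pi> u v) w = cinner v (\<pi> (star A u) w))"

definition invariant_subspace ::
    "('b, 'm) star_algebra_scheme \<Rightarrow> ('b \<Rightarrow> 'a::complex_hilbert \<Rightarrow> 'a) \<Rightarrow> 'a set \<Rightarrow> bool" where
  "invariant_subspace A \<pi> E \<longleftrightarrow> complex_subspace E \<and> (\<forall>u\<in>carrier A. \<forall>v\<in>E. \<pi> u v \<in> E)"

text \<open>Irreducible: nonzero and not an orthogonal direct sum of two nonzero star-representations.\<close>

definition irreducible_rep ::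
    "('b, 'm) star_algebra_scheme \<Rightarrow> 'a::complex_hilbert set \<Rightarrow> ('b \<Rightarrow> 'a \<Rightarrow> 'a) \<Rightarrow> bool" where
  "irreducible_rep A D \<pi> \<longleftrightarrow> D \<noteq> {0} \<and>
     (\<forall>D1 D2. invariant_subspace A \<pi> D1 \<and> invariant_subspace A \<pi> D2 \<and>
        (\<forall>v\<in>D1. \<forall>w\<in>D2. cinner v w = 0) \<and> D = {v + w |v w. v \<in> D1 \<and> w \<in> D2} \<longrightarrow>
        D1 = {0} \<or> D2 = {0})"

definition unitarily_equivalent ::
    "('b, 'm) star_algebra_scheme \<Rightarrow> 'a::complex_hilbert set \<Rightarrow> ('b \<Rightarrow> 'a \<Rightarrow> 'a) \<Rightarrow>
      'c::complex_hilbert set \<Rightarrow> ('b \<Rightarrow> 'c \<Rightarrow> 'c) \<Rightarrow> bool" where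
  "unitarily_equivalent A D \<pi> E \<rho> \<longleftrightarrow>
     (\<exists>T. unitary T \<and> T ` D = E \<and> (\<forall>u\<in>carrier A. \<forall>v\<in>D. T (\<pi> u v) = \<rho> u (T v)))"


section \<open>The Heisenberg group and well-behaved representations\<close>

text \<open>The five-dimensional Heisenberg group in exponential coordinates \<open>(p, q, t)\<close>; the same type
  serves as its Lie algebra, and the exponential map is the identity.\<close>

type_synonym heis = "(real \<times> real) \<times> (real \<times> real) \<times> real"

fun heis_mult :: "heis \<Rightarrow> heis \<Rightarrow> heis" where
  "heis_mult (p, q, t) (p', q', t') = (p + p', q + q', t + t' + (p \<bullet> q' - q \<bullet> p') / 2)"

definition heis_unitary_rep :: "(heis \<Rightarrow> 'a::complex_hilbert \<Rightarrow> 'a) \<Rightarrow> bool" where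
  "heis_unitary_rep U \<longleftrightarrow> (\<forall>g. unitary (U g)) \<and> (\<forall>g h. U (heis_mult g h) = U g \<circ> U h) \<and>
     (\<forall>v. continuous_on UNIV (\<lambda>g. U g v))"

primrec C_k :: "nat \<Rightarrow> ('b::euclidean_space \<Rightarrow> 'a::real_normed_vector) \<Rightarrow> bool" where
  "C_k 0 f \<longleftrightarrow> continuous_on UNIV f"
| "C_k (Suc k) f \<longleftrightarrow> (\<forall>x. f differentiable at x) \<and>
     (\<forall>h. C_k k (\<lambda>x. frechet_derivative f (at x) h))"

definition smooth_vectors :: "(heis \<Rightarrow> 'a::complex_hilbert \<Rightarrow> 'a) \<Rightarrow> 'a set" where
  "smooth_vectors U = {v. \<forall>k. C_k k (\<lambda>g. U g v)}"

definition heis_differential ::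
    "(heis \<Rightarrow> 'a::complex_hilbert \<Rightarrow> 'a) \<Rightarrow> heis \<Rightarrow> 'a \<Rightarrow> 'a" where
  "heis_differential U X v = vector_derivative (\<lambda>s. U (s *\<^sub>R X) v) (at 0)"

text \<open>The Lie algebra homomorphism from the Heisenberg Lie algebra to the CCR algebra: with
  \<open>c\<^sub>j = (Q\<^sub>j - \<i> P\<^sub>j) / \<surd>2\<close> it sends \<open>(p, q, t)\<close> to
  \<open>\<Sum>\<^sub>j (p\<^sub>j \<i> P\<^sub>j + q\<^sub>j \<i> Q\<^sub>j) + \<i> t\<close>. Note that \<open>c\<^sub>j\<close> is the creation operator.\<close>

fun heis_term :: "heis \<Rightarrow> two sterm" where
  "heis_term ((p1, p2), (q1, q2), t) =
     Add (Add
       (Add (Scale (p1 / sqrt 2) (Sub (Gen_star G1) (Gen G1)))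
            (Scale (p2 / sqrt 2) (Sub (Gen_star G2) (Gen G2))))
       (Add (Scale (\<i> * q1 / sqrt 2) (Add (Gen_star G1) (Gen G1)))
            (Scale (\<i> * q2 / sqrt 2) (Add (Gen_star G2) (Gen G2)))))
       (Scale (\<i> * t) One)"

definition heis_to_CCR :: "heis \<Rightarrow> two sterm set" where
  "heis_to_CCR X = term_class (A2_relations 0) (heis_term X)"

definition integrable_rep :: "'a::complex_hilbert set \<Rightarrow> (two sterm set \<Rightarrow> 'a \<Rightarrow> 'a) \<Rightarrow> bool" where
  "integrable_rep D \<pi> \<longleftrightarrow> star_rep (A2 0) D \<pi> \<and>
     (\<exists>U. heis_unitary_rep U \<and> D = smooth_vectors U \<and>
        (\<forall>X. \<forall>v\<in>D. \<pi> (heis_to_CCR X) v = heis_differential U X v))"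

definition well_behaved_rep ::
    "complex \<Rightarrow> 'a::complex_hilbert set \<Rightarrow> (two sterm set \<Rightarrow> 'a \<Rightarrow> 'a) \<Rightarrow> bool" where
  "well_behaved_rep x D \<pi> \<longleftrightarrow> star_rep (A2 x) D \<pi> \<and>
     (\<exists>\<Phi>. star_algebra_iso (A2 x) (A2 0) \<Phi> \<and>
        \<Phi> (A2_gen x G1) = A2_gen 0 G1 \<and>
        \<Phi> (A2_gen x G2) = complex_of_real (sqrt (1 + (cmod x)\<^sup>2)) \<odot>\<^bsub>A2 0\<^esub> A2_gen 0 G2
           \<oplus>\<^bsub>A2 0\<^esub> x \<odot>\<^bsub>A2 0\<^esub> star (A2 0) (A2_gen 0 G1) \<and>
        integrable_rep D (\<lambda>u. \<pi> (inv_into (carrier (A2 x)) \<Phi> u)))"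


section \<open>The Hilbert space of square-summable families\<close>

typedef 'i ell2 = "{f :: 'i \<Rightarrow> complex. (\<lambda>i. (cmod (f i))\<^sup>2) summable_on UNIV}"
  by (intro exI[of _ "\<lambda>_. 0"]) auto

lemma ell2_setI:
  assumes "\<And>F. finite F \<Longrightarrow> L2_set (\<lambda>i. cmod (f i)) F \<le> C"
  shows "f \<in> {f. (\<lambda>i. (cmod (f i))\<^sup>2) summable_on UNIV}"
    and "sqrt (\<Sum>\<^sub>\<infinity>i. (cmod (f i))\<^sup>2) \<le> C"
proof -
  have C: "0 \<le> C" using assms[of "{}"] by simp
  have b: "(\<Sum>i\<in>F. (cmod (f i))\<^sup>2) \<le> C\<^sup>2" if "finite F" for F
    using assms[OF that] by (simp add: L2_set_def sqrt_le_D)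
  have s: "(\<lambda>i. (cmod (f i))\<^sup>2) summable_on UNIV"
    by (rule nonneg_bdd_above_summable_on) (auto intro!: bdd_aboveI2 b)
  show "f \<in> {f. (\<lambda>i. (cmod (f i))\<^sup>2) summable_on UNIV}" using s by simp
  have "(\<Sum>\<^sub>\<infinity>i. (cmod (f i))\<^sup>2) \<le> C\<^sup>2"
    by (rule infsum_le_finite_sums[OF s]) (auto intro: b)
  then show "sqrt (\<Sum>\<^sub>\<infinity>i. (cmod (f i))\<^sup>2) \<le> C" using C by (simp add: real_le_lsqrt)
qed

lemma Rep_ell2_summable: "(\<lambda>i. (cmod (Rep_ell2 v i))\<^sup>2) summable_on UNIV"
  using Rep_ell2[of v] by simp

lemma L2_set_Rep_ell2_le:
  "finite F \<Longrightarrow> L2_set (\<lambda>i. cmod (Rep_ell2 v i)) F \<le> sqrt (\<Sum>\<^sub>\<infinity>i. (cmod (Rep_ell2 v i))\<^sup>2)"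
  unfolding L2_set_def by (intro real_sqrt_le_mono finite_sum_le_infsum Rep_ell2_summable) auto

lemma L2_set_cmod_add_le:
  assumes "L2_set (\<lambda>i. cmod (f i)) F \<le> C" "L2_set (\<lambda>i. cmod (g i)) F \<le> D"
  shows "L2_set (\<lambda>i. cmod (f i + g i)) F \<le> C + D"
proof -
  have "L2_set (\<lambda>i. cmod (f i + g i)) F \<le> L2_set (\<lambda>i. cmod (f i) + cmod (g i)) F"
    by (intro L2_set_mono norm_triangle_ineq) auto
  also have "\<dots> \<le> L2_set (\<lambda>i. cmod (f i)) F + L2_set (\<lambda>i. cmod (g i)) F"
    by (rule L2_set_triangle_ineq)
  finally show ?thesis using assms by linarith
qed

lemma ell2_add_mem:
  "(\<lambda>i. Rep_ell2 u i + Rep_ell2 v i) \<in> {f. (\<lambda>i. (cmod (f i))\<^sup>2) summable_on UNIV}"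
  by (rule ell2_setI(1), rule L2_set_cmod_add_le; rule L2_set_Rep_ell2_le)

lemma ell2_scale_mem:
  "(\<lambda>i. c * Rep_ell2 v i) \<in> {f. (\<lambda>i. (cmod (f i))\<^sup>2) summable_on UNIV}"
  using summable_on_cmult_right[OF Rep_ell2_summable[of v], of "(cmod c)\<^sup>2"]
  by (simp add: norm_mult power_mult_distrib)

lemma ell2_cinner_summable: "(\<lambda>i. cnj (Rep_ell2 u i) * Rep_ell2 v i) summable_on UNIV"
proof (rule abs_summable_summable, rule summable_on_comparison_test)
  show "(\<lambda>i. (cmod (Rep_ell2 u i))\<^sup>2 + (cmod (Rep_ell2 v i))\<^sup>2) summable_on UNIV"
    by (intro summable_on_add Rep_ell2_summable)
  show "norm (cnj (Rep_ell2 u i) * Rep_ell2 v i) \<le> (cmod (Rep_ell2 u i))\<^sup>2 + (cmod (Rep_ell2 v i))\<^sup>2"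
    for i
    using sum_squares_bound[of "cmod (Rep_ell2 u i)" "cmod (Rep_ell2 v i)"]
      mult_nonneg_nonneg[OF norm_ge_zero[of "Rep_ell2 u i"] norm_ge_zero[of "Rep_ell2 v i"]]
    by (simp only: norm_mult complex_mod_cnj)
qed auto

instantiation ell2 :: (type) real_normed_vector
begin

definition zero_ell2 :: "'a ell2" where "0 = Abs_ell2 (\<lambda>_. 0)"
definition plus_ell2 :: "'a ell2 \<Rightarrow> 'a ell2 \<Rightarrow> 'a ell2" where
  "u + v = Abs_ell2 (\<lambda>i. Rep_ell2 u i + Rep_ell2 v i)"
definition scaleR_ell2 :: "real \<Rightarrow> 'a ell2 \<Rightarrow> 'a ell2" where
  "r *\<^sub>R v = Abs_ell2 (\<lambda>i. complex_of_real r * Rep_ell2 v i)"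
definition uminus_ell2 :: "'a ell2 \<Rightarrow> 'a ell2" where "- v = (-1) *\<^sub>R v" for v :: "'a ell2"
definition minus_ell2 :: "'a ell2 \<Rightarrow> 'a ell2 \<Rightarrow> 'a ell2" where "u - v = u + - v" for u v :: "'a ell2"
definition norm_ell2 :: "'a ell2 \<Rightarrow> real" where
  "norm v = sqrt (\<Sum>\<^sub>\<infinity>i. (cmod (Rep_ell2 v i))\<^sup>2)"
definition sgn_ell2 :: "'a ell2 \<Rightarrow> 'a ell2" where "sgn v = inverse (norm v) *\<^sub>R v" for v :: "'a ell2"
definition dist_ell2 :: "'a ell2 \<Rightarrow> 'a ell2 \<Rightarrow> real" where "dist u v = norm (u - v)" for u v :: "'a ell2"
definition uniformity_ell2 :: "('a ell2 \<times> 'a ell2) filter" where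
  "uniformity = (INF e\<in>{0<..}. principal {(u, v :: 'a ell2). dist u v < e})"
definition open_ell2 :: "'a ell2 set \<Rightarrow> bool" where
  "open S \<longleftrightarrow> (\<forall>u\<in>S. \<forall>\<^sub>F (u', v) in uniformity. u' = u \<longrightarrow> v \<in> S)" for S :: "'a ell2 set"

lemma Rep_ell2_simps:
  "Rep_ell2 0 = (\<lambda>_. 0)"
  "Rep_ell2 (u + v) = (\<lambda>i. Rep_ell2 u i + Rep_ell2 v i)"
  "Rep_ell2 (r *\<^sub>R v) = (\<lambda>i. complex_of_real r * Rep_ell2 v i)"
  "Rep_ell2 (- v) = (\<lambda>i. - Rep_ell2 v i)"
  "Rep_ell2 (u - v) = (\<lambda>i. Rep_ell2 u i - Rep_ell2 v i)"
proof -
  show zero: "Rep_ell2 0 = (\<lambda>_. 0)" by (simp add: zero_ell2_def Abs_ell2_inverse)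
  show add: "Rep_ell2 (u + v) = (\<lambda>i. Rep_ell2 u i + Rep_ell2 v i)" for u v :: "'a ell2"
    unfolding plus_ell2_def by (rule Abs_ell2_inverse[OF ell2_add_mem])
  show scale: "Rep_ell2 (r *\<^sub>R v) = (\<lambda>i. complex_of_real r * Rep_ell2 v i)" for r and v :: "'a ell2"
    unfolding scaleR_ell2_def by (rule Abs_ell2_inverse[OF ell2_scale_mem])
  show "Rep_ell2 (- v) = (\<lambda>i. - Rep_ell2 v i)" "Rep_ell2 (u - v) = (\<lambda>i. Rep_ell2 u i - Rep_ell2 v i)"
    by (simp_all add: uminus_ell2_def minus_ell2_def add scale)
qed

lemma L2_set_Rep_le_norm: "finite F \<Longrightarrow> L2_set (\<lambda>i. cmod (Rep_ell2 v i)) F \<le> norm v"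
  unfolding norm_ell2_def by (rule L2_set_Rep_ell2_le)

lemma norm_ell2_leI:
  "(\<And>F. finite F \<Longrightarrow> L2_set (\<lambda>i. cmod (Rep_ell2 v i)) F \<le> C) \<Longrightarrow> norm v \<le> C"
  unfolding norm_ell2_def by (rule ell2_setI(2))

lemma cmod_Rep_le_norm: "cmod (Rep_ell2 v i) \<le> norm v"
  using L2_set_Rep_le_norm[of "{i}" v] by simp

instance
proof
  fix u v w :: "'a ell2" and r s :: real
  show "dist u v = norm (u - v)" "sgn u = inverse (norm u) *\<^sub>R u"
    by (simp_all add: dist_ell2_def sgn_ell2_def)
  show "uniformity = (INF e\<in>{0<..}. principal {(u, v :: 'a ell2). dist u v < e})"
    by (rule uniformity_ell2_def)
  show "open S \<longleftrightarrow> (\<forall>u\<in>S. \<forall>\<^sub>F (u', v) in uniformity. u' = u \<longrightarrow> v \<in> S)" for S :: "'a ell2 set"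
    by (rule open_ell2_def)
  show "u + v + w = u + (v + w)" "u + v = v + u" "0 + u = u" "- u + u = 0" "u - v = u + - v"
    "r *\<^sub>R (u + v) = r *\<^sub>R u + r *\<^sub>R v" "(r + s) *\<^sub>R u = r *\<^sub>R u + s *\<^sub>R u"
    "r *\<^sub>R s *\<^sub>R u = (r * s) *\<^sub>R u" "1 *\<^sub>R u = u"
    by (simp_all add: Rep_ell2_inject[symmetric] Rep_ell2_simps algebra_simps fun_eq_iff)
  show "norm u = 0 \<longleftrightarrow> u = 0"
  proof
    assume "norm u = 0"
    then have "Rep_ell2 u i = 0" for i using cmod_Rep_le_norm[of u i] by simp
    then show "u = 0" by (simp add: Rep_ell2_inject[symmetric] Rep_ell2_simps fun_eq_iff)
  qed (simp add: norm_ell2_def Rep_ell2_simps)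
  show "norm (u + v) \<le> norm u + norm v"
    by (rule norm_ell2_leI) (simp add: Rep_ell2_simps L2_set_cmod_add_le L2_set_Rep_le_norm)
  have "(\<Sum>\<^sub>\<infinity>i. (cmod (complex_of_real r * Rep_ell2 u i))\<^sup>2) = r\<^sup>2 * (\<Sum>\<^sub>\<infinity>i. (cmod (Rep_ell2 u i))\<^sup>2)"
    by (simp add: norm_mult power_mult_distrib infsum_cmult_right')
  then show "norm (r *\<^sub>R u) = \<bar>r\<bar> * norm u"
    by (simp add: norm_ell2_def Rep_ell2_simps real_sqrt_mult)
qed

end

lemma ell2_Cauchy_convergent:
  fixes X :: "nat \<Rightarrow> 'a ell2"
  assumes cauchy: "\<And>e. e > 0 \<Longrightarrow> \<exists>M. \<forall>m\<ge>M. \<forall>n\<ge>M. norm (X m - X n) < e"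
  shows "\<exists>L. \<forall>e>0. \<exists>M. \<forall>n\<ge>M. norm (X n - L) < e"
proof -
  have "Cauchy (\<lambda>n. Rep_ell2 (X n) i)" for i
  proof (rule metric_CauchyI)
    fix e :: real assume "e > 0"
    then obtain M where M: "\<forall>m\<ge>M. \<forall>n\<ge>M. norm (X m - X n) < e" using cauchy by blast
    have "dist (Rep_ell2 (X m) i) (Rep_ell2 (X n) i) \<le> norm (X m - X n)" for m n
      using cmod_Rep_le_norm[of "X m - X n" i] by (simp add: Rep_ell2_simps dist_norm)
    then show "\<exists>M. \<forall>m\<ge>M. \<forall>n\<ge>M. dist (Rep_ell2 (X m) i) (Rep_ell2 (X n) i) < e"
      using M by (meson le_less_trans)
  qed
  then have "\<forall>i. \<exists>l. (\<lambda>n. Rep_ell2 (X n) i) \<longlonglongrightarrow> l"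
    by (simp add: Cauchy_convergent_iff convergent_def)
  then obtain l where l: "\<And>i. (\<lambda>n. Rep_ell2 (X n) i) \<longlonglongrightarrow> l i" by metis
  have bound: "L2_set (\<lambda>i. cmod (Rep_ell2 (X n) i - l i)) F \<le> e"
    if "finite F" "\<forall>m\<ge>M. \<forall>n\<ge>M. norm (X m - X n) < e" "n \<ge> M" for F M e n
  proof (rule LIMSEQ_le_const2)
    show "(\<lambda>m. L2_set (\<lambda>i. cmod (Rep_ell2 (X n) i - Rep_ell2 (X m) i)) F)
        \<longlonglongrightarrow> L2_set (\<lambda>i. cmod (Rep_ell2 (X n) i - l i)) F"
      unfolding L2_set_def by (intro tendsto_intros l)
    have "L2_set (\<lambda>i. cmod (Rep_ell2 (X n) i - Rep_ell2 (X m) i)) F \<le> e" if "m \<ge> M" for m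
      using L2_set_Rep_le_norm[OF \<open>finite F\<close>, of "X n - X m"] that
        \<open>\<forall>m\<ge>M. \<forall>n\<ge>M. norm (X m - X n) < e\<close> \<open>n \<ge> M\<close>
      by (force simp: Rep_ell2_simps)
    then show "\<exists>N. \<forall>m\<ge>N. L2_set (\<lambda>i. cmod (Rep_ell2 (X n) i - Rep_ell2 (X m) i)) F \<le> e"
      by blast
  qed
  obtain M where M: "\<forall>m\<ge>M. \<forall>n\<ge>M. norm (X m - X n) < 1" using cauchy[of 1] by auto
  have "L2_set (\<lambda>i. cmod (l i)) F \<le> 1 + norm (X M)" if "finite F" for F
    using L2_set_cmod_add_le[where f = "\<lambda>i. - (Rep_ell2 (X M) i - l i)" and g = "Rep_ell2 (X M)",
        OF _ L2_set_Rep_le_norm[OF that], of 1] bound[OF that M, of M]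
    by (simp add: norm_minus_commute)
  then have Rep: "Rep_ell2 (Abs_ell2 l) = l"
    by (intro Abs_ell2_inverse ell2_setI(1))
  show ?thesis
  proof (rule exI[of _ "Abs_ell2 l"], intro allI impI)
    fix e :: real assume "e > 0"
    then obtain M where M: "\<forall>m\<ge>M. \<forall>n\<ge>M. norm (X m - X n) < e / 2"
      using cauchy[of "e / 2"] by auto
    have "norm (X n - Abs_ell2 l) \<le> e / 2" if "n \<ge> M" for n
      using bound[OF _ M that] by (intro norm_ell2_leI) (simp add: Rep_ell2_simps Rep)
    then show "\<exists>M. \<forall>n\<ge>M. norm (X n - Abs_ell2 l) < e"
      using \<open>e > 0\<close> by (intro exI[of _ M]) force
  qed
qed

instance ell2 :: (type) banach
proof
  fix X :: "nat \<Rightarrow> 'a ell2"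
  assume X: "Cauchy X"
  have "\<exists>M. \<forall>m\<ge>M. \<forall>n\<ge>M. norm (X m - X n) < e" if "e > 0" for e
    using X that by (simp add: Cauchy_def dist_norm)
  from ell2_Cauchy_convergent[OF this] show "convergent X"
    unfolding convergent_def tendsto_iff eventually_sequentially dist_norm .
qed

instantiation ell2 :: (type) complex_hilbert
begin

definition scaleC_ell2 :: "complex \<Rightarrow> 'a ell2 \<Rightarrow> 'a ell2" where
  "c *\<^sub>C v = Abs_ell2 (\<lambda>i. c * Rep_ell2 v i)"
definition cinner_ell2 :: "'a ell2 \<Rightarrow> 'a ell2 \<Rightarrow> complex" where
  "cinner u v = (\<Sum>\<^sub>\<infinity>i. cnj (Rep_ell2 u i) * Rep_ell2 v i)"

lemma Rep_ell2_scaleC: "Rep_ell2 (c *\<^sub>C v) = (\<lambda>i. c * Rep_ell2 v i)"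
  unfolding scaleC_ell2_def by (rule Abs_ell2_inverse[OF ell2_scale_mem])

instance
proof
  fix u v w :: "'a ell2" and c d :: complex and r :: real
  show "c *\<^sub>C (u + v) = c *\<^sub>C u + c *\<^sub>C v" "(c + d) *\<^sub>C u = c *\<^sub>C u + d *\<^sub>C u"
    "c *\<^sub>C (d *\<^sub>C u) = (c * d) *\<^sub>C u" "r *\<^sub>R u = complex_of_real r *\<^sub>C u"
    by (simp_all add: Rep_ell2_inject[symmetric] Rep_ell2_simps Rep_ell2_scaleC algebra_simps fun_eq_iff)
  show "cinner u v = cnj (cinner v u)"
    by (simp add: cinner_ell2_def mult.commute flip: infsum_cnj)
  show "cinner u (v + w) = cinner u v + cinner u w"
    by (simp add: cinner_ell2_def Rep_ell2_simps distrib_left infsum_add ell2_cinner_summable)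
  show "cinner u (c *\<^sub>C v) = c * cinner u v"
    by (simp add: cinner_ell2_def Rep_ell2_scaleC mult.left_commute infsum_cmult_right')
  have "cnj (Rep_ell2 u i) * Rep_ell2 u i = complex_of_real ((cmod (Rep_ell2 u i))\<^sup>2)" for i
    by (metis complex_norm_square mult.commute)
  moreover have "(\<Sum>\<^sub>\<infinity>i. complex_of_real ((cmod (Rep_ell2 u i))\<^sup>2))
      = complex_of_real (\<Sum>\<^sub>\<infinity>i. (cmod (Rep_ell2 u i))\<^sup>2)"
    by (intro infsumI iffD2[OF has_sum_of_real_iff] has_sum_infsum Rep_ell2_summable)
  ultimately have "cinner u u = complex_of_real (\<Sum>\<^sub>\<infinity>i. (cmod (Rep_ell2 u i))\<^sup>2)"
    by (simp add: cinner_ell2_def del: of_real_power)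
  then show "norm u = sqrt (Re (cinner u u))"
    by (simp add: norm_ell2_def)
qed

end


section \<open>The Fock representation\<close>

text \<open>The Hilbert space tensor product of \<open>'i ell2\<close> and \<open>'j ell2\<close> is realised as
  \<open>('i \<times> 'j) ell2\<close>, with elementary tensors as follows.\<close>

definition ell2_tensor :: "'i ell2 \<Rightarrow> 'j ell2 \<Rightarrow> ('i \<times> 'j) ell2" where
  "ell2_tensor u v = Abs_ell2 (\<lambda>(i, j). Rep_ell2 u i * Rep_ell2 v j)"

definition ket :: "'i \<Rightarrow> 'i ell2" where
  "ket i = Abs_ell2 (\<lambda>j. if j = i then 1 else 0)"

text \<open>The operators \<open>A \<otimes> 1\<close> and \<open>1 \<otimes> A\<close>, applied slice by slice.\<close>

definition tensor_id :: "('i ell2 \<Rightarrow> 'i ell2) \<Rightarrow> ('i \<times> 'j) ell2 \<Rightarrow> ('i \<times> 'j) ell2" where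
  "tensor_id A v = Abs_ell2 (\<lambda>(i, j). Rep_ell2 (A (Abs_ell2 (\<lambda>i'. Rep_ell2 v (i', j)))) i)"

definition id_tensor :: "('j ell2 \<Rightarrow> 'j ell2) \<Rightarrow> ('i \<times> 'j) ell2 \<Rightarrow> ('i \<times> 'j) ell2" where
  "id_tensor A v = Abs_ell2 (\<lambda>(i, j). Rep_ell2 (A (Abs_ell2 (\<lambda>j'. Rep_ell2 v (i, j')))) j)"

text \<open>These two operators are meaningful only where the resulting sequence is square-summable.\<close>

definition creation :: "nat ell2 \<Rightarrow> nat ell2" where
  "creation v = Abs_ell2 (\<lambda>n. case n of 0 \<Rightarrow> 0 | Suc k \<Rightarrow> sqrt (Suc k) * Rep_ell2 v k)"

definition annihilation :: "nat ell2 \<Rightarrow> nat ell2" where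
  "annihilation v = Abs_ell2 (\<lambda>n. sqrt (Suc n) * Rep_ell2 v (Suc n))"

definition rapidly_decreasing :: "(nat \<times> nat) ell2 set" where
  "rapidly_decreasing =
     {v. \<forall>k::nat. \<exists>C. \<forall>m n. (1 + real m + real n) ^ k * cmod (Rep_ell2 v (m, n)) \<le> C}"

lemma ell2_finite_support_mem:
  "finite {i. f i \<noteq> 0} \<Longrightarrow> f \<in> {f. (\<lambda>i. (cmod (f i))\<^sup>2) summable_on UNIV}"
  using summable_on_cong_neutral[of UNIV "{i. f i \<noteq> 0}" "\<lambda>i. (cmod (f i))\<^sup>2" "\<lambda>i. (cmod (f i))\<^sup>2"]
  by auto

lemma Rep_ket: "Rep_ell2 (ket i) = (\<lambda>j. if j = i then 1 else 0)"
  unfolding ket_def by (rule Abs_ell2_inverse, rule ell2_finite_support_mem) simp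

lemma Rep_ell2_tensor: "Rep_ell2 (ell2_tensor u v) = (\<lambda>(i, j). Rep_ell2 u i * Rep_ell2 v j)"
  unfolding ell2_tensor_def
proof (rule Abs_ell2_inverse, rule ell2_setI(1))
  fix F :: "('a \<times> 'b) set" assume F: "finite F"
  have "L2_set (\<lambda>k. cmod (case k of (i, j) \<Rightarrow> Rep_ell2 u i * Rep_ell2 v j)) F
      \<le> L2_set (\<lambda>(i, j). cmod (Rep_ell2 u i) * cmod (Rep_ell2 v j)) (fst ` F \<times> snd ` F)"
    unfolding L2_set_def using F
    by (intro real_sqrt_le_mono order_trans[OF _ sum_mono2[of "fst ` F \<times> snd ` F" F]])
      (auto simp: norm_mult image_iff split_beta intro!: sum_mono, force+)
  also have "\<dots> = L2_set (\<lambda>i. cmod (Rep_ell2 u i)) (fst ` F) * L2_set (\<lambda>j. cmod (Rep_ell2 v j)) (snd ` F)"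
    by (simp add: L2_set_def real_sqrt_mult[symmetric] sum_product sum.cartesian_product
        power_mult_distrib split_beta)
  also have "\<dots> \<le> norm u * norm v"
    using F by (intro mult_mono L2_set_Rep_le_norm) (auto simp: L2_set_nonneg)
  finally show "L2_set (\<lambda>k. cmod (case k of (i, j) \<Rightarrow> Rep_ell2 u i * Rep_ell2 v j)) F
      \<le> norm u * norm v" .
qed

lemma ket_tensor_ket: "ell2_tensor (ket i) (ket j) = ket (i, j)"
  by (auto simp: Rep_ell2_inject[symmetric] Rep_ell2_tensor Rep_ket fun_eq_iff)

lemma tensor_id_ell2_tensor:
  assumes "\<And>c u. A (c *\<^sub>C u) = c *\<^sub>C A u"
  shows "tensor_id A (ell2_tensor u v) = ell2_tensor (A u) v"
proof -
  have "Abs_ell2 (\<lambda>i. Rep_ell2 u i * Rep_ell2 v j) = Rep_ell2 v j *\<^sub>C u" for j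
    by (simp add: scaleC_ell2_def mult.commute)
  then show ?thesis
    by (simp add: tensor_id_def Rep_ell2_tensor assms Rep_ell2_scaleC)
      (simp add: ell2_tensor_def mult.commute)
qed

lemma id_tensor_ell2_tensor:
  assumes "\<And>c v. A (c *\<^sub>C v) = c *\<^sub>C A v"
  shows "id_tensor A (ell2_tensor u v) = ell2_tensor u (A v)"
proof -
  have "Abs_ell2 (\<lambda>j. Rep_ell2 u i * Rep_ell2 v j) = Rep_ell2 u i *\<^sub>C v" for i
    by (simp add: scaleC_ell2_def)
  then show ?thesis
    by (simp add: id_tensor_def Rep_ell2_tensor assms Rep_ell2_scaleC)
      (simp add: ell2_tensor_def)
qed

lemma creation_ket: "creation (ket n) = complex_of_real (sqrt (real n + 1)) *\<^sub>C ket (Suc n)"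
  unfolding creation_def scaleC_ell2_def Rep_ket
  by (rule arg_cong[of _ _ Abs_ell2]) (auto simp: fun_eq_iff add.commute split: nat.split)

lemma annihilation_ket:
  "annihilation (ket n) = (if n = 0 then 0 else complex_of_real (sqrt (real n)) *\<^sub>C ket (n - 1))"
  unfolding annihilation_def scaleC_ell2_def zero_ell2_def Rep_ket if_distrib[symmetric]
  by (cases n) (auto simp: fun_eq_iff intro!: arg_cong[of _ _ Abs_ell2])

end

theory Submission
  imports Defs "HOL-Probability.Probability" "HOL-Complex_Analysis.Complex_Analysis"
begin

text \<open>After the substitution \<open>a\<^sub>2 = (1 + |x|\<^sup>2)\<^sup>1\<^sup>/\<^sup>2 c\<^sub>2 + x c\<^sub>1\<^sup>*\<close> the theorem is the Stone--von Neumann theorem for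
  two degrees of freedom. For existence, the Weyl operators are the isometries that move the coherent
  vectors \<open>exp (w\<^sub>1 c\<^sub>1 + w\<^sub>2 c\<^sub>2) (e\<^sub>0 \<otimes> e\<^sub>0)\<close> of the Fock space to multiples of coherent vectors; they exist because
  the Gram matrix is preserved. Iterating the number operator shows that the smooth vectors are the
  rapidly decreasing families. For uniqueness, let \<open>\<Omega>\<close> be the average of \<open>U z v\<close> with weight
  \<open>exp (- |z|\<^sup>2 / 4)\<close>. Along complex lines \<open>exp (|w|\<^sup>2 / 4) \<langle>\<Omega>, U w \<Omega>\<rangle>\<close> is an entire function \<open>f\<close> with
  \<open>f (- c) = (f c)\<^sup>*\<close>, hence constant. So the orbit of \<open>\<Omega>\<close> has the Gram matrix of the orbit of the Fock
  vacuum, which gives an isometric intertwiner; it is onto by irreducibility.\<close>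

section \<open>Complex Hilbert spaces\<close>

text \<open>The weight \<open>exp (- |z|^2 / 4)\<close> is the vacuum expectation of the Weyl
  operator at \<open>z\<close> in the Fock representation, so averaging against it is, up to a
  constant, von Neumann's projection onto the vacuum vectors. The classical argument composes two
  such averages and evaluates a double integral of operators. Here only one copy of Omega in the
  matrix coefficient is written as an integral while the other stays an arbitrary vector; holomorphy
  replaces the composition, and every integral is a scalar one. Two features of the definitions
  shape the rest. The domain of a well-behaved representation is exactly the space of smooth
  vectors, so a dense core does not suffice: smooth vectors and rapidly decreasing families have to
  coincide, and an intertwiner must carry one domain onto the other. Irreducibility speaks of
  splittings of that domain, not of closed subspaces; it becomes applicable because the projection
  onto a closed invariant subspace commutes with the group and therefore preserves
  smoothness.\<close>

lemma scaleC_one [simp]: "1 *\<^sub>C u = (u :: 'a::complex_hilbert)"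
  using scaleR_scaleC[of 1 u] by simp

lemma scaleC_zero_left [simp]: "0 *\<^sub>C u = (0 :: 'a::complex_hilbert)"
  using scaleR_scaleC[of 0 u] by simp

lemma scaleC_minus_one: "(-1) *\<^sub>C u = - (u :: 'a::complex_hilbert)"
  using scaleR_scaleC[of "-1" u] by simp

lemma scaleC_zero_right [simp]: "c *\<^sub>C 0 = (0 :: 'a::complex_hilbert)"
  using scaleC_add_right[of c 0 "0 :: 'a"] by simp

lemma scaleC_minus_right: "c *\<^sub>C (- u) = - (c *\<^sub>C (u :: 'a::complex_hilbert))"
  by (metis scaleC_scaleC scaleC_minus_one mult.commute)

lemma scaleC_minus_left: "(- c) *\<^sub>C u = - (c *\<^sub>C (u :: 'a::complex_hilbert))"
  by (metis scaleC_scaleC scaleC_minus_one mult_minus1)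

lemma scaleC_diff_right: "c *\<^sub>C (u - v) = c *\<^sub>C u - c *\<^sub>C (v :: 'a::complex_hilbert)"
  using scaleC_add_right[of c u "- v"] by (simp add: scaleC_minus_right)

lemma scaleC_diff_left: "(c - d) *\<^sub>C u = c *\<^sub>C u - d *\<^sub>C (u :: 'a::complex_hilbert)"
  using scaleC_add_left[of c "- d" u] by (simp add: scaleC_minus_left)

lemma scaleR_scaleC_assoc: "c *\<^sub>C (r *\<^sub>R u) = r *\<^sub>R (c *\<^sub>C (u :: 'a::complex_hilbert))"
  by (simp add: scaleR_scaleC scaleC_scaleC mult.commute)

lemma cinner_add_left: "cinner (u + v) w = cinner u w + cinner (v :: 'a::complex_hilbert) w"
  by (metis cinner_add_right cinner_commute complex_cnj_add)

lemma cinner_scaleC_left: "cinner (c *\<^sub>C u) v = cnj c * cinner u (v :: 'a::complex_hilbert)"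
  by (metis cinner_scaleC_right cinner_commute complex_cnj_mult)

lemma cinner_scaleR_left: "cinner (r *\<^sub>R u) v = r *\<^sub>R cinner u (v :: 'a::complex_hilbert)"
  by (simp add: scaleR_scaleC cinner_scaleC_left scaleR_conv_of_real)

lemma cinner_scaleR_right: "cinner u (r *\<^sub>R v) = r *\<^sub>R cinner u (v :: 'a::complex_hilbert)"
  by (simp add: scaleR_scaleC cinner_scaleC_right scaleR_conv_of_real)

lemma cinner_zero_left [simp]: "cinner 0 (v :: 'a::complex_hilbert) = 0"
  using cinner_scaleR_left[of 0 v v] by simp

lemma cinner_zero_right [simp]: "cinner (v :: 'a::complex_hilbert) 0 = 0"
  using cinner_scaleR_right[of v 0 v] by simp

lemma cinner_minus_left: "cinner (- u) v = - cinner u (v :: 'a::complex_hilbert)"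
  using cinner_scaleR_left[of "-1" u v] by simp

lemma cinner_minus_right: "cinner u (- v) = - cinner u (v :: 'a::complex_hilbert)"
  using cinner_scaleR_right[of u "-1" v] by simp

lemma cinner_diff_left: "cinner (u - v) w = cinner u w - cinner (v :: 'a::complex_hilbert) w"
  using cinner_add_left[of u "- v" w] by (simp add: cinner_minus_left)

lemma cinner_diff_right: "cinner w (u - v) = cinner w u - cinner w (v :: 'a::complex_hilbert)"
  using cinner_add_right[of w u "- v"] by (simp add: cinner_minus_right)

lemmas cinner_simps = cinner_add_left cinner_add_right cinner_diff_left cinner_diff_right
  cinner_scaleC_left cinner_scaleC_right cinner_minus_left cinner_minus_right

lemma cinner_self: "cinner u u = complex_of_real ((norm (u :: 'a::complex_hilbert))\<^sup>2)"
proof -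
  have "Im (cinner u u) = 0" using cinner_commute[of u u] by (simp add: complex_eq_iff)
  moreover have "Re (cinner u u) \<ge> 0"
    using norm_eq_sqrt_cinner[of u] norm_ge_zero[of u] real_sqrt_ge_0_iff by metis
  ultimately show ?thesis by (simp add: complex_eq_iff norm_eq_sqrt_cinner)
qed

lemma norm_square_cinner: "(norm (u :: 'a::complex_hilbert))\<^sup>2 = Re (cinner u u)"
  by (simp add: cinner_self)

lemma cinner_self_eq_zero [simp]: "cinner u u = 0 \<longleftrightarrow> (u :: 'a::complex_hilbert) = 0"
  by (simp add: cinner_self)

lemma norm_scaleC: "norm (c *\<^sub>C u) = cmod c * norm (u :: 'a::complex_hilbert)"
proof -
  have "cinner (c *\<^sub>C u) (c *\<^sub>C u) = (c * cnj c) * cinner u u"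
    by (simp add: cinner_scaleC_left cinner_scaleC_right)
  also have "\<dots> = complex_of_real ((cmod c * norm u)\<^sup>2)"
    by (simp add: cinner_self power_mult_distrib complex_norm_square[symmetric])
  finally have "(norm (c *\<^sub>C u))\<^sup>2 = (cmod c * norm u)\<^sup>2"
    by (simp only: norm_square_cinner Re_complex_of_real)
  then show ?thesis by (simp add: power2_eq_iff_nonneg)
qed

lemma norm_add_square: "(norm (u + v))\<^sup>2 = (norm u)\<^sup>2 + (norm v)\<^sup>2 + 2 * Re (cinner u (v :: 'a::complex_hilbert))"
  unfolding norm_square_cinner using cinner_commute[of u v]
  by (simp add: cinner_simps)

lemma cinner_Cauchy_Schwarz: "cmod (cinner u v) \<le> norm u * norm (v :: 'a::complex_hilbert)"
proof (cases "u = 0")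
  case False
  \<comment> \<open>The coefficient that makes \<open>v + c *\<^sub>C u\<close> orthogonal to
    \<open>u\<close>; the inequality is the nonnegativity of the squared norm of this
    remainder.\<close>
  define c where "c = - cinner u v / complex_of_real ((norm u)\<^sup>2)"
  have n: "norm u > 0" using False by simp
  have "0 \<le> (norm (v + c *\<^sub>C u))\<^sup>2" by simp
  also have "\<dots> = (norm v)\<^sup>2 + (cmod c * norm u)\<^sup>2 + 2 * Re (c * cinner v u)"
    by (simp add: norm_add_square norm_scaleC cinner_simps)
  also have "c * cinner v u = - complex_of_real ((cmod (cinner u v))\<^sup>2 / (norm u)\<^sup>2)"
    unfolding c_def cinner_commute[of v u] using complex_norm_square[of "cinner u v"] by simp
  also have "cmod c = cmod (cinner u v) / (norm u)\<^sup>2"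
    by (simp add: c_def norm_divide norm_power)
  finally have "(cmod (cinner u v))\<^sup>2 / (norm u)\<^sup>2 \<le> (norm v)\<^sup>2"
    using n by (simp add: power2_eq_square field_simps)
  then have "(cmod (cinner u v))\<^sup>2 \<le> (norm u * norm v)\<^sup>2"
    using n by (simp add: field_simps power_mult_distrib)
  then show ?thesis by (rule power2_le_imp_le) simp
qed simp

lemma bounded_bilinear_cinner: "bounded_bilinear (cinner :: 'a::complex_hilbert \<Rightarrow> 'a \<Rightarrow> complex)"
  by (rule bounded_bilinear.intro)
    (auto simp: cinner_simps cinner_scaleR_left cinner_scaleR_right
      intro!: exI[of _ 1] cinner_Cauchy_Schwarz)

lemma bounded_bilinear_scaleC: "bounded_bilinear (scaleC :: complex \<Rightarrow> 'a::complex_hilbert \<Rightarrow> 'a)"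
  by (rule bounded_bilinear.intro)
    (auto simp: scaleC_add_left scaleC_add_right scaleR_scaleC_assoc scaleR_scaleC scaleC_scaleC
      scaleR_conv_of_real norm_scaleC mult.commute intro!: exI[of _ 1])

lemmas continuous_on_cinner [continuous_intros] =
  bounded_bilinear.continuous_on[OF bounded_bilinear_cinner]
lemmas continuous_on_scaleC [continuous_intros] =
  bounded_bilinear.continuous_on[OF bounded_bilinear_scaleC]
lemmas tendsto_scaleC [tendsto_intros] = bounded_bilinear.tendsto[OF bounded_bilinear_scaleC]
lemmas bounded_linear_cinner_right = bounded_bilinear.bounded_linear_right[OF bounded_bilinear_cinner]
lemmas bounded_linear_cinner_left = bounded_bilinear.bounded_linear_left[OF bounded_bilinear_cinner]
lemmas bounded_linear_scaleC_right = bounded_bilinear.bounded_linear_right[OF bounded_bilinear_scaleC]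

lemma complex_subspaceD:
  assumes "complex_subspace M"
  shows "0 \<in> M" "u \<in> M \<Longrightarrow> v \<in> M \<Longrightarrow> u + v \<in> M" "u \<in> M \<Longrightarrow> c *\<^sub>C u \<in> M"
    "u \<in> M \<Longrightarrow> v \<in> M \<Longrightarrow> u - v \<in> M" "u \<in> M \<Longrightarrow> r *\<^sub>R u \<in> M"
proof -
  show *: "0 \<in> M" "u \<in> M \<Longrightarrow> v \<in> M \<Longrightarrow> u + v \<in> M" "u \<in> M \<Longrightarrow> c *\<^sub>C u \<in> M" for u v c
    using assms by (auto simp: complex_subspace_def)
  show "u \<in> M \<Longrightarrow> v \<in> M \<Longrightarrow> u - v \<in> M"
    using *(2)[of u "(-1) *\<^sub>C v"] *(3)[of v "-1"] by (simp add: scaleC_minus_one)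
  show "u \<in> M \<Longrightarrow> r *\<^sub>R u \<in> M" using *(3)[of u] by (simp add: scaleR_scaleC)
qed

lemma subspace_closure:
  fixes M :: "'a::real_normed_vector set"
  assumes M: "subspace M"
  shows "subspace (closure M)"
  unfolding subspace_def
proof (intro conjI ballI allI)
  show "0 \<in> closure M" using subspace_0[OF M] closure_subset by blast
next
  fix u v assume "u \<in> closure M" "v \<in> closure M"
  then obtain f g where "\<forall>n. f n \<in> M" "f \<longlonglongrightarrow> u" "\<forall>n. g n \<in> M" "g \<longlonglongrightarrow> v"
    by (auto simp: closure_sequential)
  then show "u + v \<in> closure M"
    using subspace_add[OF M]
    by (auto simp: closure_sequential intro!: exI[of _ "\<lambda>n. f n + g n"] tendsto_add)
next
  fix c u assume "u \<in> closure M"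
  then obtain f where "\<forall>n. f n \<in> M" "f \<longlonglongrightarrow> u" by (auto simp: closure_sequential)
  then show "c *\<^sub>R u \<in> closure M"
    using subspace_scale[OF M]
    by (auto simp: closure_sequential intro!: exI[of _ "\<lambda>n. c *\<^sub>R f n"] tendsto_intros)
qed

lemma complex_subspace_closure:
  assumes "complex_subspace M"
  shows "complex_subspace (closure M)"
proof -
  note M = complex_subspaceD[OF assms]
  show ?thesis
    unfolding complex_subspace_def
  proof (intro conjI ballI allI)
    show "0 \<in> closure M" using M(1) closure_subset by blast
  next
    fix u v assume "u \<in> closure M" "v \<in> closure M"
    then obtain f g where "\<forall>n. f n \<in> M" "f \<longlonglongrightarrow> u" "\<forall>n. g n \<in> M" "g \<longlonglongrightarrow> v"
      by (auto simp: closure_sequential)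
    then show "u + v \<in> closure M"
      using M(2) by (auto simp: closure_sequential intro!: exI[of _ "\<lambda>n. f n + g n"] tendsto_add)
  next
    fix c u assume "u \<in> closure M"
    then obtain f where "\<forall>n. f n \<in> M" "f \<longlonglongrightarrow> u" by (auto simp: closure_sequential)
    then show "c *\<^sub>C u \<in> closure M"
      using M(3) by (auto simp: closure_sequential intro!: exI[of _ "\<lambda>n. c *\<^sub>C f n"] tendsto_intros)
  qed
qed

section \<open>Nearest points, orthogonal complements and the Riesz theorem\<close>

lemma parallelogram:
  "(norm (u + v))\<^sup>2 + (norm (u - v))\<^sup>2 = 2 * (norm u)\<^sup>2 + 2 * (norm (v :: 'a::complex_hilbert))\<^sup>2"
  unfolding norm_square_cinner by (simp add: cinner_simps)

text \<open>The midpoint of two nearly optimal points lies in \<open>M\<close> and so has distance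
  at least \<open>d\<close> from \<open>v\<close>; by the parallelogram law a minimising sequence is
  then Cauchy, and closedness keeps its limit in \<open>M\<close>.\<close>

lemma closed_subspace_nearest_point:
  assumes M: "complex_subspace M" and cl: "closed M"
  shows "\<exists>k\<in>M. \<forall>m\<in>M. norm (v - k) \<le> norm (v - m)"
proof -
  note S = complex_subspaceD[OF M]
  define d where "d = (INF m\<in>M. norm (v - m))"
  have bdd: "bdd_below ((\<lambda>m. norm (v - m)) ` M)" by (rule bdd_belowI2[of _ 0]) simp
  have ne: "M \<noteq> {}" using S(1) by blast
  have dle: "d \<le> norm (v - m)" if "m \<in> M" for m
    unfolding d_def using bdd that by (rule cINF_lower)
  have d0: "d \<ge> 0" unfolding d_def using ne by (intro cINF_greatest) auto
  have "\<exists>m\<in>M. norm (v - m) < d + 1 / Suc n" for n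
    using cINF_less_iff[OF ne bdd, of "d + 1 / Suc n"] by (simp add: d_def)
  then obtain k where kM: "\<And>n. k n \<in> M" and kd: "\<And>n. norm (v - k n) < d + 1 / Suc n" by metis
  have est: "(norm (k n - k m))\<^sup>2 \<le> (8 * d + 4) / Suc N" if "n \<ge> N" "m \<ge> N" for m n N
  proof -
    define e :: real where "e = 1 / Suc N"
    have e: "0 < e" "e \<le> 1" by (simp_all add: e_def)
    have b: "(norm (v - k j))\<^sup>2 \<le> (d + e)\<^sup>2" if "j \<ge> N" for j
    proof -
      have "1 / real (Suc j) \<le> e" using that by (simp add: e_def frac_le)
      then show ?thesis using kd[of j] by (intro power_mono) auto
    qed
    have "(1/2) *\<^sub>R (k n + k m) \<in> M" by (intro S kM)
    from dle[OF this] have "2 * d \<le> norm (2 *\<^sub>R (v - (1/2) *\<^sub>R (k n + k m)))" by simp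
    also have "2 *\<^sub>R (v - (1/2) *\<^sub>R (k n + k m)) = (v - k n) + (v - k m)"
      by (simp add: algebra_simps scaleR_2)
    finally have "(2 * d)\<^sup>2 \<le> (norm ((v - k n) + (v - k m)))\<^sup>2" using d0 by (intro power_mono) auto
    moreover have "norm (k n - k m) = norm ((v - k n) - (v - k m))" by (simp add: norm_minus_commute)
    ultimately have "(norm (k n - k m))\<^sup>2 \<le> 4 * (d + e)\<^sup>2 - 4 * d\<^sup>2"
      using parallelogram[of "v - k n" "v - k m"] b[OF that(1)] b[OF that(2)]
      by (simp add: power_mult_distrib)
    also have "\<dots> = (8 * d + 4 * e) * e" by (simp add: power2_eq_square algebra_simps)
    also have "\<dots> \<le> (8 * d + 4) * e" using e d0 by (intro mult_right_mono) auto
    finally show ?thesis by (simp add: e_def)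
  qed
  have "Cauchy k"
  proof (rule CauchyI)
    fix e :: real assume e: "e > 0"
    obtain N where "(8 * d + 4) / e\<^sup>2 < real N" using reals_Archimedean2 by blast
    then have N: "(8 * d + 4) / e\<^sup>2 < Suc N" by simp
    have "norm (k m - k n) < e" if "m \<ge> N" "n \<ge> N" for m n
    proof -
      have "(norm (k m - k n))\<^sup>2 \<le> (8 * d + 4) / Suc N" using est that by blast
      also have "\<dots> < e\<^sup>2" using N e by (simp add: field_simps)
      finally show ?thesis using e by (simp add: power_less_imp_less_base)
    qed
    then show "\<exists>M. \<forall>m\<ge>M. \<forall>n\<ge>M. norm (k m - k n) < e" by blast
  qed
  then obtain l where l: "k \<longlonglongrightarrow> l" using Cauchy_convergent_iff convergent_def by blast
  have lM: "l \<in> M" using closed_sequentially[OF cl _ l] kM by blast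
  have "norm (v - l) \<le> d"
  proof (rule LIMSEQ_le)
    show "(\<lambda>n. norm (v - k n)) \<longlonglongrightarrow> norm (v - l)" by (intro tendsto_intros l)
    show "(\<lambda>n. d + 1 / Suc n) \<longlonglongrightarrow> d"
      using tendsto_add[OF tendsto_const LIMSEQ_inverse_real_of_nat, of d] by (simp add: inverse_eq_divide)
    show "\<exists>N. \<forall>n\<ge>N. norm (v - k n) \<le> d + 1 / Suc n" using kd less_imp_le by blast
  qed
  then show ?thesis using lM dle order_trans by blast
qed

lemma orthogonal_decomposition:
  fixes M :: "'a::complex_hilbert set"
  assumes M: "complex_subspace M" and cl: "closed M"
  shows "\<exists>k\<in>M. \<forall>m\<in>M. cinner m (v - k) = 0"
proof -
  note S = complex_subspaceD[OF M]
  obtain k where k: "k \<in> M" "\<And>m. m \<in> M \<Longrightarrow> norm (v - k) \<le> norm (v - m)"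
    using closed_subspace_nearest_point[OF M cl] by blast
  have "cinner m (v - k) = 0" if "m \<in> M" for m
  proof (cases "m = 0")
    case False
    define z where "z = cinner m (v - k)"
    \<comment> \<open>Moving \<open>k\<close> by \<open>c *\<^sub>C m\<close> lowers the squared
      distance by |z|^2 / |m|^2, the largest possible gain in the direction of \<open>m\<close>;
      minimality of \<open>k\<close> forces \<open>z = 0\<close>.\<close>
    define c where "c = z / complex_of_real ((norm m)\<^sup>2)"
    have n: "norm m > 0" using False by simp
    have "k + c *\<^sub>C m \<in> M" by (intro S k(1) that)
    then have "norm (v - k) \<le> norm (v - (k + c *\<^sub>C m))" by (rule k(2))
    then have "(norm (v - k))\<^sup>2 \<le> (norm ((v - k) + (- c) *\<^sub>C m))\<^sup>2"
      by (intro power_mono) (auto simp: scaleC_minus_left algebra_simps)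
    also have "\<dots> = (norm (v - k))\<^sup>2 + (cmod c * norm m)\<^sup>2 - 2 * Re (c * cnj z)"
      using cinner_commute[of "v - k" m] by (simp add: norm_add_square norm_scaleC cinner_simps z_def)
    also have "c * cnj z = complex_of_real ((cmod z)\<^sup>2 / (norm m)\<^sup>2)"
      using complex_norm_square[of z] by (simp add: c_def)
    also have "cmod c = cmod z / (norm m)\<^sup>2" by (simp add: c_def norm_divide norm_power)
    finally have "(cmod z)\<^sup>2 / (norm m)\<^sup>2 \<le> 0" using n by (simp add: power2_eq_square field_simps)
    then show ?thesis using n by (simp add: z_def divide_le_0_iff)
  qed simp
  then show ?thesis using k(1) by blast
qed

lemma dense_complex_subspaceI:
  fixes M :: "'a::complex_hilbert set"
  assumes "complex_subspace M" and "\<And>v. (\<And>m. m \<in> M \<Longrightarrow> cinner m v = 0) \<Longrightarrow> v = 0"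
  shows "closure M = UNIV"
proof -
  have "v \<in> closure M" for v
  proof -
    obtain k where k: "k \<in> closure M" "\<forall>m\<in>closure M. cinner m (v - k) = 0"
      using orthogonal_decomposition[OF complex_subspace_closure[OF assms(1)] closed_closure, of v]
      by (elim bexE)
    have "v - k = 0" by (rule assms(2), rule bspec[OF k(2)]) (rule subsetD[OF closure_subset])
    then show ?thesis using k(1) by simp
  qed
  then show ?thesis by (simp add: set_eq_iff)
qed

text \<open>The orthogonal complement of the kernel is spanned by the single vector
  \<open>e\<close>, because \<open>l e *\<^sub>C u - l u *\<^sub>C e\<close> always lies in the
  kernel. This later turns a family of scalar integrals into a vector.\<close>

lemma Riesz_representation:
  fixes l :: "'a::complex_hilbert \<Rightarrow> complex"
  assumes lin: "bounded_linear l" and sc: "\<And>c u. l (c *\<^sub>C u) = c * l u"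
  obtains w where "\<And>u. l u = cinner w u"
proof -
  interpret l: bounded_linear l by (rule lin)
  define M where "M = {u. l u = 0}"
  have M: "complex_subspace M" by (auto simp: M_def complex_subspace_def l.add sc)
  have cl: "closed M"
    unfolding M_def by (rule closed_Collect_eq[OF linear_continuous_on[OF lin] continuous_on_const])
  show thesis
  proof (cases "M = UNIV")
    case True
    then show ?thesis using that[of 0] by (auto simp: M_def)
  next
    case False
    then obtain v where "l v \<noteq> 0" by (auto simp: M_def)
    obtain k where k: "k \<in> M" "\<forall>m\<in>M. cinner m (v - k) = 0"
      using orthogonal_decomposition[OF M cl, of v] by (elim bexE)
    define e where "e = v - k"
    have le: "l e \<noteq> 0" using \<open>l v \<noteq> 0\<close> k(1) by (simp add: e_def l.diff M_def)
    then have e0: "cinner e e \<noteq> 0" by (auto simp: l.zero)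
    have "l u = cinner (cnj (l e / cinner e e) *\<^sub>C e) u" for u
    proof -
      have "l e *\<^sub>C u - l u *\<^sub>C e \<in> M" by (simp add: M_def l.diff sc)
      then have "cinner (l e *\<^sub>C u - l u *\<^sub>C e) e = 0" using k(2) by (simp add: e_def)
      then have "cnj (cinner (l e *\<^sub>C u - l u *\<^sub>C e) e) = 0" by simp
      then have "cinner e (l e *\<^sub>C u - l u *\<^sub>C e) = 0" by (metis cinner_commute)
      then show ?thesis using e0 by (simp add: cinner_simps field_simps)
    qed
    then show ?thesis by (rule that)
  qed
qed

section \<open>Total sets and isometries\<close>

definition cspan :: "'a::complex_hilbert set \<Rightarrow> 'a set" where
  "cspan A = span {c *\<^sub>C a |c a. a \<in> A}"

definition total :: "'a::complex_hilbert set \<Rightarrow> bool" where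
  "total A \<longleftrightarrow> closure (cspan A) = UNIV"

text \<open>\<open>span\<close> is the real span, so a complex scalar has to be carried through to
  the generators, which are closed under complex multiples by construction.\<close>

lemma complex_subspace_cspan: "complex_subspace (cspan A)"
proof -
  have "c *\<^sub>C u \<in> cspan A" if "u \<in> cspan A" for c u
    using that unfolding cspan_def
  proof (induction rule: span_induct_alt)
    case base
    then show ?case by (simp add: span_zero)
  next
    case (step r x y)
    then obtain d a where "x = d *\<^sub>C a" "a \<in> A" by blast
    then have "c *\<^sub>C (r *\<^sub>R x + y) = r *\<^sub>R ((c * d) *\<^sub>C a) + c *\<^sub>C y"
      by (simp add: scaleC_add_right scaleR_scaleC_assoc scaleC_scaleC)
    moreover have "(c * d) *\<^sub>C a \<in> {c *\<^sub>C a |c a. a \<in> A}" using \<open>a \<in> A\<close> by blast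
    ultimately show ?case using step by (simp only: span_add span_scale span_base)
  qed
  then show ?thesis by (auto simp: complex_subspace_def cspan_def span_zero span_add)
qed

lemma cspan_superset: "A \<subseteq> cspan A"
  unfolding cspan_def by (force intro: span_base exI[of _ 1])

lemma cspan_subset: "A \<subseteq> M \<Longrightarrow> complex_subspace M \<Longrightarrow> cspan A \<subseteq> M"
  unfolding cspan_def by (rule span_minimal) (auto dest: complex_subspaceD simp: subspace_def)

lemma totalI:
  fixes A :: "'a::complex_hilbert set"
  assumes "\<And>v. (\<And>a. a \<in> A \<Longrightarrow> cinner a v = 0) \<Longrightarrow> v = 0"
  shows "total A"
  unfolding total_def
  by (rule dense_complex_subspaceI[OF complex_subspace_cspan]) (use assms cspan_superset in blast)

lemma total_closed_subspace:
  assumes "total A" "A \<subseteq> M" "complex_subspace M" "closed M"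
  shows "M = UNIV"
  using closure_minimal[OF cspan_subset[OF assms(2,3)] assms(4)] assms(1) by (auto simp: total_def)

lemma total_orthogonal_zero:
  assumes A: "total A" and z: "\<And>a. a \<in> A \<Longrightarrow> cinner a v = 0"
  shows "v = 0"
proof -
  have "{u. cinner u v = 0} = UNIV"
    by (rule total_closed_subspace[OF A])
      (auto simp: z complex_subspace_def cinner_simps intro!: closed_Collect_eq continuous_intros)
  then have "cinner v v = 0" by blast
  then show ?thesis by simp
qed

definition isometric :: "('a::complex_hilbert \<Rightarrow> 'b::complex_hilbert) \<Rightarrow> bool" where
  "isometric T \<longleftrightarrow> (\<forall>u v. T (u + v) = T u + T v) \<and> (\<forall>c u. T (c *\<^sub>C u) = c *\<^sub>C T u) \<and>
     (\<forall>u v. cinner (T u) (T v) = cinner u v)"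

lemma unitary_iff: "unitary T \<longleftrightarrow> isometric T \<and> surj T"
  by (auto simp: unitary_def isometric_def)

lemma isometricD:
  assumes "isometric T"
  shows "T (u + v) = T u + T v" "T (c *\<^sub>C u) = c *\<^sub>C T u" "cinner (T u) (T v) = cinner u v"
    "norm (T u) = norm u" "T 0 = 0" "T (u - v) = T u - T v" "bounded_linear T" "inj T"
proof -
  show *: "T (u + v) = T u + T v" "T (c *\<^sub>C u) = c *\<^sub>C T u" "cinner (T u) (T v) = cinner u v" for u v c
    using assms by (auto simp: isometric_def)
  show n: "norm (T u) = norm u" for u by (simp add: norm_eq_sqrt_cinner *(3))
  show "T 0 = 0" using *(2)[of 0 0] by simp
  show d: "T (u - v) = T u - T v" for u v
    using *(1)[of u "(-1) *\<^sub>C v"] *(2)[of "-1" v] by (simp add: scaleC_minus_one)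
  show "bounded_linear T"
    by (rule bounded_linear_intro[of _ 1]) (simp_all add: * scaleR_scaleC n)
  show "inj T"
  proof (rule injI)
    fix x y assume "T x = T y"
    then have "norm (x - y) = 0" using n[of "x - y"] by (simp add: d)
    then show "x = y" by simp
  qed
qed

lemma isometric_comp: "isometric S \<Longrightarrow> isometric T \<Longrightarrow> isometric (S \<circ> T)"
  by (auto simp: isometric_def)

lemma closed_range_isometric:
  assumes T: "isometric T"
  shows "closed (range T)" "complex_subspace (range T)"
proof -
  note I = isometricD[OF T]
  show "complex_subspace (range T)"
    unfolding complex_subspace_def
    using I(5) by (auto simp flip: I(1) I(2) simp: image_iff)
  show "closed (range T)"
  proof (unfold closed_sequential_limits, intro allI impI, elim conjE)
    fix f l assume f: "\<forall>n. f n \<in> range T" "f \<longlonglongrightarrow> l"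
    then have "\<forall>n. \<exists>k. f n = T k" by (simp add: image_iff)
    then obtain g where "\<And>n. f n = T (g n)" by metis
    then have g: "f = (\<lambda>n. T (g n))" by blast
    have "dist (g m) (g n) = dist (f m) (f n)" for m n
      using I(4)[of "g m - g n"] by (simp add: dist_norm g I(6))
    then have "Cauchy g" using LIMSEQ_imp_Cauchy[OF f(2)] by (simp add: Cauchy_def)
    then obtain k where "g \<longlonglongrightarrow> k" using Cauchy_convergent_iff convergent_def by blast
    then have "f \<longlonglongrightarrow> T k" using bounded_linear.tendsto[OF I(7)] by (simp add: g)
    then show "l \<in> range T" using LIMSEQ_unique[OF f(2)] by blast
  qed
qed

lemma total_linear_eq:
  assumes A: "total A" and T: "bounded_linear S" "bounded_linear T"
    "\<And>c u. S (c *\<^sub>C u) = c *\<^sub>C S u" "\<And>c u. T (c *\<^sub>C u) = c *\<^sub>C T u"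
    and eq: "\<And>a. a \<in> A \<Longrightarrow> S a = T a"
  shows "S = T"
proof -
  have "{u. S u = T u} = UNIV"
    by (rule total_closed_subspace[OF A])
      (auto simp: eq complex_subspace_def T(3,4) linear_0 linear_add bounded_linear.linear T(1,2)
        intro!: closed_Collect_eq linear_continuous_on T)
  then show ?thesis by blast
qed

text \<open>The graph of the isometry is the closure of the span of the pairs \<open>(c a\<^sub>i, c b\<^sub>i)\<close>: on it both
  components have the same inner products, and its first projection is complete and total.\<close>

lemma isometry_of_Gram:
  fixes a :: "'i \<Rightarrow> 'a::complex_hilbert" and b :: "'i \<Rightarrow> 'b::complex_hilbert"
  assumes total: "total (range a)" and gram: "\<And>i j. cinner (a i) (a j) = cinner (b i) (b j)"
  obtains T where "isometric T" "\<And>i. T (a i) = b i"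
proof -
  define P where "P = {(c *\<^sub>C a i, c *\<^sub>C b i) |c i. True}"
  define G where "G = closure (span P)"
  have subG: "subspace G" unfolding G_def by (intro subspace_closure subspace_span)
  have PG: "P \<subseteq> G" unfolding G_def by (rule order_trans[OF span_superset closure_subset])
  \<comment> \<open>Both sides are additive and continuous in \<open>p\<close>, so agreement on
    \<open>P\<close> extends to the closed real span. This is used twice: for \<open>q\<close> in
    \<open>P\<close>, and then, with the roles exchanged, for \<open>q\<close> in
    \<open>G\<close>.\<close>
  have ker: "G \<subseteq> {p. cinner (fst p) (fst q) = cinner (snd p) (snd q)}" (is "_ \<subseteq> ?K")
    if "\<And>p. p \<in> P \<Longrightarrow> cinner (fst p) (fst q) = cinner (snd p) (snd q)" for q :: "'a \<times> 'b"
    unfolding G_def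
  proof (intro closure_minimal span_minimal)
    show "P \<subseteq> ?K" using that by blast
    show "subspace ?K" by (simp add: subspace_def cinner_simps cinner_scaleR_left)
    show "closed ?K" by (intro closed_Collect_eq continuous_intros)
  qed
  have 1: "cinner (fst p) (fst q) = cinner (snd p) (snd q)" if "p \<in> G" "q \<in> P" for p q
  proof -
    from that(2) obtain c i where q: "q = (c *\<^sub>C a i, c *\<^sub>C b i)" by (auto simp: P_def)
    have "cinner (fst r) (fst q) = cinner (snd r) (snd q)" if "r \<in> P" for r
      using that by (auto simp: P_def q cinner_simps gram)
    then show ?thesis using ker[of q] that(1) by blast
  qed
  have 2: "cinner (fst p) (fst q) = cinner (snd p) (snd q)" if "p \<in> G" "q \<in> G" for p q
  proof -
    have "cinner (fst r) (fst q) = cinner (snd r) (snd q)" if "r \<in> P" for r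
      using 1[OF \<open>q \<in> G\<close> that] by (metis cinner_commute)
    then show ?thesis using ker[of q] \<open>p \<in> G\<close> by blast
  qed
  have nrm: "norm (fst p) = norm (snd p)" if "p \<in> G" for p
    using 2[OF that that] by (simp add: norm_eq_sqrt_cinner)
  \<comment> \<open>\<open>G\<close> is the closure of a real span only, so its stability under
    complex scalars is a separate passage to the closure.\<close>
  have scG: "(c *\<^sub>C fst p, c *\<^sub>C snd p) \<in> G" if "p \<in> G" for c p
  proof -
    have "span P \<subseteq> {p. (c *\<^sub>C fst p, c *\<^sub>C snd p) \<in> span P}"
    proof (rule span_minimal)
      show "P \<subseteq> {p. (c *\<^sub>C fst p, c *\<^sub>C snd p) \<in> span P}"
        unfolding P_def
        by (clarsimp simp: scaleC_scaleC) (rule span_base, blast)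
      show "subspace {p. (c *\<^sub>C fst p, c *\<^sub>C snd p) \<in> span P}"
        using subspace_span[of P] unfolding subspace_def
        by (simp add: scaleC_add_right scaleR_scaleC_assoc zero_prod_def flip: add_Pair scaleR_Pair)
    qed
    then have "span P \<subseteq> {p. (c *\<^sub>C fst p, c *\<^sub>C snd p) \<in> G}"
      using closure_subset[of "span P"] by (auto simp: G_def)
    moreover have "closed ((\<lambda>p :: 'a \<times> 'b. (c *\<^sub>C fst p, c *\<^sub>C snd p)) -` G)"
      by (intro closed_vimage continuous_intros) (simp add: G_def)
    ultimately have "G \<subseteq> {p. (c *\<^sub>C fst p, c *\<^sub>C snd p) \<in> G}"
      unfolding G_def vimage_def by (rule closure_minimal)
    then show ?thesis using that by blast
  qed
  have inj: "y = y'" if "(x, y) \<in> G" "(x, y') \<in> G" for x y y'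
    using nrm[OF subspace_diff[OF subG that]] by simp
  have abG: "(a i, b i) \<in> G" for i
  proof -
    have "(1 *\<^sub>C a i, 1 *\<^sub>C b i) \<in> P" unfolding P_def
      by (rule CollectI, rule exI[of _ 1], rule exI[of _ i]) simp
    then show ?thesis using PG by auto
  qed
  \<comment> \<open>Since the two components have equal norms, a convergent sequence of first
    components comes with a Cauchy sequence of second ones.\<close>
  have "closed (fst ` G)"
  proof (unfold closed_sequential_limits, intro allI impI, elim conjE)
    fix f l assume f: "\<forall>n. f n \<in> fst ` G" "f \<longlonglongrightarrow> l"
    then have "\<forall>n. \<exists>y. (f n, y) \<in> G" by (metis imageE prod.collapse)
    then obtain g where g: "\<And>n. (f n, g n) \<in> G" by metis
    have "norm (g m - g n) = norm (f m - f n)" for m n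
      using nrm[OF subspace_diff[OF subG g[of m] g[of n]]] by simp
    moreover have "Cauchy f" using f(2) by (rule LIMSEQ_imp_Cauchy)
    ultimately have "Cauchy g" unfolding Cauchy_def dist_norm by simp
    then obtain l' where "g \<longlonglongrightarrow> l'" using Cauchy_convergent_iff convergent_def by blast
    with f(2) have lim: "(\<lambda>n. (f n, g n)) \<longlonglongrightarrow> (l, l')" by (rule tendsto_Pair)
    have cl: "closed G" by (simp add: G_def)
    have "(l, l') \<in> G" by (rule closed_sequentially[OF cl _ lim]) (rule g)
    then show "l \<in> fst ` G" using imageI[of "(l, l')" G fst] by simp
  qed
  moreover have "complex_subspace (fst ` G)"
    unfolding complex_subspace_def
  proof (intro conjI ballI allI)
    show "0 \<in> fst ` G" using subspace_0[OF subG] by (force simp: zero_prod_def)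
    show "u + v \<in> fst ` G" if "u \<in> fst ` G" "v \<in> fst ` G" for u v
    proof -
      from that obtain p q where "u = fst p" "p \<in> G" "v = fst q" "q \<in> G" by (elim imageE)
      then show ?thesis using imageI[OF subspace_add[OF subG], of p q fst] by simp
    qed
    show "c *\<^sub>C u \<in> fst ` G" if "u \<in> fst ` G" for c u
    proof -
      from that obtain p where "u = fst p" "p \<in> G" by (elim imageE)
      then show ?thesis using imageI[OF scG, of p fst c] by simp
    qed
  qed
  moreover have "range a \<subseteq> fst ` G"
  proof
    fix y assume "y \<in> range a"
    then obtain i where "y = a i" by blast
    then show "y \<in> fst ` G" using imageI[OF abG, of fst i] by simp
  qed
  ultimately have "fst ` G = UNIV" by (intro total_closed_subspace[OF total])
  then have "x \<in> fst ` G" for x by simp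
  then have "\<forall>x. \<exists>y. (x, y) \<in> G" by (metis imageE prod.collapse)
  then obtain T where T: "\<And>x. (x, T x) \<in> G" by metis
  have "isometric T"
    unfolding isometric_def
  proof (intro conjI allI)
    show "T (u + v) = T u + T v" for u v
      using inj[OF T[of "u + v"]] subspace_add[OF subG T[of u] T[of v]] by simp
    show "T (c *\<^sub>C u) = c *\<^sub>C T u" for c u
      using inj[OF T[of "c *\<^sub>C u"]] scG[OF T[of u], of c] by simp
    show "cinner (T u) (T v) = cinner u v" for u v using 2[OF T[of u] T[of v]] by simp
  qed
  moreover have "T (a i) = b i" for i
    by (rule inj[OF T[of "a i"] abG[of i]])
  ultimately show thesis by (rule that[of T])
qed

section \<open>Calculus in Hilbert spaces\<close>

text \<open>Matrix coefficients against a total set are often explicit where the vector-valued map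
  is not. The mean value inequality bounds \<open>cinner u w\<close>, for the remainder
  \<open>w\<close>, by \<open>norm u\<close> times a quantity independent of \<open>u\<close>; by
  density the bound holds for \<open>u = w\<close>, which is differentiability in norm.\<close>

lemma has_derivative_weakI:
  fixes f :: "'b::euclidean_space \<Rightarrow> 'a::complex_hilbert" and G :: "'b \<Rightarrow> 'b \<Rightarrow> 'a"
  assumes A: "total A"
    and weak: "\<And>a x. a \<in> A \<Longrightarrow>
      ((\<lambda>y. cinner a (f y)) has_derivative (\<lambda>h. cinner a (G x h))) (at x)"
    and lin: "\<And>x. linear (G x)"
    and cont: "\<And>h. continuous_on UNIV (\<lambda>x. G x h)"
  shows "(f has_derivative G x) (at x)"
proof -
  define M where "M = {a. \<forall>x. ((\<lambda>y. cinner a (f y)) has_derivative (\<lambda>h. cinner a (G x h))) (at x)}"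
  have "complex_subspace M"
    unfolding complex_subspace_def M_def
    by (auto simp: cinner_simps intro!: has_derivative_add has_derivative_mult_right)
  moreover have "A \<subseteq> M" using weak by (auto simp: M_def)
  ultimately have AM: "cspan A \<subseteq> M" by (intro cspan_subset)
  have blin: "bounded_linear (G x)" for x using lin linear_conv_bounded_linear by blast
  have "\<exists>d>0. \<forall>y. norm (y - x) < d \<longrightarrow> norm (f y - f x - G x (y - x)) \<le> e * norm (y - x)"
    if e: "e > 0" for e
  proof -
    \<comment> \<open>The argument space is finite-dimensional, so continuity of \<open>G\<close> in
      each basis direction already controls the operator norm of \<open>G y - G x\<close>.\<close>
    define B where "B y = (\<Sum>b\<in>Basis. norm (G y b - G x b))" for y
    have "continuous_on UNIV B" unfolding B_def by (intro continuous_intros cont)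
    then have "B \<midarrow>x\<rightarrow> B x" by (simp add: continuous_on_def)
    moreover have "B x = 0" by (simp add: B_def)
    ultimately have "\<forall>\<^sub>F y in at x. dist (B y) 0 < e" using e by (auto dest: tendstoD)
    then obtain d where d: "d > 0" "\<forall>y. y \<noteq> x \<and> dist y x < d \<longrightarrow> \<bar>B y\<bar> < e"
      by (auto simp: eventually_at dist_real_def)
    have Bd: "B y \<le> e" if "y \<in> ball x d" for y
      using d(2)[rule_format, of y] that e \<open>B x = 0\<close> by (cases "y = x") (auto simp: dist_commute)
    have G: "norm (G y h - G x h) \<le> B y * norm h" for y h
    proof -
      have "G y h - G x h = (\<Sum>b\<in>Basis. (h \<bullet> b) *\<^sub>R (G y b - G x b))"
        using linear_sum[OF lin, of y "\<lambda>b. (h \<bullet> b) *\<^sub>R b" Basis]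
          linear_sum[OF lin, of x "\<lambda>b. (h \<bullet> b) *\<^sub>R b" Basis]
        by (simp add: euclidean_representation linear_scale[OF lin] sum_subtractf algebra_simps)
      also have "norm \<dots> \<le> (\<Sum>b\<in>Basis. norm h * norm (G y b - G x b))"
        by (intro sum_norm_le) (simp add: mult_right_mono Basis_le_norm)
      finally show ?thesis by (simp add: B_def sum_distrib_left mult.commute)
    qed
    have "norm (f y - f x - G x (y - x)) \<le> e * norm (y - x)" if y: "norm (y - x) < d" for y
    proof -
      define w where "w = f y - f x - G x (y - x)"
      have "cmod (cinner u w) \<le> norm u * (e * norm (y - x))" if u: "u \<in> cspan A" for u
      proof -
        have "cmod ((cinner u (f y) - cinner u (G x y)) - (cinner u (f x) - cinner u (G x x)))
          \<le> (norm u * e) * norm (y - x)"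
        proof (rule differentiable_bound[of "ball x d" "\<lambda>z. cinner u (f z) - cinner u (G x z)"
              "\<lambda>z h. cinner u (G z h) - cinner u (G x h)"])
          fix z assume z: "z \<in> ball x d"
          have "((\<lambda>z. cinner u (f z)) has_derivative (\<lambda>h. cinner u (G z h))) (at z)"
            using u AM by (auto simp: M_def)
          moreover have "((\<lambda>z. cinner u (G x z)) has_derivative (\<lambda>h. cinner u (G x h))) (at z)"
            by (intro bounded_linear_imp_has_derivative
                bounded_linear_compose[OF bounded_linear_cinner_right blin])
          ultimately show "((\<lambda>z. cinner u (f z) - cinner u (G x z)) has_derivative
              (\<lambda>h. cinner u (G z h) - cinner u (G x h))) (at z within ball x d)"
            by (rule has_derivative_at_withinI[OF has_derivative_diff])
          have "cmod (cinner u (G z h) - cinner u (G x h)) \<le> (norm u * e) * norm h" for h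
          proof -
            have "cmod (cinner u (G z h - G x h)) \<le> norm u * norm (G z h - G x h)"
              by (rule cinner_Cauchy_Schwarz)
            also have "\<dots> \<le> norm u * (e * norm h)"
              using order_trans[OF G[of z h] mult_right_mono[OF Bd[OF z]]]
              by (intro mult_left_mono) auto
            finally show ?thesis by (simp add: cinner_diff_right)
          qed
          then show "onorm (\<lambda>h. cinner u (G z h) - cinner u (G x h)) \<le> norm u * e"
            by (intro onorm_le)
        qed (use y d(1) in \<open>auto simp: dist_norm norm_minus_commute\<close>)
        also have "(cinner u (f y) - cinner u (G x y)) - (cinner u (f x) - cinner u (G x x)) = cinner u w"
          by (simp add: w_def cinner_simps linear_diff[OF lin])
        finally show ?thesis by (simp add: mult.assoc)
      qed
      then have "cspan A \<subseteq> {u. cmod (cinner u w) \<le> norm u * (e * norm (y - x))}" by blast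
      moreover have "closed {u. cmod (cinner u w) \<le> norm u * (e * norm (y - x))}"
        by (intro closed_Collect_le continuous_intros)
      ultimately have "closure (cspan A) \<subseteq> {u. cmod (cinner u w) \<le> norm u * (e * norm (y - x))}"
        by (rule closure_minimal)
      then have "w \<in> {u. cmod (cinner u w) \<le> norm u * (e * norm (y - x))}"
        using A unfolding total_def by blast
      then have "norm w * norm w \<le> norm w * (e * norm (y - x))"
        by (simp add: cinner_self power2_eq_square norm_mult)
      then show ?thesis using e by (cases "w = 0") (auto simp flip: w_def)
    qed
    then show ?thesis using d(1) by blast
  qed
  then show ?thesis using blin by (simp add: has_derivative_at_alt)
qed

section \<open>Closure properties of the classes \<open>C_k\<close>\<close>

lemma frechet_derivative_eq: "(f has_derivative f') (at x) \<Longrightarrow> frechet_derivative f (at x) = f'"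
  by (rule frechet_derivative_at[symmetric])

lemma C_k_SucI:
  assumes "\<And>x. (f has_derivative f' x) (at x)" "\<And>h. C_k k (\<lambda>x. f' x h)"
  shows "C_k (Suc k) f"
  using assms frechet_derivative_eq[OF assms(1)] by (auto simp: differentiable_def)

lemma C_k_SucD:
  assumes "C_k (Suc k) f"
  shows "(f has_derivative frechet_derivative f (at x)) (at x)"
    "C_k k (\<lambda>x. frechet_derivative f (at x) h)"
  using assms by (auto simp: frechet_derivative_works)

lemma C_k_Suc_imp: "C_k (Suc k) f \<Longrightarrow> C_k k f"
proof (induction k arbitrary: f)
  case 0
  then have "f differentiable at x" for x by simp
  then show ?case by (simp add: continuous_at_imp_continuous_on differentiable_imp_continuous_within)
next
  case (Suc k)
  then show ?case by (metis C_k.simps(2))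
qed

lemma C_k_add: "C_k k f \<Longrightarrow> C_k k g \<Longrightarrow> C_k k (\<lambda>x. f x + g x)"
proof (induction k arbitrary: f g)
  case 0
  then show ?case by (simp add: continuous_on_add)
next
  case (Suc k)
  show ?case
    by (rule C_k_SucI, rule has_derivative_add; (rule C_k_SucD(1)[OF Suc.prems(1)] C_k_SucD(1)[OF Suc.prems(2)])?)
      (rule Suc.IH; rule C_k_SucD(2); fact Suc.prems)
qed

lemma C_k_bounded_linear: "bounded_linear T \<Longrightarrow> C_k k f \<Longrightarrow> C_k k (\<lambda>x. T (f x))"
proof (induction k arbitrary: f)
  case 0
  then show ?case
    using continuous_on_compose2[OF linear_continuous_on[OF 0(1), of UNIV], of UNIV f] by simp
next
  case (Suc k)
  show ?case
    by (rule C_k_SucI[OF bounded_linear.has_derivative[OF Suc.prems(1) C_k_SucD(1)[OF Suc.prems(2)]]])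
      (rule Suc.IH[OF Suc.prems(1) C_k_SucD(2)[OF Suc.prems(2)]])
qed

text \<open>The derivative consists of a term of the same shape and a constant multiple of
  \<open>f\<close> itself, which has one derivative to spare. Orbit maps of the Heisenberg group
  produce exactly such coefficients, linear in the group element.\<close>

lemma C_k_scale_linear: "bounded_linear l \<Longrightarrow> C_k k f \<Longrightarrow> C_k k (\<lambda>x. l x *\<^sub>R f x)"
proof (induction k arbitrary: f)
  case 0
  then show ?case
    using continuous_on_scaleR[OF linear_continuous_on[OF 0(1), of UNIV], of f] by simp
next
  case (Suc k)
  have "((\<lambda>x. l x *\<^sub>R f x) has_derivative
      (\<lambda>h. l x *\<^sub>R frechet_derivative f (at x) h + l h *\<^sub>R f x)) (at x)" for x
    by (intro has_derivative_scaleR C_k_SucD(1)[OF Suc.prems(2)]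
        bounded_linear_imp_has_derivative Suc.prems(1))
  then show ?case
    by (rule C_k_SucI)
      (intro C_k_add Suc.IH C_k_SucD(2)[OF Suc.prems(2)] Suc.prems(1)
        C_k_bounded_linear[OF bounded_linear_scaleR_right] C_k_Suc_imp[OF Suc.prems(2)])
qed

section \<open>Square-summable families\<close>

lemma ell2_eqI: "(\<And>i. Rep_ell2 u i = Rep_ell2 v i) \<Longrightarrow> u = v"
  by (simp add: Rep_ell2_inject[symmetric] fun_eq_iff)

lemma cinner_ket: "cinner (ket i) v = Rep_ell2 v i"
proof -
  have "cinner (ket i) v = (\<Sum>\<^sub>\<infinity>j\<in>{i}. cnj (Rep_ell2 (ket i) j) * Rep_ell2 v j)"
    unfolding cinner_ell2_def by (rule infsum_cong_neutral) (auto simp: Rep_ket)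
  then show ?thesis by (simp add: Rep_ket)
qed

lemma total_ket: "total (range ket)"
proof (rule totalI)
  fix v :: "'a ell2" assume "\<And>a. a \<in> range ket \<Longrightarrow> cinner a v = 0"
  then have "cinner (ket i) v = 0" for i by simp
  then show "v = 0" by (intro ell2_eqI) (simp add: cinner_ket Rep_ell2_simps)
qed

lemma norm_ell2_square: "(norm v)\<^sup>2 = (\<Sum>\<^sub>\<infinity>i. (cmod (Rep_ell2 v i))\<^sup>2)"
  unfolding norm_ell2_def by (simp add: infsum_nonneg)

lemma norm_ell2_mono:
  assumes "\<And>i. cmod (Rep_ell2 u i) \<le> cmod (Rep_ell2 v i)"
  shows "norm u \<le> norm v"
  unfolding norm_ell2_def
  by (intro real_sqrt_le_mono infsum_mono Rep_ell2_summable power_mono assms) simp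

definition ell2_truncate :: "'i set \<Rightarrow> 'i ell2 \<Rightarrow> 'i ell2" where
  "ell2_truncate F v = (\<Sum>i\<in>F. Rep_ell2 v i *\<^sub>C ket i)"

lemma Rep_ell2_sum: "Rep_ell2 (sum f F) i = (\<Sum>j\<in>F. Rep_ell2 (f j) i)"
  by (induction F rule: infinite_finite_induct) (simp_all add: Rep_ell2_simps)

lemma Rep_ell2_truncate:
  "finite F \<Longrightarrow> Rep_ell2 (ell2_truncate F v) i = (if i \<in> F then Rep_ell2 v i else 0)"
  by (simp add: ell2_truncate_def Rep_ell2_sum Rep_ell2_scaleC Rep_ket if_distrib cong: if_cong)

lemma norm_ell2_truncate:
  assumes "finite F"
  shows "(norm (v - ell2_truncate F v))\<^sup>2 = (norm v)\<^sup>2 - (\<Sum>i\<in>F. (cmod (Rep_ell2 v i))\<^sup>2)"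
proof -
  have "(norm (ell2_truncate F v))\<^sup>2 = (\<Sum>\<^sub>\<infinity>i\<in>F. (cmod (Rep_ell2 v i))\<^sup>2)"
    unfolding norm_ell2_square
    by (rule infsum_cong_neutral) (auto simp: Rep_ell2_truncate assms)
  moreover have "cinner (ell2_truncate F v) (v - ell2_truncate F v) = 0"
    unfolding cinner_ell2_def
    by (rule infsum_0) (auto simp: Rep_ell2_truncate assms Rep_ell2_simps)
  ultimately show ?thesis
    using norm_add_square[of "ell2_truncate F v" "v - ell2_truncate F v"] assms by simp
qed

lemma ell2_truncate_tendsto: "((\<lambda>F. norm (v - ell2_truncate F v)) \<longlongrightarrow> 0) (finite_subsets_at_top UNIV)"
proof -
  have "((\<lambda>F. \<Sum>i\<in>F. (cmod (Rep_ell2 v i))\<^sup>2) \<longlongrightarrow> (norm v)\<^sup>2) (finite_subsets_at_top UNIV)"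
    unfolding norm_ell2_square using has_sum_infsum[OF Rep_ell2_summable[of v]]
    by (simp add: has_sum_def)
  then have "((\<lambda>F. sqrt ((norm v)\<^sup>2 - (\<Sum>i\<in>F. (cmod (Rep_ell2 v i))\<^sup>2))) \<longlongrightarrow>
      sqrt ((norm v)\<^sup>2 - (norm v)\<^sup>2)) (finite_subsets_at_top UNIV)"
    by (intro tendsto_intros)
  moreover have "\<forall>\<^sub>F F in finite_subsets_at_top UNIV.
      sqrt ((norm v)\<^sup>2 - (\<Sum>i\<in>F. (cmod (Rep_ell2 v i))\<^sup>2)) = norm (v - ell2_truncate F v)"
    by (rule eventually_finite_subsets_at_top_weakI) (simp flip: norm_ell2_truncate)
  ultimately show ?thesis by (auto dest: Lim_transform_eventually)
qed

text \<open>Domination bounds the tails of \<open>f x\<close> by those of the fixed vector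
  \<open>b\<close>, uniformly in \<open>x\<close>; hence \<open>f\<close> is a uniform limit of its
  finite truncations, and these are continuous coordinate by coordinate.\<close>

lemma continuous_on_ell2_dominated:
  fixes f :: "'b::topological_space \<Rightarrow> 'i ell2"
  assumes cont: "\<And>i. continuous_on S (\<lambda>x. Rep_ell2 (f x) i)"
    and bound: "\<And>x i. x \<in> S \<Longrightarrow> cmod (Rep_ell2 (f x) i) \<le> cmod (Rep_ell2 b i)"
  shows "continuous_on S f"
proof (rule uniform_limit_theorem)
  show "uniform_limit S (\<lambda>F x. ell2_truncate F (f x)) f (finite_subsets_at_top UNIV)"
  proof (rule uniform_limitI)
    fix e :: real assume "e > 0"
    with ell2_truncate_tendsto[of b]
    have "\<forall>\<^sub>F F in finite_subsets_at_top UNIV. norm (b - ell2_truncate F b) < e"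
      by (auto dest: tendstoD)
    moreover have "\<forall>\<^sub>F F in finite_subsets_at_top (UNIV :: 'i set). finite F"
      by (rule eventually_finite_subsets_at_top_weakI)
    ultimately show "\<forall>\<^sub>F F in finite_subsets_at_top UNIV. \<forall>x\<in>S. dist (ell2_truncate F (f x)) (f x) < e"
    proof eventually_elim
      case (elim F)
      have "dist (ell2_truncate F (f x)) (f x) \<le> norm (b - ell2_truncate F b)" if "x \<in> S" for x
        unfolding dist_norm using bound[OF that] elim(2)
        by (subst norm_minus_commute, intro norm_ell2_mono) (simp add: Rep_ell2_simps Rep_ell2_truncate)
      then show ?case using elim(1) by force
    qed
  qed
  show "\<forall>\<^sub>F F in finite_subsets_at_top UNIV. continuous_on S (\<lambda>x. ell2_truncate F (f x))"
    unfolding ell2_truncate_def by (intro always_eventually allI continuous_intros cont)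
qed simp

lemma Rep_Abs_ell2_dominated:
  assumes "\<And>i. cmod (f i) \<le> cmod (Rep_ell2 b i)"
  shows "Rep_ell2 (Abs_ell2 f) = f"
proof (rule Abs_ell2_inverse, rule CollectI, rule summable_on_comparison_test[OF Rep_ell2_summable[of b]])
  show "(cmod (f i))\<^sup>2 \<le> (cmod (Rep_ell2 b i))\<^sup>2" for i
    by (intro power_mono assms) simp
qed simp

lemma Rep_Abs_ell2_slice:
  "Rep_ell2 (Abs_ell2 (\<lambda>i. Rep_ell2 v (i, j))) = (\<lambda>i. Rep_ell2 v (i, j))"
  "Rep_ell2 (Abs_ell2 (\<lambda>j. Rep_ell2 v (i, j))) = (\<lambda>j. Rep_ell2 v (i, j))"
proof -
  have "(\<lambda>i. (cmod (Rep_ell2 v (i, j)))\<^sup>2) summable_on UNIV"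
    using summable_on_reindex[of "\<lambda>i. (i, j)" UNIV "\<lambda>k. (cmod (Rep_ell2 v k))\<^sup>2"]
      summable_on_subset_banach[OF Rep_ell2_summable[of v], of "range (\<lambda>i. (i, j))"]
    by (simp add: inj_on_def o_def)
  moreover have "(\<lambda>j. (cmod (Rep_ell2 v (i, j)))\<^sup>2) summable_on UNIV"
    using summable_on_reindex[of "\<lambda>j. (i, j)" UNIV "\<lambda>k. (cmod (Rep_ell2 v k))\<^sup>2"]
      summable_on_subset_banach[OF Rep_ell2_summable[of v], of "range (\<lambda>j. (i, j))"]
    by (simp add: inj_on_def o_def)
  ultimately show "Rep_ell2 (Abs_ell2 (\<lambda>i. Rep_ell2 v (i, j))) = (\<lambda>i. Rep_ell2 v (i, j))"
    "Rep_ell2 (Abs_ell2 (\<lambda>j. Rep_ell2 v (i, j))) = (\<lambda>j. Rep_ell2 v (i, j))"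
    by (simp_all add: Abs_ell2_inverse)
qed

section \<open>Rapidly decreasing families\<close>

type_synonym seq2 = "nat \<times> nat \<Rightarrow> complex"

definition rdf :: "seq2 \<Rightarrow> bool" where
  "rdf f \<longleftrightarrow> (\<forall>k::nat. \<exists>C. \<forall>m n. (1 + real m + real n) ^ k * cmod (f (m, n)) \<le> C)"

lemma rapidly_decreasing_iff: "v \<in> rapidly_decreasing \<longleftrightarrow> rdf (Rep_ell2 v)"
  by (simp add: rapidly_decreasing_def rdf_def)

text \<open>The sequence 1 / (1 + n) is square-summable and (1 + m) (1 + n) is at most (1 + m +
  n)^2, so its tensor square serves as \<open>b\<close>.\<close>

lemma quadratic_decay_dominated:
  "\<exists>b :: (nat \<times> nat) ell2. \<forall>m n c. (1 + real m + real n) ^ 2 * c \<le> 1 \<longrightarrow> c \<le> cmod (Rep_ell2 b (m, n))"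
proof -
  define u :: "nat ell2" where "u = Abs_ell2 (\<lambda>n. complex_of_real (1 / (1 + real n)))"
  have "summable (\<lambda>n. 1 / (real (Suc n))\<^sup>2)"
    using inverse_power_summable[of 2, where 'a = real] summable_Suc_iff[of "\<lambda>n. 1 / (real n)\<^sup>2"]
    by (simp add: inverse_eq_divide power_divide)
  then have "(\<lambda>n. (cmod (complex_of_real (1 / (1 + real n))))\<^sup>2) summable_on UNIV"
    by (intro summable_nonneg_imp_summable_on) (simp_all add: power_divide norm_divide del: of_real_add)
  then have u: "Rep_ell2 u = (\<lambda>n. complex_of_real (1 / (1 + real n)))"
    unfolding u_def by (intro Abs_ell2_inverse CollectI)
  have "c \<le> cmod (Rep_ell2 (ell2_tensor u u) (m, n))" if "(1 + real m + real n) ^ 2 * c \<le> 1" for m n c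
  proof (cases "c \<ge> 0")
    case True
    have "((1 + real m) * (1 + real n)) * c \<le> (1 + real m + real n) ^ 2 * c"
      by (intro mult_right_mono True) (simp add: power2_eq_square algebra_simps)
    also note that
    finally have "c \<le> 1 / ((1 + real m) * (1 + real n))"
      by (subst pos_le_divide_eq) (auto simp: mult.commute add_pos_nonneg)
    then show ?thesis by (simp add: Rep_ell2_tensor u norm_mult norm_divide del: of_real_add)
  next
    case False
    then show ?thesis by (meson norm_ge_zero not_less order_trans less_imp_le)
  qed
  then show ?thesis by (intro exI[of _ "ell2_tensor u u"]) simp
qed

lemma Rep_Abs_quadratic_decay:
  assumes "\<And>m n. (1 + real m + real n) ^ 2 * cmod (f (m, n)) \<le> C"
  shows "Rep_ell2 (Abs_ell2 f) = f"
proof -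
  obtain b :: "(nat \<times> nat) ell2"
    where b: "\<forall>m n c. (1 + real m + real n) ^ 2 * c \<le> 1 \<longrightarrow> c \<le> cmod (Rep_ell2 b (m, n))"
    using quadratic_decay_dominated by (elim exE)
  define D where "D = max C 1"
  have D: "D > 0" "C \<le> D" by (simp_all add: D_def)
  have "cmod (f (m, n)) \<le> cmod (Rep_ell2 (complex_of_real D *\<^sub>C b) (m, n))" for m n
  proof -
    have "(1 + real m + real n) ^ 2 * (cmod (f (m, n)) / D) \<le> 1"
      using assms[of m n] D by (simp add: field_simps)
    from b[rule_format, OF this] show ?thesis using D by (simp add: Rep_ell2_scaleC norm_mult field_simps)
  qed
  then show ?thesis by (intro Rep_Abs_ell2_dominated[of _ "complex_of_real D *\<^sub>C b"]) auto
qed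

lemma rdf_Abs:
  assumes "rdf f"
  shows "Rep_ell2 (Abs_ell2 f) = f" "Abs_ell2 f \<in> rapidly_decreasing"
proof -
  show "Rep_ell2 (Abs_ell2 f) = f"
    using assms unfolding rdf_def by (metis Rep_Abs_quadratic_decay)
  then show "Abs_ell2 f \<in> rapidly_decreasing" using assms by (simp add: rapidly_decreasing_iff)
qed

lemma rdf_zero: "rdf (\<lambda>_. 0)"
  by (auto simp: rdf_def)

lemma rdf_add: "rdf f \<Longrightarrow> rdf g \<Longrightarrow> rdf (\<lambda>p. f p + g p)"
  unfolding rdf_def
proof (intro allI)
  fix k assume f: "\<forall>k. \<exists>C. \<forall>m n. (1 + real m + real n) ^ k * cmod (f (m, n)) \<le> C"
    and g: "\<forall>k. \<exists>C. \<forall>m n. (1 + real m + real n) ^ k * cmod (g (m, n)) \<le> C"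
  obtain C D where CD: "\<And>m n. (1 + real m + real n) ^ k * cmod (f (m, n)) \<le> C"
    "\<And>m n. (1 + real m + real n) ^ k * cmod (g (m, n)) \<le> D" using f g by meson
  have "(1 + real m + real n) ^ k * cmod (f (m, n) + g (m, n)) \<le> C + D" for m n
  proof -
    have "(1 + real m + real n) ^ k * cmod (f (m, n) + g (m, n)) \<le>
        (1 + real m + real n) ^ k * (cmod (f (m, n)) + cmod (g (m, n)))"
      by (intro mult_left_mono norm_triangle_ineq) simp
    also have "\<dots> \<le> C + D" using CD[of m n] by (simp add: distrib_left)
    finally show ?thesis .
  qed
  then show "\<exists>C. \<forall>m n. (1 + real m + real n) ^ k * cmod (f (m, n) + g (m, n)) \<le> C" by blast
qed

text \<open>A ladder operator moves the index by one, which changes 1 + m + n by a factor of at most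
  2, and multiplies by at most a constant times 1 + m' + n'. The price is one more power in the
  decay of \<open>f\<close>, which rapid decrease can always pay.\<close>

lemma rdf_dominated_shift:
  assumes f: "rdf f" and "\<And>m n. \<exists>m' n'. 1 + real m + real n \<le> 2 * (1 + real m' + real n') \<and>
      cmod (g (m, n)) \<le> c * ((1 + real m' + real n') * cmod (f (m', n')))" and c: "c \<ge> 0"
  shows "rdf g"
  unfolding rdf_def
proof
  fix k
  obtain C where C: "\<And>m n. (1 + real m + real n) ^ Suc k * cmod (f (m, n)) \<le> C"
    using f unfolding rdf_def by meson
  have "(1 + real m + real n) ^ k * cmod (g (m, n)) \<le> 2 ^ k * c * C" for m n
  proof -
    obtain m' n' where le: "1 + real m + real n \<le> 2 * (1 + real m' + real n')"
      "cmod (g (m, n)) \<le> c * ((1 + real m' + real n') * cmod (f (m', n')))" using assms(2) by meson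
    have "(1 + real m + real n) ^ k * cmod (g (m, n)) \<le>
      (2 * (1 + real m' + real n')) ^ k * (c * ((1 + real m' + real n') * cmod (f (m', n'))))"
      using le by (intro mult_mono power_mono) auto
    also have "\<dots> = 2 ^ k * c * ((1 + real m' + real n') ^ Suc k * cmod (f (m', n')))"
      unfolding power_mult_distrib power_Suc by (simp only: mult_ac)
    also have "\<dots> \<le> 2 ^ k * c * C" using C c by (intro mult_left_mono) auto
    finally show ?thesis .
  qed
  then show "\<exists>C. \<forall>m n. (1 + real m + real n) ^ k * cmod (g (m, n)) \<le> C" by blast
qed

lemma rdf_scale: "rdf f \<Longrightarrow> rdf (\<lambda>p. c * f p)"
proof (rule rdf_dominated_shift[where c = "cmod c" and f = f])
  fix m n :: nat
  have "cmod c * cmod (f (m, n)) * 1 \<le> cmod c * cmod (f (m, n)) * (1 + real m + real n)"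
    by (intro mult_left_mono) auto
  then show "\<exists>m' n'. 1 + real m + real n \<le> 2 * (1 + real m' + real n') \<and>
      cmod (c * f (m, n)) \<le> cmod c * ((1 + real m' + real n') * cmod (f (m', n')))"
    by (intro exI[of _ m] exI[of _ n]) (simp add: norm_mult mult_ac)
qed auto

lemma complex_subspace_rapidly_decreasing: "complex_subspace rapidly_decreasing"
  by (auto simp: complex_subspace_def rapidly_decreasing_iff Rep_ell2_simps Rep_ell2_scaleC
      rdf_zero rdf_add rdf_scale)

lemma ket_rapidly_decreasing: "ket i \<in> rapidly_decreasing"
  unfolding rapidly_decreasing_iff rdf_def
proof
  fix k
  have "(1 + real m + real n) ^ k * cmod (Rep_ell2 (ket i) (m, n)) \<le> (1 + real (fst i) + real (snd i)) ^ k"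
    for m n by (cases i) (auto simp: Rep_ket)
  then show "\<exists>C. \<forall>m n. (1 + real m + real n) ^ k * cmod (Rep_ell2 (ket i) (m, n)) \<le> C" by blast
qed

lemma dense_rapidly_decreasing: "closure rapidly_decreasing = UNIV"
  by (rule dense_complex_subspaceI[OF complex_subspace_rapidly_decreasing])
    (rule total_orthogonal_zero[OF total_ket], use ket_rapidly_decreasing in blast)

section \<open>Ladder operators on formal families\<close>

text \<open>At \<open>m = 0\<close> the truncated \<open>m - 1\<close> points to index 0 again, but
  the factor \<open>sqrt m\<close> vanishes there, as the creation operator requires.\<close>

definition cre1 :: "seq2 \<Rightarrow> seq2" where
  "cre1 f = (\<lambda>(m, n). complex_of_real (sqrt m) * f (m - 1, n))"
definition ann1 :: "seq2 \<Rightarrow> seq2" where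
  "ann1 f = (\<lambda>(m, n). complex_of_real (sqrt (Suc m)) * f (Suc m, n))"
definition cre2 :: "seq2 \<Rightarrow> seq2" where
  "cre2 f = (\<lambda>(m, n). complex_of_real (sqrt n) * f (m, n - 1))"
definition ann2 :: "seq2 \<Rightarrow> seq2" where
  "ann2 f = (\<lambda>(m, n). complex_of_real (sqrt (Suc n)) * f (m, Suc n))"

lemmas ladder_defs = cre1_def ann1_def cre2_def ann2_def

lemma sqrt_le_self: "sqrt (real n) \<le> real n"
  by (cases n) (auto intro!: real_le_lsqrt simp: power2_eq_square)

lemma rdf_ladder:
  assumes "rdf f"
  shows "rdf (cre1 f)" "rdf (ann1 f)" "rdf (cre2 f)" "rdf (ann2 f)"
proof -
  have ladder_bound: "sqrt (real j) * cmod z \<le> 2 * ((1 + real j' + real k) * cmod z)"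
    "sqrt (real j) * cmod z \<le> 2 * ((1 + real k + real j') * cmod z)" if "j \<le> Suc j'" for j j' k z
  proof -
    have "sqrt (real j) \<le> 2 * (1 + real j' + real k)" using sqrt_le_self[of j] that by simp
    from mult_right_mono[OF this, of "cmod z"]
    show "sqrt (real j) * cmod z \<le> 2 * ((1 + real j' + real k) * cmod z)"
      "sqrt (real j) * cmod z \<le> 2 * ((1 + real k + real j') * cmod z)"
      by (simp_all only: mult.assoc add.assoc add.commute[of "real k"] norm_ge_zero)
  qed
  show "rdf (cre1 f)"
  proof (rule rdf_dominated_shift[OF assms, where c = 2])
    fix m n
    have "cmod (cre1 f (m, n)) \<le> 2 * ((1 + real (m - 1) + real n) * cmod (f (m - 1, n)))"
      using ladder_bound(1)[of m "m - 1"] by (simp add: cre1_def norm_mult)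
    moreover have "1 + real m + real n \<le> 2 * (1 + real (m - 1) + real n)" by (cases m) auto
    ultimately show "\<exists>m' n'. 1 + real m + real n \<le> 2 * (1 + real m' + real n') \<and>
      cmod (cre1 f (m, n)) \<le> 2 * ((1 + real m' + real n') * cmod (f (m', n')))" by blast
  qed simp
  show "rdf (cre2 f)"
  proof (rule rdf_dominated_shift[OF assms, where c = 2])
    fix m n
    have "cmod (cre2 f (m, n)) \<le> 2 * ((1 + real m + real (n - 1)) * cmod (f (m, n - 1)))"
      using ladder_bound(2)[of n "n - 1"] by (simp add: cre2_def norm_mult)
    moreover have "1 + real m + real n \<le> 2 * (1 + real m + real (n - 1))" by (cases n) auto
    ultimately show "\<exists>m' n'. 1 + real m + real n \<le> 2 * (1 + real m' + real n') \<and>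
      cmod (cre2 f (m, n)) \<le> 2 * ((1 + real m' + real n') * cmod (f (m', n')))" by blast
  qed simp
  show "rdf (ann1 f)"
  proof (rule rdf_dominated_shift[OF assms, where c = 2])
    fix m n
    have "cmod (ann1 f (m, n)) \<le> 2 * ((1 + real (Suc m) + real n) * cmod (f (Suc m, n)))"
      using ladder_bound(1)[of "Suc m" "Suc m"] by (simp add: ann1_def norm_mult del: of_nat_Suc)
    moreover have "1 + real m + real n \<le> 2 * (1 + real (Suc m) + real n)" by simp
    ultimately show "\<exists>m' n'. 1 + real m + real n \<le> 2 * (1 + real m' + real n') \<and>
      cmod (ann1 f (m, n)) \<le> 2 * ((1 + real m' + real n') * cmod (f (m', n')))" by blast
  qed simp
  show "rdf (ann2 f)"
  proof (rule rdf_dominated_shift[OF assms, where c = 2])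
    fix m n
    have "cmod (ann2 f (m, n)) \<le> 2 * ((1 + real m + real (Suc n)) * cmod (f (m, Suc n)))"
      using ladder_bound(2)[of "Suc n" "Suc n"] by (simp add: ann2_def norm_mult del: of_nat_Suc)
    moreover have "1 + real m + real n \<le> 2 * (1 + real m + real (Suc n))" by simp
    ultimately show "\<exists>m' n'. 1 + real m + real n \<le> 2 * (1 + real m' + real n') \<and>
      cmod (ann2 f (m, n)) \<le> 2 * ((1 + real m' + real n') * cmod (f (m', n')))" by blast
  qed simp
qed

lemma ladder_linear:
  "cre1 (\<lambda>p. f p + g p) = (\<lambda>p. cre1 f p + cre1 g p)" "cre1 (\<lambda>p. c * f p) = (\<lambda>p. c * cre1 f p)"
  "ann1 (\<lambda>p. f p + g p) = (\<lambda>p. ann1 f p + ann1 g p)" "ann1 (\<lambda>p. c * f p) = (\<lambda>p. c * ann1 f p)"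
  "cre2 (\<lambda>p. f p + g p) = (\<lambda>p. cre2 f p + cre2 g p)" "cre2 (\<lambda>p. c * f p) = (\<lambda>p. c * cre2 f p)"
  "ann2 (\<lambda>p. f p + g p) = (\<lambda>p. ann2 f p + ann2 g p)" "ann2 (\<lambda>p. c * f p) = (\<lambda>p. c * ann2 f p)"
  by (auto simp: ladder_defs fun_eq_iff algebra_simps)

lemma sqrt_self_mult: "complex_of_real (sqrt (real k)) * (complex_of_real (sqrt (real k)) * z) = of_nat k * z"
  by (simp flip: mult.assoc of_real_mult)

lemma ladder_commute:
  "ann1 (cre1 f) p = cre1 (ann1 f) p + f p" "ann2 (cre2 f) p = cre2 (ann2 f) p + f p"
  "cre1 (cre2 f) = cre2 (cre1 f)" "ann1 (ann2 f) = ann2 (ann1 f)"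
  "ann1 (cre2 f) = cre2 (ann1 f)" "ann2 (cre1 f) = cre1 (ann2 f)"
proof -
  obtain m n where p: "p = (m, n)" by (cases p)
  show "ann1 (cre1 f) p = cre1 (ann1 f) p + f p"
    by (cases m) (simp_all add: p ladder_defs sqrt_self_mult distrib_right del: of_nat_Suc, simp add: distrib_right)
  show "ann2 (cre2 f) p = cre2 (ann2 f) p + f p"
    by (cases n) (simp_all add: p ladder_defs sqrt_self_mult distrib_right del: of_nat_Suc, simp add: distrib_right)
qed (auto simp: ladder_defs fun_eq_iff)

text \<open>After a shift of the index the two sums have the same terms, and the terms outside the
  range of the shift are zero. The adjunction thus holds for all families, summable or not.\<close>

lemma infsum_cre:
  "(\<Sum>\<^sub>\<infinity>p. cnj (cre1 f p) * g p) = (\<Sum>\<^sub>\<infinity>p. cnj (f p) * ann1 g p)"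
  "(\<Sum>\<^sub>\<infinity>p. cnj (cre2 f p) * g p) = (\<Sum>\<^sub>\<infinity>p. cnj (f p) * ann2 g p)"
proof -
  have "cre1 f p = 0" if "p \<notin> range (\<lambda>(m, n). (Suc m, n))" for p
    using that by (cases p; cases "fst p") (auto simp: cre1_def image_iff)
  then have "(\<Sum>\<^sub>\<infinity>p. cnj (cre1 f p) * g p) = (\<Sum>\<^sub>\<infinity>p\<in>range (\<lambda>(m, n). (Suc m, n)). cnj (cre1 f p) * g p)"
    by (intro infsum_cong_neutral) auto
  also have "\<dots> = (\<Sum>\<^sub>\<infinity>p. cnj (f p) * ann1 g p)"
    by (subst infsum_reindex, simp add: inj_on_def, rule infsum_cong)
      (auto simp: ladder_defs case_prod_unfold)
  finally show "(\<Sum>\<^sub>\<infinity>p. cnj (cre1 f p) * g p) = (\<Sum>\<^sub>\<infinity>p. cnj (f p) * ann1 g p)" .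
  have "cre2 f p = 0" if "p \<notin> range (\<lambda>(m, n). (m, Suc n))" for p
    using that by (cases p; cases "snd p") (auto simp: cre2_def image_iff)
  then have "(\<Sum>\<^sub>\<infinity>p. cnj (cre2 f p) * g p) = (\<Sum>\<^sub>\<infinity>p\<in>range (\<lambda>(m, n). (m, Suc n)). cnj (cre2 f p) * g p)"
    by (intro infsum_cong_neutral) auto
  also have "\<dots> = (\<Sum>\<^sub>\<infinity>p. cnj (f p) * ann2 g p)"
    by (subst infsum_reindex, simp add: inj_on_def, rule infsum_cong)
      (auto simp: ladder_defs case_prod_unfold)
  finally show "(\<Sum>\<^sub>\<infinity>p. cnj (cre2 f p) * g p) = (\<Sum>\<^sub>\<infinity>p. cnj (f p) * ann2 g p)" .
qed

section \<open>The Fock representation of the algebra\<close>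

fun gen_op :: "complex \<Rightarrow> two \<Rightarrow> bool \<Rightarrow> seq2 \<Rightarrow> seq2" where
  "gen_op x G1 False f = cre1 f"
| "gen_op x G1 True f = ann1 f"
| "gen_op x G2 False f = (\<lambda>p. complex_of_real (sqrt (1 + (cmod x)\<^sup>2)) * cre2 f p + x * ann1 f p)"
| "gen_op x G2 True f = (\<lambda>p. complex_of_real (sqrt (1 + (cmod x)\<^sup>2)) * ann2 f p + cnj x * cre1 f p)"

text \<open>The Boolean argument tells whether the operator of the term or that of its star is meant.
  The ladder operators act on all families, without any convergence requirement.\<close>

primrec fock_op :: "complex \<Rightarrow> two sterm \<Rightarrow> bool \<Rightarrow> seq2 \<Rightarrow> seq2" where
  "fock_op x (Gen g) b f = gen_op x g b f"
| "fock_op x Zero b f = (\<lambda>p. 0)"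
| "fock_op x One b f = f"
| "fock_op x (Add s t) b f = (\<lambda>p. fock_op x s b f p + fock_op x t b f p)"
| "fock_op x (Mult s t) b f =
    (if b then fock_op x t b (fock_op x s b f) else fock_op x s b (fock_op x t b f))"
| "fock_op x (Scale c s) b f = (\<lambda>p. (if b then cnj c else c) * fock_op x s b f p)"
| "fock_op x (Star s) b f = fock_op x s (\<not> b) f"

lemma gen_op_linear:
  "gen_op x g b (\<lambda>p. f p + h p) = (\<lambda>p. gen_op x g b f p + gen_op x g b h p)"
  "gen_op x g b (\<lambda>p. c * f p) = (\<lambda>p. c * gen_op x g b f p)"
  by (cases g; cases b; simp add: ladder_linear algebra_simps)+

lemma fock_op_linear:
  "fock_op x s b (\<lambda>p. f p + h p) = (\<lambda>p. fock_op x s b f p + fock_op x s b h p)"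
  "fock_op x s b (\<lambda>p. c * f p) = (\<lambda>p. c * fock_op x s b f p)"
proof (induction s arbitrary: b f h c)
  case (Gen g)
  show "fock_op x (Gen g) b (\<lambda>p. f p + h p) = (\<lambda>p. fock_op x (Gen g) b f p + fock_op x (Gen g) b h p)"
    "fock_op x (Gen g) b (\<lambda>p. c * f p) = (\<lambda>p. c * fock_op x (Gen g) b f p)" for b f h c
    by (simp_all add: gen_op_linear)
qed (simp_all add: algebra_simps)

lemma sqrt_one_plus_square:
  "complex_of_real (sqrt (1 + (cmod x)\<^sup>2)) * complex_of_real (sqrt (1 + (cmod x)\<^sup>2)) = 1 + x * cnj x"
  using complex_norm_square[of x] by (simp flip: of_real_mult)

text \<open>Both values of \<open>b\<close> have to be covered: the rule \<open>cong_star\<close>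
  passes from the operator of a term to that of its star, and so uses the adjoint of every
  relation.\<close>

lemma fock_op_relations:
  assumes "(s, t) \<in> A2_relations x"
  shows "fock_op x s b f = fock_op x t b f"
proof -
  have *: "fock_op x s True f p = fock_op x t True f p \<and> fock_op x s False f p = fock_op x t False f p" for p
    using assms unfolding A2_relations_def
    by (elim insertE emptyE; simp add: ladder_linear ladder_commute)
      (simp_all add: algebra_simps sqrt_one_plus_square)
  then show ?thesis by (cases b) (auto simp: fun_eq_iff)
qed

lemma fock_op_cong: "star_cong (A2_relations x) s t \<Longrightarrow> fock_op x s b f = fock_op x t b f"
proof (induction arbitrary: b f rule: star_cong.induct)
  case (rel s t)
  then show ?case by (rule fock_op_relations)
qed (simp_all add: fock_op_linear algebra_simps)

lemma rdf_gen_op: "rdf f \<Longrightarrow> rdf (gen_op x g b f)"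
  by (cases g; cases b) (simp_all add: rdf_ladder rdf_add rdf_scale)

lemma rdf_fock_op: "rdf f \<Longrightarrow> rdf (fock_op x s b f)"
  by (induction s arbitrary: b f) (simp_all add: rdf_gen_op rdf_zero rdf_add rdf_scale)

definition fock :: "complex \<Rightarrow> two sterm \<Rightarrow> bool \<Rightarrow> (nat \<times> nat) ell2 \<Rightarrow> (nat \<times> nat) ell2" where
  "fock x s b v = Abs_ell2 (fock_op x s b (Rep_ell2 v))"

lemma Rep_fock:
  assumes "v \<in> rapidly_decreasing"
  shows "Rep_ell2 (fock x s b v) = fock_op x s b (Rep_ell2 v)"
  unfolding fock_def using assms by (intro rdf_Abs rdf_fock_op) (simp add: rapidly_decreasing_iff)

lemma fock_rapidly_decreasing: "v \<in> rapidly_decreasing \<Longrightarrow> fock x s b v \<in> rapidly_decreasing"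
  by (simp add: rapidly_decreasing_iff[of "fock x s b v"] Rep_fock rapidly_decreasing_iff rdf_fock_op)

lemma rapidly_decreasing_add: "u \<in> rapidly_decreasing \<Longrightarrow> v \<in> rapidly_decreasing \<Longrightarrow> u + v \<in> rapidly_decreasing"
  and rapidly_decreasing_scale: "u \<in> rapidly_decreasing \<Longrightarrow> c *\<^sub>C u \<in> rapidly_decreasing"
  using complex_subspaceD[OF complex_subspace_rapidly_decreasing] by blast+

lemma fock_simps:
  assumes "v \<in> rapidly_decreasing"
  shows "fock x Zero b v = 0" "fock x One b v = v"
    "fock x (Add s t) b v = fock x s b v + fock x t b v"
    "fock x (Mult s t) b v = (if b then fock x t b (fock x s b v) else fock x s b (fock x t b v))"
    "fock x (Scale c s) b v = (if b then cnj c else c) *\<^sub>C fock x s b v"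
    "fock x (Star s) b v = fock x s (\<not> b) v"
    "fock x s b (c *\<^sub>C v) = c *\<^sub>C fock x s b v"
    "w \<in> rapidly_decreasing \<Longrightarrow> fock x s b (v + w) = fock x s b v + fock x s b w"
  using assms
  by (auto intro!: ell2_eqI simp: Rep_fock Rep_ell2_simps Rep_ell2_scaleC fock_rapidly_decreasing
      fock_op_linear rapidly_decreasing_add rapidly_decreasing_scale)

lemma fock_cong: "star_cong (A2_relations x) s t \<Longrightarrow> fock x s b v = fock x t b v"
  by (simp add: fock_def fock_op_cong)

lemma cinner_cre:
  assumes "u \<in> rapidly_decreasing" "v \<in> rapidly_decreasing"
  shows "cinner (Abs_ell2 (cre1 (Rep_ell2 u))) v = cinner u (Abs_ell2 (ann1 (Rep_ell2 v)))"
    "cinner (Abs_ell2 (cre2 (Rep_ell2 u))) v = cinner u (Abs_ell2 (ann2 (Rep_ell2 v)))"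
    "cinner (Abs_ell2 (ann1 (Rep_ell2 u))) v = cinner u (Abs_ell2 (cre1 (Rep_ell2 v)))"
    "cinner (Abs_ell2 (ann2 (Rep_ell2 u))) v = cinner u (Abs_ell2 (cre2 (Rep_ell2 v)))"
proof -
  have *: "cinner (Abs_ell2 (cre1 (Rep_ell2 u))) v = cinner u (Abs_ell2 (ann1 (Rep_ell2 v)))"
    "cinner (Abs_ell2 (cre2 (Rep_ell2 u))) v = cinner u (Abs_ell2 (ann2 (Rep_ell2 v)))"
    if "u \<in> rapidly_decreasing" "v \<in> rapidly_decreasing" for u v
    using that by (simp_all add: cinner_ell2_def rdf_Abs rdf_ladder rapidly_decreasing_iff infsum_cre)
  show "cinner (Abs_ell2 (cre1 (Rep_ell2 u))) v = cinner u (Abs_ell2 (ann1 (Rep_ell2 v)))"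
    "cinner (Abs_ell2 (cre2 (Rep_ell2 u))) v = cinner u (Abs_ell2 (ann2 (Rep_ell2 v)))"
    using * assms by blast+
  show "cinner (Abs_ell2 (ann1 (Rep_ell2 u))) v = cinner u (Abs_ell2 (cre1 (Rep_ell2 v)))"
    "cinner (Abs_ell2 (ann2 (Rep_ell2 u))) v = cinner u (Abs_ell2 (cre2 (Rep_ell2 v)))"
    using *[OF assms(2,1)] by (metis cinner_commute)+
qed

lemma fock_Gen:
  assumes "v \<in> rapidly_decreasing"
  shows "fock x (Gen G1) False v = Abs_ell2 (cre1 (Rep_ell2 v))"
    "fock x (Gen G1) True v = Abs_ell2 (ann1 (Rep_ell2 v))"
    "fock x (Gen G2) False v = complex_of_real (sqrt (1 + (cmod x)\<^sup>2)) *\<^sub>C Abs_ell2 (cre2 (Rep_ell2 v))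
      + x *\<^sub>C Abs_ell2 (ann1 (Rep_ell2 v))"
    "fock x (Gen G2) True v = complex_of_real (sqrt (1 + (cmod x)\<^sup>2)) *\<^sub>C Abs_ell2 (ann2 (Rep_ell2 v))
      + cnj x *\<^sub>C Abs_ell2 (cre1 (Rep_ell2 v))"
  using assms
  by (auto intro!: ell2_eqI simp: Rep_fock Rep_ell2_simps Rep_ell2_scaleC rdf_Abs rdf_ladder
      rapidly_decreasing_iff)

lemma fock_adjoint:
  assumes "u \<in> rapidly_decreasing" "v \<in> rapidly_decreasing"
  shows "cinner (fock x s b u) v = cinner u (fock x s (\<not> b) v)"
  using assms
proof (induction s arbitrary: b u v)
  case (Gen g)
  then show ?case
    by (cases g; cases b) (simp_all add: fock_Gen cinner_simps cinner_cre)
qed (auto simp: fock_simps cinner_simps fock_rapidly_decreasing)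

definition fock_rep :: "complex \<Rightarrow> two sterm set \<Rightarrow> (nat \<times> nat) ell2 \<Rightarrow> (nat \<times> nat) ell2" where
  "fock_rep x u v = fock x (SOME s. u = term_class (A2_relations x) s) False v"

lemma fock_rep_term_class: "fock_rep x (term_class (A2_relations x) s) v = fock x s False v"
  unfolding fock_rep_def
  by (rule someI2[of _ s]) (auto simp: term_class_eq_iff intro: fock_cong[symmetric])

lemma star_rep_fock: "star_rep (A2 x) rapidly_decreasing (fock_rep x)"
  unfolding star_rep_def A2_def
  by (auto simp: presented_star_algebra_simps fock_rep_term_class fock_simps fock_rapidly_decreasing
      complex_subspace_rapidly_decreasing dense_rapidly_decreasing fock_adjoint)

text \<open>\<open>Abs_ell2\<close> can be undone only on square-summable families; rapid decrease
  guarantees this for the raised and lowered families, whose slices are then the images of the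
  slices of \<open>v\<close>.\<close>

lemma tensor_creation:
  assumes "v \<in> rapidly_decreasing"
  shows "tensor_id creation v = Abs_ell2 (cre1 (Rep_ell2 v))"
    "id_tensor creation v = Abs_ell2 (cre2 (Rep_ell2 v))"
    "tensor_id annihilation v = Abs_ell2 (ann1 (Rep_ell2 v))"
proof -
  have v: "rdf (Rep_ell2 v)" using assms by (simp add: rapidly_decreasing_iff)
  have "creation (Abs_ell2 (\<lambda>i. Rep_ell2 v (i, j))) =
      Abs_ell2 (\<lambda>i. Rep_ell2 (Abs_ell2 (cre1 (Rep_ell2 v))) (i, j))" for j
    unfolding creation_def Rep_Abs_ell2_slice rdf_Abs(1)[OF rdf_ladder(1)[OF v]]
    by (rule arg_cong[of _ _ Abs_ell2]) (auto simp: cre1_def fun_eq_iff split: nat.split)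
  then show "tensor_id creation v = Abs_ell2 (cre1 (Rep_ell2 v))"
    by (simp only: tensor_id_def Rep_Abs_ell2_slice case_prod_eta Rep_ell2_inverse)
  have "creation (Abs_ell2 (\<lambda>j. Rep_ell2 v (i, j))) =
      Abs_ell2 (\<lambda>j. Rep_ell2 (Abs_ell2 (cre2 (Rep_ell2 v))) (i, j))" for i
    unfolding creation_def Rep_Abs_ell2_slice rdf_Abs(1)[OF rdf_ladder(3)[OF v]]
    by (rule arg_cong[of _ _ Abs_ell2]) (auto simp: cre2_def fun_eq_iff split: nat.split)
  then show "id_tensor creation v = Abs_ell2 (cre2 (Rep_ell2 v))"
    by (simp only: id_tensor_def Rep_Abs_ell2_slice case_prod_eta Rep_ell2_inverse)
  have "annihilation (Abs_ell2 (\<lambda>i. Rep_ell2 v (i, j))) =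
      Abs_ell2 (\<lambda>i. Rep_ell2 (Abs_ell2 (ann1 (Rep_ell2 v))) (i, j))" for j
    unfolding annihilation_def Rep_Abs_ell2_slice rdf_Abs(1)[OF rdf_ladder(2)[OF v]]
    by (simp add: ann1_def)
  then show "tensor_id annihilation v = Abs_ell2 (ann1 (Rep_ell2 v))"
    by (simp only: tensor_id_def Rep_Abs_ell2_slice case_prod_eta Rep_ell2_inverse)
qed

lemma fock_rep_gens:
  assumes "v \<in> rapidly_decreasing"
  shows "fock_rep x (A2_gen x G1) v = tensor_id creation v"
    "fock_rep x (A2_gen x G2) v = complex_of_real (sqrt (1 + (cmod x)\<^sup>2)) *\<^sub>C id_tensor creation v
      + x *\<^sub>C tensor_id annihilation v"
  using assms by (simp_all add: A2_gen_def fock_rep_term_class fock_Gen tensor_creation)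

text \<open>Up to scalars the vacuum is the only vector killed by both annihilation operators, and
  the creation operators reach every \<open>ket\<close> from it. An orthogonal invariant splitting
  must put the vacuum into one summand, and the other one is then orthogonal to a total set.\<close>

lemma fock_rep_irreducible: "irreducible_rep (A2 x) rapidly_decreasing (fock_rep x)"
proof -
  define r where "r = complex_of_real (sqrt (1 + (cmod x)\<^sup>2))"
  have "0 < sqrt (1 + (cmod x)\<^sup>2)" by (simp add: add_pos_nonneg)
  then have r: "r \<noteq> 0" unfolding r_def of_real_eq_0_iff by linarith
  \<comment> \<open>These terms undo the substitution for the second generator: they act as
    \<open>ann1\<close>, \<open>ann2\<close> and \<open>cre2\<close> for every
    \<open>x\<close>.\<close>
  define L1 :: "two sterm" where "L1 = Gen_star G1"
  define L2 :: "two sterm" where "L2 = Scale (1 / r) (Add (Gen_star G2) (Scale (- cnj x) (Gen G1)))"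
  define R2 :: "two sterm" where "R2 = Scale (1 / r) (Add (Gen G2) (Scale (- x) (Gen_star G1)))"
  have op: "fock_op x L1 False f = ann1 f" "fock_op x L2 False f = ann2 f"
    "fock_op x R2 False f = cre2 f" "fock_op x (Gen G1) False f = cre1 f" for f
    using r by (auto simp: L1_def L2_def R2_def r_def[symmetric] fun_eq_iff field_simps)
  have inv: "fock x s False v \<in> E" if "invariant_subspace (A2 x) (fock_rep x) E" "v \<in> E" for E s v
    using that by (auto simp: invariant_subspace_def A2_def presented_star_algebra_simps fock_rep_term_class)
  have full: "E' = {0}"
    if E: "invariant_subspace (A2 x) (fock_rep x) E" "ket (0, 0) \<in> E"
      and E': "invariant_subspace (A2 x) (fock_rep x) E'" and orth: "\<forall>v\<in>E. \<forall>w\<in>E'. cinner v w = 0"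
    for E E'
  proof -
    have cE: "complex_subspace E" "complex_subspace E'" using E E' by (auto simp: invariant_subspace_def)
    have sq: "sqrt (real (Suc n)) \<noteq> 0" for n by simp
    have 1: "ket (Suc m, n) \<in> E" if "ket (m, n) \<in> E" for m n
    proof -
      have "fock x (Gen G1) False (ket (m, n)) = complex_of_real (sqrt (Suc m)) *\<^sub>C ket (Suc m, n)"
        by (rule ell2_eqI, subst Rep_fock[OF ket_rapidly_decreasing], unfold op Rep_ell2_scaleC Rep_ket)
          (auto simp: cre1_def split: prod.split)
      then have "complex_of_real (1 / sqrt (Suc m)) *\<^sub>C (complex_of_real (sqrt (Suc m)) *\<^sub>C ket (Suc m, n)) \<in> E"
        using inv[OF E(1) that, of "Gen G1"] complex_subspaceD(3)[OF cE(1)] by metis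
      then show ?thesis using sq[of m] by (simp add: scaleC_scaleC flip: of_real_mult)
    qed
    have 2: "ket (m, Suc n) \<in> E" if "ket (m, n) \<in> E" for m n
    proof -
      have "fock x R2 False (ket (m, n)) = complex_of_real (sqrt (Suc n)) *\<^sub>C ket (m, Suc n)"
        by (rule ell2_eqI, subst Rep_fock[OF ket_rapidly_decreasing], unfold op Rep_ell2_scaleC Rep_ket)
          (auto simp: cre2_def split: prod.split)
      then have "complex_of_real (1 / sqrt (Suc n)) *\<^sub>C (complex_of_real (sqrt (Suc n)) *\<^sub>C ket (m, Suc n)) \<in> E"
        using inv[OF E(1) that, of R2] complex_subspaceD(3)[OF cE(1)] by metis
      then show ?thesis using sq[of n] by (simp add: scaleC_scaleC flip: of_real_mult)
    qed
    have "ket (m, 0) \<in> E" for m by (induction m) (auto intro: E(2) 1)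
    then have "ket (m, n) \<in> E" for m n by (induction n) (auto intro: 2)
    then have k: "ket p \<in> E" for p by (cases p) auto
    have "w = 0" if "w \<in> E'" for w
      using orth k that by (intro total_orthogonal_zero[OF total_ket]) auto
    then show ?thesis using complex_subspaceD(1)[OF cE(2)] by blast
  qed
  have vac: "v = Rep_ell2 v (0, 0) *\<^sub>C ket (0, 0)"
    if v: "v \<in> rapidly_decreasing" and z: "fock x L1 False v = 0" "fock x L2 False v = 0" for v
  proof (rule ell2_eqI)
    fix p :: "nat \<times> nat"
    obtain m n where p: "p = (m, n)" by (cases p)
    have "ann1 (Rep_ell2 v) = (\<lambda>_. 0)" "ann2 (Rep_ell2 v) = (\<lambda>_. 0)"
      using Rep_fock[OF v, of x L1 False] Rep_fock[OF v, of x L2 False] z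
      by (simp_all add: op Rep_ell2_simps)
    then have "ann1 (Rep_ell2 v) (m, n) = 0" "ann2 (Rep_ell2 v) (m, n) = 0" for m n by simp_all
    then have "Rep_ell2 v (Suc m, n) = 0" "Rep_ell2 v (m, Suc n) = 0" for m n
      by (simp_all add: ladder_defs del: of_nat_Suc)
    then show "Rep_ell2 v p = Rep_ell2 (Rep_ell2 v (0, 0) *\<^sub>C ket (0, 0)) p"
      by (cases m; cases n) (auto simp: p Rep_ell2_scaleC Rep_ket)
  qed
  show ?thesis
    unfolding irreducible_rep_def
  proof (intro conjI allI impI, goal_cases)
    case 1
    have "ket (0, 0) \<noteq> (0 :: (nat \<times> nat) ell2)"
    proof
      assume "ket (0, 0) = (0 :: (nat \<times> nat) ell2)"
      then have "cinner (ket (0, 0)) (ket (0, 0) :: (nat \<times> nat) ell2) = 0" by simp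
      then show False by (subst (asm) cinner_ket) (simp add: Rep_ket)
    qed
    then show ?case using ket_rapidly_decreasing by blast
  next
    case (2 D1 D2)
    then have D1: "invariant_subspace (A2 x) (fock_rep x) D1" and D2: "invariant_subspace (A2 x) (fock_rep x) D2"
      and orth: "\<forall>v\<in>D1. \<forall>w\<in>D2. cinner v w = 0"
      and D: "rapidly_decreasing = {v + w |v w. v \<in> D1 \<and> w \<in> D2}" by blast+
    have zero: "0 \<in> D1" "0 \<in> D2"
      using D1 D2 complex_subspaceD(1) by (auto simp: invariant_subspace_def)
    have sub: "D1 \<subseteq> rapidly_decreasing" "D2 \<subseteq> rapidly_decreasing"
      unfolding D using zero by force+
    obtain v w where vw: "ket (0, 0) = v + w" "v \<in> D1" "w \<in> D2"
      using ket_rapidly_decreasing[of "(0, 0)"] unfolding D by blast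
    have vwr: "v \<in> rapidly_decreasing" "w \<in> rapidly_decreasing" using vw sub by auto
    have low: "fock x s False v = 0 \<and> fock x s False w = 0"
      if s: "fock_op x s False (Rep_ell2 (ket (0, 0))) = (\<lambda>_. 0)" for s
    proof -
      have "fock x s False (v + w) = 0"
        using s by (intro ell2_eqI) (simp add: Rep_fock ket_rapidly_decreasing Rep_ell2_simps flip: vw(1))
      \<comment> \<open>The two images cancel although they lie in orthogonal summands, so each of
        them is zero.\<close>
      then have "fock x s False v = - fock x s False w"
        by (simp add: fock_simps vwr eq_neg_iff_add_eq_0)
      moreover have "cinner (fock x s False v) (fock x s False w) = 0"
        using orth inv[OF D1 vw(2)] inv[OF D2 vw(3)] by blast
      ultimately show ?thesis by (simp add: cinner_minus_left)
    qed
    have "fock_op x L1 False (Rep_ell2 (ket (0, 0))) = (\<lambda>_. 0)" "fock_op x L2 False (Rep_ell2 (ket (0, 0))) = (\<lambda>_. 0)"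
      unfolding op by (auto simp: ladder_defs Rep_ket)
    from low[OF this(1)] low[OF this(2)]
    have v: "v = Rep_ell2 v (0, 0) *\<^sub>C ket (0, 0)" and w: "w = Rep_ell2 w (0, 0) *\<^sub>C ket (0, 0)"
      using vac vwr by blast+
    have "cinner v w = 0" using orth vw by blast
    then have "cnj (Rep_ell2 v (0, 0)) * Rep_ell2 w (0, 0) = 0"
      by (subst (asm) v, subst (asm) w) (simp add: cinner_simps cinner_ket Rep_ket)
    then have "w = 0 \<or> v = 0" using v w by (metis complex_cnj_zero_iff mult_eq_0_iff scaleC_zero_left)
    then show ?case
    proof
      assume "w = 0"
      then have "ket (0, 0) \<in> D1" using vw by simp
      then show ?thesis using full[OF D1 _ D2 orth] by blast
    next
      assume "v = 0"
      then have "ket (0, 0) \<in> D2" using vw by simp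
      moreover have "\<forall>v\<in>D2. \<forall>w\<in>D1. cinner v w = 0" using orth by (metis cinner_commute complex_cnj_zero)
      ultimately show ?thesis using full[OF D2 _ D1] by blast
    qed
  qed
qed

section \<open>Changing the parameter of the algebra\<close>

lemma equivp_star_cong: "equivp (star_cong R)"
  by (rule equivpI)
    (auto intro!: reflpI sympI transpI intro: star_cong.refl star_cong.sym star_cong.trans)

text \<open>Noncommutative identities are verified in the free star-algebra, where they are equations in a
  ring type, and carry over to every presented algebra.\<close>

quotient_type 'g free_star_algebra = "'g sterm" / "star_cong {}"
  by (rule equivp_star_cong)

instantiation free_star_algebra :: (type) "{ring, monoid_mult}"
begin

lift_definition zero_free_star_algebra :: "'a free_star_algebra" is Zero .
lift_definition one_free_star_algebra :: "'a free_star_algebra" is One .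
lift_definition plus_free_star_algebra :: "'a free_star_algebra \<Rightarrow> 'a free_star_algebra \<Rightarrow> 'a free_star_algebra"
  is Add by (rule star_cong.cong_add)
lift_definition times_free_star_algebra :: "'a free_star_algebra \<Rightarrow> 'a free_star_algebra \<Rightarrow> 'a free_star_algebra"
  is Mult by (rule star_cong.cong_mult)
lift_definition uminus_free_star_algebra :: "'a free_star_algebra \<Rightarrow> 'a free_star_algebra"
  is "Scale (-1)" by (rule star_cong.cong_scale)
lift_definition minus_free_star_algebra :: "'a free_star_algebra \<Rightarrow> 'a free_star_algebra \<Rightarrow> 'a free_star_algebra"
  is "\<lambda>s t. Sub s t" by (intro star_cong.cong_add star_cong.cong_scale)

instance
proof
  fix u v w :: "'a free_star_algebra"
  show "u + v + w = u + (v + w)" by transfer (rule star_cong.add_assoc)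
  show "u + v = v + u" by transfer (rule star_cong.add_comm)
  show "0 + u = u" by transfer (rule star_cong.add_zero)
  show "- u + u = 0" by transfer (rule star_cong.trans[OF star_cong.add_comm star_cong.add_neg])
  show "u - v = u + - v" by transfer (rule star_cong.refl)
  show "u * v * w = u * (v * w)" by transfer (rule star_cong.mult_assoc)
  show "(u + v) * w = u * w + v * w" by transfer (rule star_cong.mult_add_left)
  show "u * (v + w) = u * v + u * w" by transfer (rule star_cong.mult_add_right)
  show "1 * u = u" by transfer (rule star_cong.mult_one_left)
  show "u * 1 = u" by transfer (rule star_cong.mult_one_right)
qed

end

lift_definition free_scale :: "complex \<Rightarrow> 'g free_star_algebra \<Rightarrow> 'g free_star_algebra"
  is Scale by (rule star_cong.cong_scale)
lift_definition free_star :: "'g free_star_algebra \<Rightarrow> 'g free_star_algebra"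
  is Star by (rule star_cong.cong_star)

lemma free_scale_simps:
  "free_scale c (u + v) = free_scale c u + free_scale c v"
  "free_scale (c + d) u = free_scale c u + free_scale d u"
  "free_scale c (free_scale d u) = free_scale (c * d) u"
  "free_scale 1 u = u"
  "free_scale c u * v = free_scale c (u * v)"
  "u * free_scale c v = free_scale c (u * v)"
  "free_star (free_star u) = u"
  "free_star (u + v) = free_star u + free_star v"
  "free_star (u * v) = free_star v * free_star u"
  "free_star (free_scale c u) = free_scale (cnj c) (free_star u)"
  by (transfer, rule star_cong.scale_add_right star_cong.scale_add_left star_cong.scale_scale
      star_cong.scale_one star_cong.mult_scale_left star_cong.mult_scale_right star_cong.star_star
      star_cong.star_add star_cong.star_mult star_cong.star_scale)+

lemma free_scale_minus: "free_scale (- c) u = - free_scale c u" "free_scale c (- u) = - free_scale c u"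
  "free_scale 0 u = 0" "free_scale c 0 = 0" "free_scale c (u - v) = free_scale c u - free_scale c v"
  "free_star (u - v) = free_star u - free_star v"
proof -
  have m: "free_scale (-1) u = - u" for u :: "'a free_star_algebra" by transfer (rule star_cong.refl)
  show "free_scale (- c) u = - free_scale c u" "free_scale c (- u) = - free_scale c u"
    unfolding m[symmetric] free_scale_simps by simp_all
  then have "free_scale c (- v) = - free_scale c v" "free_star (- v) = - free_star v"
    unfolding m[symmetric] free_scale_simps by simp_all
  then show "free_scale c (u - v) = free_scale c u - free_scale c v"
    "free_star (u - v) = free_star u - free_star v"
    using free_scale_simps(1)[of c u "- v"] free_scale_simps(8)[of u "- v"] by simp_all
  show "free_scale 0 u = 0" using free_scale_simps(2)[of 0 0 u] by simp
  show "free_scale c 0 = 0" using free_scale_simps(1)[of c 0 0] by simp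
qed

lemma abs_free_simps:
  "abs_free_star_algebra Zero = 0" "abs_free_star_algebra One = 1"
  "abs_free_star_algebra (Add s t) = abs_free_star_algebra s + abs_free_star_algebra t"
  "abs_free_star_algebra (Mult s t) = abs_free_star_algebra s * abs_free_star_algebra t"
  "abs_free_star_algebra (Scale c s) = free_scale c (abs_free_star_algebra s)"
  "abs_free_star_algebra (Star s) = free_star (abs_free_star_algebra s)"
  by (simp_all add: zero_free_star_algebra_def one_free_star_algebra_def plus_free_star_algebra.abs_eq
      times_free_star_algebra.abs_eq free_scale.abs_eq free_star.abs_eq)

lemma star_cong_mono: "star_cong R s t \<Longrightarrow> R \<subseteq> R' \<Longrightarrow> star_cong R' s t"
  by (induction rule: star_cong.induct) (auto intro: star_cong.intros)

lemma star_cong_freeI: "abs_free_star_algebra s = abs_free_star_algebra t \<Longrightarrow> star_cong R s t"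
  using free_star_algebra.abs_eq_iff star_cong_mono by blast

primrec subst :: "('g \<Rightarrow> 'h sterm) \<Rightarrow> 'g sterm \<Rightarrow> 'h sterm" where
  "subst h (Gen g) = h g"
| "subst h Zero = Zero"
| "subst h One = One"
| "subst h (Add s t) = Add (subst h s) (subst h t)"
| "subst h (Mult s t) = Mult (subst h s) (subst h t)"
| "subst h (Scale c s) = Scale c (subst h s)"
| "subst h (Star s) = Star (subst h s)"

lemma subst_cong:
  assumes "\<And>s t. (s, t) \<in> R \<Longrightarrow> star_cong R' (subst h s) (subst h t)"
  shows "star_cong R s t \<Longrightarrow> star_cong R' (subst h s) (subst h t)"
proof (induction rule: star_cong.induct)
  case (rel s t)
  then show ?case by (rule assms)
qed (auto intro: star_cong.intros)

lemma subst_id: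
  assumes "\<And>g. star_cong R (subst h (k g)) (Gen g)"
  shows "star_cong R (subst h (subst k s)) s"
  by (induction s) (auto intro: assms star_cong.intros)

fun bogoliubov :: "complex \<Rightarrow> complex \<Rightarrow> two \<Rightarrow> two sterm" where
  "bogoliubov \<rho> \<sigma> G1 = Gen G1"
| "bogoliubov \<rho> \<sigma> G2 = Add (Scale \<rho> (Gen G2)) (Scale \<sigma> (Gen_star G1))"

text \<open>For the new second generator \<open>b2\<close>, the number \<open>z\<close> is the
  commutator of \<open>b2\<close> with the first generator, and the left side of \<open>one\<close>
  is the commutator of the adjoint of \<open>b2\<close> with \<open>b2\<close>. Keeping
  \<open>y\<close> general lets one computation serve both the isomorphism and its inverse.\<close>

lemma bogoliubov_relations:
  assumes z: "z = \<rho> * y + \<sigma>"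
    and one: "\<rho> * cnj \<rho> - \<rho> * cnj \<sigma> * y - cnj \<rho> * \<sigma> * cnj y - \<sigma> * cnj \<sigma> = 1"
    and st: "(s, t) \<in> A2_relations z"
  shows "star_cong (A2_relations y) (subst (bogoliubov \<rho> \<sigma>) s) (subst (bogoliubov \<rho> \<sigma>) t)"
proof -
  let ?R = "A2_relations y"
  \<comment> \<open>Each relation to be proved follows from the values of these commutators by a
    linear combination and an identity of the free star-algebra; \<open>chain\<close> joins the
    two.\<close>
  define C1 C2 C3 C4 C4' :: "two sterm" where
    "C1 = Sub (Mult (Gen_star G1) (Gen G1)) (Mult (Gen G1) (Gen_star G1))"
    and "C2 = Sub (Mult (Gen_star G2) (Gen G2)) (Mult (Gen G2) (Gen_star G2))"
    and "C3 = Sub (Mult (Gen_star G1) (Gen G2)) (Mult (Gen G2) (Gen_star G1))"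
    and "C4 = Sub (Mult (Gen G2) (Gen G1)) (Mult (Gen G1) (Gen G2))"
    and "C4' = Star C4"
  have C1: "star_cong ?R C1 One" and C2: "star_cong ?R C2 One" and C4: "star_cong ?R C4 (Scale y One)"
    by (auto simp: A2_relations_def C1_def C2_def C4_def intro: star_cong.rel)
  have "star_cong ?R C3 (Sub (Mult (Gen G2) (Gen_star G1)) (Mult (Gen G2) (Gen_star G1)))"
    unfolding C3_def
    by (intro star_cong.cong_add star_cong.refl star_cong.rel) (simp add: A2_relations_def)
  then have C3: "star_cong ?R C3 Zero" using star_cong.add_neg star_cong.trans by blast
  have one_star: "free_star (1 :: two free_star_algebra) = 1"
    using free_scale_simps(9)[of "free_star 1 :: two free_star_algebra" 1]
    by (metis free_scale_simps(7) mult_1 mult_1_right)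
  have C4': "star_cong ?R C4' (Scale (cnj y) One)"
    unfolding C4'_def
    by (rule star_cong.trans[OF star_cong.cong_star[OF C4] star_cong_freeI])
      (simp add: abs_free_simps free_scale_simps one_star)
  define a1 a2 :: "two free_star_algebra" where "a1 = abs_free_star_algebra (Gen G1)"
    and "a2 = abs_free_star_algebra (Gen G2)"
  note simps = abs_free_simps free_scale_simps free_scale_minus a1_def[symmetric] a2_def[symmetric]
    C1_def C2_def C3_def C4_def C4'_def algebra_simps
  let ?h = "bogoliubov \<rho> \<sigma>"
  have chain: "star_cong ?R s' t'"
    if "star_cong ?R s1 t1" "abs_free_star_algebra s' = abs_free_star_algebra s1"
      "abs_free_star_algebra t1 = abs_free_star_algebra t'" for s' t' s1 t1
    using that star_cong.trans star_cong_freeI by meson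
  consider "s = Sub (Mult (Gen_star G1) (Gen G1)) (Mult (Gen G1) (Gen_star G1))" "t = One"
    | "s = Sub (Mult (Gen_star G2) (Gen G2)) (Mult (Gen G2) (Gen_star G2))" "t = One"
    | "s = Mult (Gen_star G1) (Gen G2)" "t = Mult (Gen G2) (Gen_star G1)"
    | "s = Sub (Mult (Gen G2) (Gen G1)) (Mult (Gen G1) (Gen G2))" "t = Scale z One"
    using st unfolding A2_relations_def by blast
  then show ?thesis
  proof cases
    case 1
    then show ?thesis using C1 by (simp add: C1_def)
  next
    case 2
    have "star_cong ?R
        (Add (Scale (\<rho> * cnj \<rho>) C2) (Add (Scale (- (\<rho> * cnj \<sigma>)) C4)
          (Add (Scale (- (cnj \<rho> * \<sigma>)) C4') (Scale (- (\<sigma> * cnj \<sigma>)) C1))))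
        (Add (Scale (\<rho> * cnj \<rho>) One) (Add (Scale (- (\<rho> * cnj \<sigma>)) (Scale y One))
          (Add (Scale (- (cnj \<rho> * \<sigma>)) (Scale (cnj y) One)) (Scale (- (\<sigma> * cnj \<sigma>)) One))))"
      by (intro star_cong.cong_add star_cong.cong_scale C1 C2 C4 C4')
    then show ?thesis
    proof (rule chain)
      have "free_scale (\<rho> * cnj \<rho>) 1 + (free_scale (- (\<rho> * cnj \<sigma>) * y) 1 +
          (free_scale (- (cnj \<rho> * \<sigma>) * cnj y) 1 + free_scale (- (\<sigma> * cnj \<sigma>)) 1)) =
        free_scale (\<rho> * cnj \<rho> - \<rho> * cnj \<sigma> * y - cnj \<rho> * \<sigma> * cnj y - \<sigma> * cnj \<sigma>) (1 :: two free_star_algebra)"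
        by (simp flip: free_scale_simps(2)) (simp add: algebra_simps)
      then show "abs_free_star_algebra (Add (Scale (\<rho> * cnj \<rho>) One) (Add (Scale (- (\<rho> * cnj \<sigma>)) (Scale y One))
          (Add (Scale (- (cnj \<rho> * \<sigma>)) (Scale (cnj y) One)) (Scale (- (\<sigma> * cnj \<sigma>)) One))))
          = abs_free_star_algebra (subst ?h t)"
        unfolding one by (simp add: 2 abs_free_simps free_scale_simps(3,4))
    qed (simp add: 2 simps)
  next
    case 3
    have "star_cong ?R (Add (Scale \<rho> C3) (subst ?h t)) (Add (Scale \<rho> Zero) (subst ?h t))"
      by (intro star_cong.cong_add star_cong.cong_scale C3 star_cong.refl)
    then show ?thesis by (rule chain) (simp_all add: 3 simps)
  next
    case 4
    have "star_cong ?R (Add (Scale \<rho> C4) (Scale \<sigma> C1)) (Add (Scale \<rho> (Scale y One)) (Scale \<sigma> One))"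
      by (intro star_cong.cong_add star_cong.cong_scale C1 C4)
    then show ?thesis by (rule chain) (simp_all add: 4 z simps)
  qed
qed

lemma bogoliubov_inverse:
  assumes "\<rho> * \<rho>' = 1" "\<rho>' * \<sigma> + \<sigma>' = 0"
  shows "star_cong R (subst (bogoliubov \<rho> \<sigma>) (bogoliubov \<rho>' \<sigma>' g)) (Gen g)"
proof (rule star_cong_freeI, cases g)
  case G2
  have "\<rho>' * \<rho> = 1" using assms by (simp add: mult.commute)
  then show "abs_free_star_algebra (subst (bogoliubov \<rho> \<sigma>) (bogoliubov \<rho>' \<sigma>' g)) = abs_free_star_algebra (Gen g)"
    using assms by (simp add: G2 abs_free_simps free_scale_simps free_scale_minus add.assoc
        flip: free_scale_simps(2))
qed simp

lemma star_algebra_iso_subst: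
  assumes "\<And>s t. star_cong R s t \<Longrightarrow> star_cong R' (subst h s) (subst h t)"
    and "\<And>s t. star_cong R' s t \<Longrightarrow> star_cong R (subst k s) (subst k t)"
    and "\<And>g. star_cong R (subst k (h g)) (Gen g)" "\<And>g. star_cong R' (subst h (k g)) (Gen g)"
  obtains \<Phi> where "star_algebra_iso (presented_star_algebra R) (presented_star_algebra R') \<Phi>"
    "\<And>s. \<Phi> (term_class R s) = term_class R' (subst h s)"
proof -
  define \<Phi> where "\<Phi> u = term_class R' (subst h (SOME s. u = term_class R s))" for u
  have \<Phi>: "\<Phi> (term_class R s) = term_class R' (subst h s)" for s
    unfolding \<Phi>_def
    by (rule someI2[of _ s]) (auto simp: term_class_eq_iff intro: assms(1) star_cong.sym)
  have "inj_on \<Phi> (range (term_class R))"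
  proof (rule inj_onI, clarsimp simp: \<Phi>)
    fix s t assume "term_class R' (subst h s) = term_class R' (subst h t)"
    then have "star_cong R (subst k (subst h s)) (subst k (subst h t))"
      by (intro assms(2)) (simp add: term_class_eq_iff)
    then show "term_class R s = term_class R t"
      using subst_id[OF assms(3)] by (metis term_class_eq_iff star_cong.sym star_cong.trans)
  qed
  moreover have "\<Phi> ` range (term_class R) = range (term_class R')"
  proof (intro equalityI subsetI)
    fix u assume "u \<in> range (term_class R')"
    then obtain t where "u = term_class R' t" by blast
    also have "\<dots> = \<Phi> (term_class R (subst k t))"
      using subst_id[OF assms(4)] by (simp add: \<Phi> term_class_eq_iff star_cong.sym)
    finally show "u \<in> \<Phi> ` range (term_class R)" by blast
  qed (auto simp: \<Phi>)
  ultimately have "star_algebra_iso (presented_star_algebra R) (presented_star_algebra R') \<Phi>"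
    by (auto simp: star_algebra_iso_def presented_star_algebra_simps \<Phi> bij_betw_def)
  then show thesis by (rule that[OF _ \<Phi>])
qed

text \<open>The choice \<open>r * r = 1 + x * cnj x\<close> satisfies the normalisation of
  \<open>bogoliubov_relations\<close> in both directions: with coefficients \<open>r\<close>,
  \<open>x\<close> over parameter 0, and with \<open>1 / r\<close>, \<open>- x / r\<close> over
  parameter \<open>x\<close>.\<close>

lemma A2_iso:
  obtains \<Phi> where "star_algebra_iso (A2 x) (A2 0) \<Phi>" "\<Phi> (A2_gen x G1) = A2_gen 0 G1"
    "\<Phi> (A2_gen x G2) = complex_of_real (sqrt (1 + (cmod x)\<^sup>2)) \<odot>\<^bsub>A2 0\<^esub> A2_gen 0 G2
       \<oplus>\<^bsub>A2 0\<^esub> x \<odot>\<^bsub>A2 0\<^esub> star (A2 0) (A2_gen 0 G1)"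
    "\<And>s. \<Phi> (term_class (A2_relations x) s) =
      term_class (A2_relations 0) (subst (bogoliubov (complex_of_real (sqrt (1 + (cmod x)\<^sup>2))) x) s)"
proof -
  define r where "r = complex_of_real (sqrt (1 + (cmod x)\<^sup>2))"
  have "0 < sqrt (1 + (cmod x)\<^sup>2)" by (simp add: add_pos_nonneg)
  then have r0: "r \<noteq> 0" unfolding r_def of_real_eq_0_iff by linarith
  have cr: "cnj r = r" by (simp add: r_def)
  have rr: "r * r = 1 + x * cnj x" unfolding r_def by (rule sqrt_one_plus_square)
  have 1: "star_cong (A2_relations 0) (subst (bogoliubov r x) s) (subst (bogoliubov r x) t)"
    if "star_cong (A2_relations x) s t" for s t
    by (rule subst_cong[OF bogoliubov_relations that]) (simp_all add: cr rr)
  have 2: "star_cong (A2_relations x) (subst (bogoliubov (1 / r) (- x / r)) s) (subst (bogoliubov (1 / r) (- x / r)) t)"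
    if "star_cong (A2_relations 0) s t" for s t
  proof (rule subst_cong[OF bogoliubov_relations that])
    have "(1 + x * cnj x) / (r * r) = 1" unfolding rr[symmetric] using r0 by simp
    then show "1 / r * cnj (1 / r) - 1 / r * cnj (- x / r) * x - cnj (1 / r) * (- x / r) * cnj x
        - - x / r * cnj (- x / r) = 1"
      using r0 by (simp add: cr field_simps)
  qed (use r0 in auto)
  have 3: "star_cong (A2_relations x) (subst (bogoliubov (1 / r) (- x / r)) (bogoliubov r x g)) (Gen g)" for g
    using r0 by (intro bogoliubov_inverse) (simp_all add: field_simps)
  have 4: "star_cong (A2_relations 0) (subst (bogoliubov r x) (bogoliubov (1 / r) (- x / r) g)) (Gen g)" for g
    using r0 by (intro bogoliubov_inverse) (simp_all add: field_simps)
  obtain \<Phi> where \<Phi>: "star_algebra_iso (presented_star_algebra (A2_relations x)) (presented_star_algebra (A2_relations 0)) \<Phi>"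
    "\<And>s. \<Phi> (term_class (A2_relations x) s) = term_class (A2_relations 0) (subst (bogoliubov r x) s)"
    using star_algebra_iso_subst[OF 1 2 3 4] by metis
  show thesis
    by (rule that[of \<Phi>]) (simp_all add: \<Phi> A2_def A2_gen_def presented_star_algebra_simps flip: r_def)
qed

section \<open>Coherent vectors\<close>

text \<open>The m-th power of the creation operator sends the vacuum to sqrt (m!) times the m-th
  basis vector; together with the 1 / m! of the exponential series this leaves 1 / sqrt
  (m!).\<close>

definition cohf :: "complex \<times> complex \<Rightarrow> seq2" where
  "cohf w = (\<lambda>(m, n). fst w ^ m * snd w ^ n / complex_of_real (sqrt (fact m * fact n)))"

definition coh_ladder :: "nat \<Rightarrow> nat \<Rightarrow> seq2 \<Rightarrow> seq2" where
  "coh_ladder j k f = (cre1 ^^ j) ((cre2 ^^ k) f)"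

text \<open>These are the mixed partial derivatives of \<open>coh\<close>, because differentiating
  in \<open>w\<close> applies a creation operator. Treating them as one family makes the derivative
  of a member a combination of members.\<close>

definition coh_deriv :: "nat \<Rightarrow> nat \<Rightarrow> complex \<times> complex \<Rightarrow> (nat \<times> nat) ell2" where
  "coh_deriv j k w = Abs_ell2 (coh_ladder j k (cohf w))"

definition coh :: "complex \<times> complex \<Rightarrow> (nat \<times> nat) ell2" where
  "coh w = coh_deriv 0 0 w"

lemma power_over_fact_le_exp:
  fixes x :: real assumes "x \<ge> 0"
  shows "x ^ n \<le> fact n * exp x"
proof -
  have "(\<Sum>i\<in>{n}. x ^ i /\<^sub>R fact i) \<le> (\<Sum>i. x ^ i /\<^sub>R fact i)"
    using assms by (intro sum_le_suminf summable_exp_generic) auto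
  then have "x ^ n /\<^sub>R fact n \<le> exp x" by (simp add: exp_def)
  then show ?thesis by (simp add: field_simps)
qed

lemma power_le_sqrt_fact:
  fixes x :: real assumes "x \<ge> 0"
  shows "x ^ n \<le> sqrt (fact n) * exp (x\<^sup>2)"
proof (rule power2_le_imp_le)
  have "(x ^ n)\<^sup>2 = (x\<^sup>2) ^ n" by (simp add: power_mult[symmetric] mult.commute)
  also have "\<dots> \<le> fact n * exp (x\<^sup>2)" by (rule power_over_fact_le_exp) simp
  also have "\<dots> \<le> fact n * (exp (x\<^sup>2) * exp (x\<^sup>2))" by (intro mult_left_mono) auto
  also have "\<dots> = (sqrt (fact n) * exp (x\<^sup>2))\<^sup>2"
    unfolding power_mult_distrib power2_eq_square[of "exp (x\<^sup>2)"] by simp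
  finally show "(x ^ n)\<^sup>2 \<le> (sqrt (fact n) * exp (x\<^sup>2))\<^sup>2" .
qed simp

text \<open>The polynomial weight is absorbed by \<open>exp (1 + m + n)\<close>, that is, by
  enlarging \<open>w\<close> by the factor \<open>exp 1\<close>; hence the form of \<open>R\<close>.
  The remaining quotients \<open>R ^ n / sqrt (fact n)\<close> are bounded by
  \<open>exp (R\<^sup>2)\<close>.\<close>

lemma rdf_cohf: "rdf (cohf w)"
  unfolding rdf_def
proof
  fix k
  define R where "R = exp 1 * max (cmod (fst w)) (cmod (snd w))"
  have R: "R \<ge> 0" "exp 1 * cmod (fst w) \<le> R" "exp 1 * cmod (snd w) \<le> R" by (auto simp: R_def le_max_iff_disj)
  have "(1 + real m + real n) ^ k * cmod (cohf w (m, n)) \<le> fact k * exp 1 * (exp (R\<^sup>2) * exp (R\<^sup>2))" for m n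
  proof -
    have p: "(1 + real m + real n) ^ k \<le> fact k * exp 1 * exp 1 ^ m * exp 1 ^ n"
      using power_over_fact_le_exp[of "1 + real m + real n" k]
      by (simp add: exp_add exp_of_nat_mult[symmetric] mult_ac)
    have "(1 + real m + real n) ^ k * (cmod (fst w) ^ m * cmod (snd w) ^ n) \<le>
        fact k * exp 1 * exp 1 ^ m * exp 1 ^ n * (cmod (fst w) ^ m * cmod (snd w) ^ n)"
      by (intro mult_right_mono p) auto
    also have "\<dots> = fact k * exp 1 * ((exp 1 * cmod (fst w)) ^ m * (exp 1 * cmod (snd w)) ^ n)"
      by (simp add: power_mult_distrib mult_ac)
    also have "\<dots> \<le> fact k * exp 1 * (R ^ m * R ^ n)"
      using R by (intro mult_left_mono mult_mono power_mono) auto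
    also have "\<dots> \<le> fact k * exp 1 * ((sqrt (fact m) * exp (R\<^sup>2)) * (sqrt (fact n) * exp (R\<^sup>2)))"
      using R(1) by (intro mult_left_mono mult_mono power_le_sqrt_fact) auto
    finally have "(1 + real m + real n) ^ k * (cmod (fst w) ^ m * cmod (snd w) ^ n) \<le>
      fact k * exp 1 * (exp (R\<^sup>2) * exp (R\<^sup>2)) * sqrt (fact m * fact n)"
      by (simp add: real_sqrt_mult mult_ac)
    moreover have "0 < sqrt (fact m * fact n :: real)" by simp
    ultimately show ?thesis
      by (simp add: cohf_def norm_mult norm_divide norm_power divide_le_eq)
  qed
  then show "\<exists>C. \<forall>m n. (1 + real m + real n) ^ k * cmod (cohf w (m, n)) \<le> C" by blast
qed

lemma rdf_coh_ladder: "rdf f \<Longrightarrow> rdf (coh_ladder j k f)"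
proof -
  have "rdf ((cre1 ^^ j) f)" "rdf ((cre2 ^^ k) f)" if "rdf f" for f
    by (induction j; use that in \<open>simp add: rdf_ladder\<close>) (induction k; use that in \<open>simp add: rdf_ladder\<close>)
  then show "rdf f \<Longrightarrow> rdf (coh_ladder j k f)" by (simp add: coh_ladder_def)
qed

lemma Rep_coh_deriv: "Rep_ell2 (coh_deriv j k w) = coh_ladder j k (cohf w)"
  unfolding coh_deriv_def by (intro rdf_Abs rdf_coh_ladder rdf_cohf)

lemma Rep_coh: "Rep_ell2 (coh w) = cohf w"
  by (simp add: coh_def Rep_coh_deriv coh_ladder_def)

lemma coh_rapidly_decreasing: "coh w \<in> rapidly_decreasing"
  by (simp add: rapidly_decreasing_iff Rep_coh rdf_cohf)

lemma cre1_apply: "cre1 f (m, n) = complex_of_real (sqrt m) * f (m - 1, n)"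
  and cre2_apply: "cre2 f (m, n) = complex_of_real (sqrt n) * f (m, n - 1)"
  by (simp_all add: cre1_def cre2_def)

text \<open>Each coordinate of the laddered family is a real multiple of one coordinate of
  \<open>f\<close>, with data independent of \<open>f\<close>. Continuity, domination and
  differentiability of \<open>coh_deriv\<close> are read off from \<open>cohf\<close> in this
  way.\<close>

lemma coh_ladder_weighted_shift: "\<exists>a p'. \<forall>f. coh_ladder j k f p = complex_of_real a * f p'"
proof -
  have 1: "\<exists>a p'. \<forall>f. (cre1 ^^ j) f p = complex_of_real a * f p'" for p
  proof (induction j arbitrary: p)
    case 0
    show ?case by (intro exI[of _ 1] exI[of _ p]) simp
  next
    case (Suc j)
    obtain m n where p: "p = (m, n)" by (cases p)
    obtain a p' where "\<forall>f. (cre1 ^^ j) f (m - 1, n) = complex_of_real a * f p'" using Suc by blast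
    then show ?case
      by (intro exI[of _ "sqrt m * a"] exI[of _ p']) (simp add: cre1_apply p mult.assoc)
  qed
  have 2: "\<exists>a p'. \<forall>f. (cre2 ^^ k) f p = complex_of_real a * f p'" for p
  proof (induction k arbitrary: p)
    case 0
    show ?case by (intro exI[of _ 1] exI[of _ p]) simp
  next
    case (Suc k)
    obtain m n where p: "p = (m, n)" by (cases p)
    obtain a p' where "\<forall>f. (cre2 ^^ k) f (m, n - 1) = complex_of_real a * f p'" using Suc by blast
    then show ?case
      by (intro exI[of _ "sqrt n * a"] exI[of _ p']) (simp add: cre2_apply p mult.assoc)
  qed
  obtain a p' where a: "\<forall>f. (cre1 ^^ j) f p = complex_of_real a * f p'" using 1 by blast
  obtain b p'' where b: "\<forall>f. (cre2 ^^ k) f p' = complex_of_real b * f p''" using 2 by blast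
  show ?thesis
    by (intro exI[of _ "a * b"] exI[of _ p'']) (simp add: coh_ladder_def a b mult.assoc)
qed

lemma coh_ladder_cre:
  "coh_ladder j k (cre1 f) = coh_ladder (Suc j) k f" "coh_ladder j k (cre2 f) = coh_ladder j (Suc k) f"
proof -
  have "(cre2 ^^ k) (cre1 f) = cre1 ((cre2 ^^ k) f)"
    by (induction k) (simp_all add: ladder_commute)
  then show "coh_ladder j k (cre1 f) = coh_ladder (Suc j) k f"
    by (simp add: coh_ladder_def funpow_swap1)
  show "coh_ladder j k (cre2 f) = coh_ladder j (Suc k) f"
    by (simp add: coh_ladder_def funpow_swap1)
qed

lemma has_derivative_cohf:
  "((\<lambda>w. cohf w p) has_derivative (\<lambda>h. fst h * cre1 (cohf w) p + snd h * cre2 (cohf w) p)) (at w)"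
proof -
  obtain m n where p: "p = (m, n)" by (cases p)
  have fact_pred: "sqrt m / sqrt (fact (m - 1) * c) = real m / sqrt (fact m * c)"
    if "c > 0" for c :: real and m
  proof (cases m)
    case (Suc k)
    have "sqrt (Suc k) * sqrt (Suc k) = real (Suc k)" by simp
    then show ?thesis using that
      by (simp add: Suc real_sqrt_mult divide_eq_eq eq_divide_eq mult.assoc[symmetric] del: of_nat_Suc)
  qed simp
  have c: "complex_of_real (sqrt (real m)) / complex_of_real (sqrt (fact (m - Suc 0) * c))
      = of_nat m / complex_of_real (sqrt (fact m * c))" if "c > 0" for m c
    using arg_cong[OF fact_pred[OF that, of m], of complex_of_real] by simp
  have c': "complex_of_real (sqrt (real m)) / complex_of_real (sqrt (c * fact (m - Suc 0)))
      = of_nat m / complex_of_real (sqrt (c * fact m))" if "c > 0" for m c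
    using c[OF that, of m] by (simp add: mult.commute)
  have e1: "cre1 (cohf w) p = of_nat m * fst w ^ (m - 1) * snd w ^ n / complex_of_real (sqrt (fact m * fact n))"
    using arg_cong[OF c[of "fact n" m], of "\<lambda>z. z * (fst w ^ (m - 1) * snd w ^ n)"]
    by (simp add: cre1_def cohf_def p)
  have e2: "cre2 (cohf w) p = of_nat n * snd w ^ (n - 1) * fst w ^ m / complex_of_real (sqrt (fact m * fact n))"
    using arg_cong[OF c'[of "fact m" n], of "\<lambda>z. z * (fst w ^ m * snd w ^ (n - 1))"]
    by (simp add: cre2_def cohf_def p mult_ac)
  have "((\<lambda>w. fst w ^ m * snd w ^ n) has_derivative
      (\<lambda>h. fst w ^ m * (of_nat n * snd h * snd w ^ (n - 1)) + of_nat m * fst h * fst w ^ (m - 1) * snd w ^ n)) (at w)"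
    by (intro has_derivative_mult has_derivative_power has_derivative_fst has_derivative_snd has_derivative_ident)
  from has_derivative_mult_right[OF this, of "1 / complex_of_real (sqrt (fact m * fact n))"]
  show ?thesis
    unfolding e1 e2
    by (rule has_derivative_eq_rhs[OF has_derivative_transform_within[where d = 1]])
      (auto simp: cohf_def p fun_eq_iff add_divide_distrib mult_ac)
qed

lemma continuous_coh_deriv: "continuous_on UNIV (coh_deriv j k)"
proof -
  have "isCont (coh_deriv j k) w" for w
  proof -
    \<comment> \<open>The moduli of the coordinates of \<open>cohf\<close> increase with the moduli
      of the arguments, so on the ball of radius \<open>R\<close> the vector at
      \<open>(R, R)\<close> dominates.\<close>
    define R where "R = norm w + 1"
    have R: "R > 0" by (simp add: R_def add_nonneg_pos)
    have "continuous_on (ball 0 R) (coh_deriv j k)"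
    proof (rule continuous_on_ell2_dominated)
      fix p
      obtain a p' where a: "\<forall>f. coh_ladder j k f p = complex_of_real a * f p'"
        using coh_ladder_weighted_shift by blast
      have "continuous_on UNIV (\<lambda>w. cohf w p')"
        using has_derivative_continuous[OF has_derivative_cohf] continuous_at_imp_continuous_on by blast
      then show "continuous_on (ball 0 R) (\<lambda>w. Rep_ell2 (coh_deriv j k w) p)"
        unfolding Rep_coh_deriv a[rule_format]
        by (intro continuous_on_mult continuous_on_const) (rule continuous_on_subset, auto)
      fix z :: "complex \<times> complex" assume z: "z \<in> ball 0 R"
      have "cmod (fst z) \<le> R" "cmod (snd z) \<le> R"
        using z norm_fst_le[of "fst z" "snd z"] norm_snd_le[of "snd z" "fst z"] by auto
      then have "cmod (cohf z p') \<le> cmod (cohf (complex_of_real R, complex_of_real R) p')"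
        using R by (cases p') (auto simp: cohf_def norm_mult norm_divide norm_power
            intro!: divide_right_mono mult_mono power_mono)
      then show "cmod (Rep_ell2 (coh_deriv j k z) p) \<le>
          cmod (Rep_ell2 (coh_deriv j k (complex_of_real R, complex_of_real R)) p)"
        by (simp add: Rep_coh_deriv a norm_mult mult_left_mono)
    qed
    moreover have "w \<in> ball 0 R" by (simp add: R_def)
    ultimately show ?thesis by (simp add: continuous_on_eq_continuous_at)
  qed
  then show ?thesis by (simp add: continuous_at_imp_continuous_on)
qed

lemma has_derivative_coh_deriv:
  "(coh_deriv j k has_derivative
    (\<lambda>h. fst h *\<^sub>C coh_deriv (Suc j) k w + snd h *\<^sub>C coh_deriv j (Suc k) w)) (at w)"
proof (rule has_derivative_weakI[OF total_ket])
  fix a :: "(nat \<times> nat) ell2" and x :: "complex \<times> complex"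
  assume "a \<in> range ket"
  then obtain p where a: "a = ket p" by blast
  obtain c p' where c: "\<forall>f. coh_ladder j k f p = complex_of_real c * f p'"
    using coh_ladder_weighted_shift by blast
  have "((\<lambda>y. complex_of_real c * cohf y p') has_derivative
      (\<lambda>h. complex_of_real c * (fst h * cre1 (cohf x) p' + snd h * cre2 (cohf x) p'))) (at x)"
    by (intro has_derivative_mult_right has_derivative_cohf)
  then show "((\<lambda>y. cinner a (coh_deriv j k y)) has_derivative
      (\<lambda>h. cinner a (fst h *\<^sub>C coh_deriv (Suc j) k x + snd h *\<^sub>C coh_deriv j (Suc k) x))) (at x)"
    by (simp add: a cinner_simps cinner_ket Rep_coh_deriv c[rule_format] algebra_simps flip: coh_ladder_cre)
next
  show "linear (\<lambda>h. fst h *\<^sub>C coh_deriv (Suc j) k w + snd h *\<^sub>C coh_deriv j (Suc k) w)" for w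
    by (rule linearI)
      (simp_all add: scaleC_add_left scaleR_scaleC scaleR_conv_of_real scaleC_scaleC scaleC_add_right algebra_simps)
  show "continuous_on UNIV (\<lambda>w. fst h *\<^sub>C coh_deriv (Suc j) k w + snd h *\<^sub>C coh_deriv j (Suc k) w)" for h
    by (intro continuous_intros continuous_coh_deriv)
qed

lemma coh_ladder_vacuum:
  "coh_ladder j k (cohf (0, 0)) = (\<lambda>p. complex_of_real (sqrt (fact j * fact k)) * Rep_ell2 (ket (j, k)) p)"
proof -
  have 2: "(cre2 ^^ k) (cohf (0, 0)) = (\<lambda>p. complex_of_real (sqrt (fact k)) * Rep_ell2 (ket (0, k)) p)"
  proof (induction k)
    case 0
    show ?case by (auto simp: cohf_def Rep_ket fun_eq_iff)
  next
    case (Suc k)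
    show ?case
      by (auto simp: Suc cre2_apply Rep_ket fun_eq_iff real_sqrt_mult)
  qed
  show ?thesis
  proof (induction j)
    case 0
    show ?case by (simp add: coh_ladder_def 2)
  next
    case (Suc j)
    then show ?case
      by (auto simp: coh_ladder_def cre1_apply Rep_ket fun_eq_iff real_sqrt_mult mult_ac)
  qed
qed

text \<open>Orthogonality to all coherent vectors survives differentiation in \<open>w\<close>, and
  the derivatives at the origin are nonzero multiples of the vectors
  \<open>ket (j, k)\<close>.\<close>

lemma total_coh: "total (range coh)"
proof (rule totalI)
  fix v assume "\<And>a. a \<in> range coh \<Longrightarrow> cinner a v = 0"
  then have 0: "cinner (coh_deriv 0 0 w) v = 0" for w by (simp add: coh_def)
  have step: "cinner (coh_deriv (Suc j) k w) v = 0 \<and> cinner (coh_deriv j (Suc k) w) v = 0"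
    if z: "\<And>w. cinner (coh_deriv j k w) v = 0" for j k w
  proof -
    have "((\<lambda>w. cinner (coh_deriv j k w) v) has_derivative
        (\<lambda>h. cinner (fst h *\<^sub>C coh_deriv (Suc j) k w + snd h *\<^sub>C coh_deriv j (Suc k) w) v)) (at w)"
      by (rule bounded_linear.has_derivative[OF bounded_linear_cinner_left has_derivative_coh_deriv])
    moreover have "((\<lambda>w. cinner (coh_deriv j k w) v) has_derivative (\<lambda>h. 0)) (at w)"
      unfolding z by (rule has_derivative_const)
    ultimately have "(\<lambda>h. cinner (fst h *\<^sub>C coh_deriv (Suc j) k w + snd h *\<^sub>C coh_deriv j (Suc k) w) v) = (\<lambda>h. 0)"
      by (rule has_derivative_unique)
    from fun_cong[OF this, of "(1, 0)"] fun_cong[OF this, of "(0, 1)"] show ?thesis by simp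
  qed
  have "\<forall>w. cinner (coh_deriv j 0 w) v = 0" for j by (induction j) (use 0 step in blast)+
  then have "\<forall>w. cinner (coh_deriv j k w) v = 0" for j k by (induction k) (use step in blast)+
  then have "cinner (coh_deriv j k (0, 0)) v = 0" for j k by blast
  moreover have "coh_deriv j k (0, 0) = complex_of_real (sqrt (fact j * fact k)) *\<^sub>C ket (j, k)" for j k
    by (rule ell2_eqI) (simp add: Rep_coh_deriv coh_ladder_vacuum Rep_ell2_scaleC)
  ultimately have "cinner (ket (j, k)) v = 0" for j k by (simp add: cinner_simps)
  then have "cinner a v = 0" if "a \<in> range ket" for a using that by auto
  then show "v = 0" by (rule total_orthogonal_zero[OF total_ket])
qed

definition hip :: "complex \<times> complex \<Rightarrow> complex \<times> complex \<Rightarrow> complex" where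
  "hip a w = cnj (fst a) * fst w + cnj (snd a) * snd w"

lemma infsum_exp: "(\<Sum>\<^sub>\<infinity>n. z ^ n / fact n) = exp (z :: complex)"
proof -
  have "((\<lambda>n. z ^ n /\<^sub>R fact n) has_sum exp z) UNIV"
    by (rule norm_summable_imp_has_sum[OF summable_norm_exp exp_converges])
  then have "((\<lambda>n. z ^ n / fact n) has_sum exp z) UNIV"
    by (simp add: scaleR_conv_of_real field_simps)
  then show ?thesis by (rule infsumI)
qed

text \<open>The double series factors into two exponential series; the result is the reproducing
  kernel of the Bargmann-Fock space.\<close>

lemma cinner_coh: "cinner (coh w) (coh z) = exp (hip w z)"
proof -
  define a b where "a = cnj (fst w) * fst z" and "b = cnj (snd w) * snd z"
  have eq: "cnj (Rep_ell2 (coh w) (m, n)) * Rep_ell2 (coh z) (m, n) = a ^ m / fact m * (b ^ n / fact n)" for m n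
  proof -
    have "complex_of_real (sqrt (fact m * fact n)) * complex_of_real (sqrt (fact m * fact n)) = fact m * fact n"
      by (subst of_real_mult[symmetric]) simp
    then show ?thesis
      by (simp add: Rep_coh cohf_def a_def b_def power_mult_distrib mult_ac)
  qed
  have "cinner (coh w) (coh z) = (\<Sum>\<^sub>\<infinity>m. \<Sum>\<^sub>\<infinity>n. cnj (Rep_ell2 (coh w) (m, n)) * Rep_ell2 (coh z) (m, n))"
    unfolding cinner_ell2_def
    using infsum_Sigma_banach[of "\<lambda>p. cnj (Rep_ell2 (coh w) p) * Rep_ell2 (coh z) p" UNIV "\<lambda>_. UNIV"]
      ell2_cinner_summable[of "coh w" "coh z"] by simp
  also have "\<dots> = exp a * exp b"
    unfolding eq infsum_cmult_right' infsum_exp infsum_cmult_left' ..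
  finally show ?thesis by (simp add: a_def b_def hip_def exp_add)
qed

section \<open>The Heisenberg group\<close>

definition omega :: "heis \<Rightarrow> heis \<Rightarrow> real" where
  "omega g h = fst g \<bullet> fst (snd h) - fst (snd g) \<bullet> fst h"

definition heis_Z :: heis where
  "heis_Z = ((0, 0), (0, 0), 1)"

text \<open>In these coordinates the group law is addition with a bilinear correction along the
  centre, so translations are affine maps and their derivatives are explicit.\<close>

lemma heis_mult_eq: "heis_mult g h = g + h + (omega g h / 2) *\<^sub>R heis_Z"
  by (cases g rule: prod_cases3; cases h rule: prod_cases3) (simp add: omega_def heis_Z_def zero_prod_def)

lemma omega_simps [simp]:
  "omega g (h + h') = omega g h + omega g h'" "omega (g + g') h = omega g h + omega g' h"
  "omega g (r *\<^sub>R h) = r * omega g h" "omega (r *\<^sub>R g) h = r * omega g h"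
  "omega g (- h) = - omega g h" "omega (- g) h = - omega g h"
  "omega g (h - h') = omega g h - omega g h'"
  "omega g g = 0" "omega g heis_Z = 0" "omega heis_Z g = 0" "omega g 0 = 0" "omega 0 g = 0"
  by (auto simp: omega_def heis_Z_def inner_commute inner_diff_left inner_diff_right
      inner_add_left inner_add_right algebra_simps zero_prod_def[symmetric])

lemma continuous_omega [continuous_intros]:
  "continuous_on S f \<Longrightarrow> continuous_on S g \<Longrightarrow> continuous_on S (\<lambda>x. omega (f x) (g x))"
  unfolding omega_def by (intro continuous_intros)

lemma bounded_linear_omega: "bounded_linear (\<lambda>g. omega g h)" "bounded_linear (omega g)"
  by (intro linear_conv_bounded_linear[THEN iffD1] linearI; simp)+

lemma heis_mult_simps [simp]: "heis_mult g 0 = g" "heis_mult 0 g = g"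
  "heis_mult g (- g) = 0" "heis_mult (- g) g = 0"
  by (simp_all add: heis_mult_eq)

lemma heis_unitary_repD:
  assumes "heis_unitary_rep U"
  shows "isometric (U g)" "U (heis_mult g h) v = U g (U h v)" "continuous_on UNIV (\<lambda>g. U g v)"
    "U 0 v = v" "U (- g) (U g v) = v" "U g (U (- g) v) = v"
    "cinner u (U g v) = cinner (U (- g) u) v"
proof -
  show iso: "isometric (U g)" for g using assms unfolding heis_unitary_rep_def unitary_iff by blast
  have "U (heis_mult g h) = U g \<circ> U h" for g h using assms unfolding heis_unitary_rep_def by blast
  then show m: "U (heis_mult g h) v = U g (U h v)" for g h v by simp
  show "continuous_on UNIV (\<lambda>g. U g v)" using assms by (auto simp: heis_unitary_rep_def)
  have "U 0 (U 0 v) = U 0 v" for v using m[of 0 0 v] by simp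
  then show z: "U 0 v = v" for v using isometricD(8)[OF iso[of 0]] by (simp add: inj_eq)
  show "U (- g) (U g v) = v" "U g (U (- g) v) = v" for g v
    using m[of "- g" g v] m[of g "- g" v] z by simp_all
  then show "cinner u (U g v) = cinner (U (- g) u) v"
    using isometricD(3)[OF iso[of g], of "U (- g) u" v] by simp
qed

text \<open>Isometry makes the approximation of \<open>v\<close> by vectors of the span uniform in
  \<open>g\<close>, and uniform limits preserve continuity.\<close>

lemma isometric_strongly_continuous:
  assumes iso: "\<And>g :: 'b::topological_space. isometric (U g)" and A: "total A"
    and cont: "\<And>a. a \<in> A \<Longrightarrow> continuous_on UNIV (\<lambda>g. U g a)"
  shows "continuous_on UNIV (\<lambda>g. U g v)"
proof -
  note I = isometricD[OF iso]
  have "cspan A \<subseteq> {v. continuous_on UNIV (\<lambda>g. U g v)}"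
    by (rule cspan_subset)
      (auto simp: complex_subspace_def I cont intro!: continuous_on_add continuous_on_scaleC)
  then have sp: "continuous_on UNIV (\<lambda>g. U g v)" if "v \<in> cspan A" for v using that by blast
  have "v \<in> closure (cspan A)" using A by (simp add: total_def)
  then obtain s where s: "\<And>n. s n \<in> cspan A" "s \<longlonglongrightarrow> v" by (auto simp: closure_sequential)
  show ?thesis
  proof (rule uniform_limit_theorem)
    show "\<forall>\<^sub>F n in sequentially. continuous_on UNIV (\<lambda>g. U g (s n))" using s(1) sp by simp
    show "uniform_limit UNIV (\<lambda>n g. U g (s n)) (\<lambda>g. U g v) sequentially"
    proof (rule uniform_limitI)
      fix e :: real assume "e > 0"
      with s(2) have "\<forall>\<^sub>F n in sequentially. dist (s n) v < e" by (rule tendstoD)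
      then show "\<forall>\<^sub>F n in sequentially. \<forall>g\<in>UNIV. dist (U g (s n)) (U g v) < e"
        by (simp add: dist_norm I(4) flip: I(6))
    qed
  qed simp
qed

section \<open>The Heisenberg group on the Fock space\<close>

text \<open>In terms of \<open>\<alpha> = disp g\<close>, the Lie algebra element \<open>g\<close> acts as
  \<open>\<alpha>\<^sub>1 c\<^sub>1 + \<alpha>\<^sub>2 c\<^sub>2 - \<alpha>\<^sub>1\<^sup>* c\<^sub>1\<^sup>* - \<alpha>\<^sub>2\<^sup>* c\<^sub>2\<^sup>* + \<i> t\<close>; its exponential moves coherent vectors to
  multiples of coherent vectors.\<close>

definition disp :: "heis \<Rightarrow> complex \<times> complex" where
  "disp g = (complex_of_real (1 / sqrt 2) * Complex (- fst (fst g)) (fst (fst (snd g))),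
     complex_of_real (1 / sqrt 2) * Complex (- snd (fst g)) (snd (fst (snd g))))"

lemma disp_simps [simp]:
  "disp (g + h) = disp g + disp h" "disp (r *\<^sub>R g) = r *\<^sub>R disp g" "disp (- g) = - disp g"
  "disp (g - h) = disp g - disp h" "disp heis_Z = 0" "disp 0 = 0"
  by (auto simp: disp_def heis_Z_def prod_eq_iff complex_eq_iff add_divide_distrib diff_divide_distrib)

lemma bounded_linear_disp: "bounded_linear disp"
  by (intro linear_conv_bounded_linear[THEN iffD1] linearI) simp_all

lemma hip_simps [simp]:
  "hip a (w + z) = hip a w + hip a z" "hip (a + b) w = hip a w + hip b w"
  "hip a (- w) = - hip a w" "hip (- a) w = - hip a w" "hip a (w - z) = hip a w - hip a z"
  "hip 0 w = 0" "hip w 0 = 0"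
  by (simp_all add: hip_def algebra_simps)

lemma cnj_hip [simp]: "cnj (hip a w) = hip w a"
  by (simp add: hip_def mult.commute)

lemma bounded_bilinear_hip: "bounded_bilinear hip"
proof (rule bounded_bilinear.intro)
  have "cmod (hip a w) \<le> norm a * norm w * 2" for a w
  proof -
    have "cmod (hip a w) \<le> cmod (fst a) * cmod (fst w) + cmod (snd a) * cmod (snd w)"
      unfolding hip_def by (rule order_trans[OF norm_triangle_ineq]) (simp add: norm_mult)
    also have "\<dots> \<le> norm a * norm w + norm a * norm w"
      using norm_fst_le[of "fst a" "snd a"] norm_snd_le[of "snd a" "fst a"]
        norm_fst_le[of "fst w" "snd w"] norm_snd_le[of "snd w" "fst w"]
      by (intro add_mono mult_mono) auto
    finally show ?thesis by simp
  qed
  then show "\<exists>K. \<forall>a b. norm (hip a b) \<le> norm a * norm b * K" by blast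
qed (simp_all add: hip_def scaleR_conv_of_real algebra_simps)

text \<open>The imaginary part of the Hermitian form is half the symplectic form. This is what
  matches the phases of \<open>weyl\<close> with the cocycle of \<open>heis_mult\<close>.\<close>

lemma hip_disp: "hip (disp h) (disp g) - hip (disp g) (disp h) = \<i> * complex_of_real (omega g h)"
proof -
  obtain p1 p2 q1 q2 t where g: "g = ((p1, p2), (q1, q2), t)" by (metis prod.collapse)
  obtain p1' p2' q1' q2' t' where h: "h = ((p1', p2'), (q1', q2'), t')" by (metis prod.collapse)
  have s: "x / sqrt 2 * (y / sqrt 2) = x * y / 2" for x y :: real by simp
  show ?thesis
    by (simp add: hip_def disp_def omega_def g h complex_eq_iff s algebra_simps) (simp add: field_simps)
qed

text \<open>By the Baker-Campbell-Hausdorff formula the exponential of the Lie algebra element is a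
  creation exponential times an annihilation exponential times a scalar, whence the term
  \<open>- hip (disp g) (disp g) / 2\<close>. Coherent vectors are eigenvectors of the annihilation
  operators, whence \<open>- hip (disp g) w\<close>.\<close>

definition weyl_phase :: "heis \<Rightarrow> complex \<times> complex \<Rightarrow> complex" where
  "weyl_phase g w = exp (\<i> * complex_of_real (snd (snd g)) - hip (disp g) (disp g) / 2 - hip (disp g) w)"

definition weyl :: "heis \<Rightarrow> (nat \<times> nat) ell2 \<Rightarrow> (nat \<times> nat) ell2" where
  "weyl g = (SOME T. isometric T \<and> (\<forall>w. T (coh w) = weyl_phase g w *\<^sub>C coh (w + disp g)))"

lemma weyl_props: "isometric (weyl g)" "weyl g (coh w) = weyl_phase g w *\<^sub>C coh (w + disp g)"
proof -
  have "cinner (coh w) (coh z) =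
      cinner (weyl_phase g w *\<^sub>C coh (w + disp g)) (weyl_phase g z *\<^sub>C coh (z + disp g))" for w z
    unfolding cinner_simps cinner_coh weyl_phase_def
    by (simp add: exp_cnj[symmetric] mult.assoc[symmetric] exp_add[symmetric] del: exp_cnj)
      (simp add: exp_cnj exp_add[symmetric] exp_diff[symmetric] field_simps)
  then obtain T where "isometric T" "\<And>w. T (coh w) = weyl_phase g w *\<^sub>C coh (w + disp g)"
    using isometry_of_Gram[OF total_coh, of "\<lambda>w. weyl_phase g w *\<^sub>C coh (w + disp g)"] by metis
  then have "\<exists>T. isometric T \<and> (\<forall>w. T (coh w) = weyl_phase g w *\<^sub>C coh (w + disp g))" by blast
  then have "isometric (weyl g) \<and> (\<forall>w. weyl g (coh w) = weyl_phase g w *\<^sub>C coh (w + disp g))"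
    unfolding weyl_def by (rule someI_ex)
  then show "isometric (weyl g)" "weyl g (coh w) = weyl_phase g w *\<^sub>C coh (w + disp g)" by blast+
qed

lemma isometric_eq_on_coh:
  assumes "isometric S" "isometric T" "\<And>w. S (coh w) = T (coh w)"
  shows "S = T"
  by (rule total_linear_eq[OF total_coh]) (use assms in \<open>auto simp: isometricD\<close>)

lemma snd_snd_heis [simp]:
  "snd (snd (heis_mult g h)) = snd (snd g) + snd (snd h) + omega g h / 2" "disp (heis_mult g h) = disp g + disp h"
  by (simp_all add: heis_mult_eq) (simp add: heis_Z_def)

lemma weyl_mult: "weyl (heis_mult g h) = weyl g \<circ> weyl h"
proof (rule isometric_eq_on_coh)
  fix w
  have "weyl_phase (heis_mult g h) w = weyl_phase h w * weyl_phase g (w + disp h)"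
    using hip_disp[of h g] unfolding weyl_phase_def exp_add[symmetric]
    by (intro arg_cong[of _ _ exp]) (simp add: field_simps)
  then show "weyl (heis_mult g h) (coh w) = (weyl g \<circ> weyl h) (coh w)"
    by (simp add: weyl_props isometricD(2)[OF weyl_props(1)] scaleC_scaleC add_ac)
qed (intro isometric_comp weyl_props)+

lemma heis_unitary_rep_weyl: "heis_unitary_rep weyl"
proof -
  have "weyl 0 = id"
    by (rule isometric_eq_on_coh[OF weyl_props(1)])
      (simp add: isometric_def, simp add: weyl_props weyl_phase_def zero_prod_def[symmetric])
  then have "weyl g (weyl (- g) v) = v" for g v
    using weyl_mult[of g "- g"] by (simp add: fun_eq_iff)
  then have "surj (weyl g)" for g by (metis surjI)
  then have "unitary (weyl g)" for g by (simp add: unitary_iff weyl_props)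
  moreover have "continuous_on UNIV (\<lambda>g. weyl g v)" for v
  proof (rule isometric_strongly_continuous[OF weyl_props(1) total_coh])
    fix a assume "a \<in> range coh"
    then obtain w where a: "a = coh w" by blast
    have cd: "continuous_on UNIV disp" by (rule linear_continuous_on[OF bounded_linear_disp])
    have "continuous_on UNIV coh" using continuous_coh_deriv[of 0 0] by (simp add: coh_def[abs_def])
    then have "continuous_on UNIV (\<lambda>g. coh (w + disp g))"
      by (rule continuous_on_compose2) (auto intro!: continuous_intros cd)
    moreover have "continuous_on UNIV (\<lambda>g. weyl_phase g w)"
      unfolding weyl_phase_def
      by (intro continuous_intros bounded_bilinear.continuous_on[OF bounded_bilinear_hip] cd) simp
    ultimately show "continuous_on UNIV (\<lambda>g. weyl g a)"
      by (simp add: a weyl_props continuous_on_scaleC)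
  qed
  ultimately show ?thesis using weyl_mult by (auto simp: heis_unitary_rep_def)
qed

lemmas weyl_rep = heis_unitary_repD[OF heis_unitary_rep_weyl]

definition heis_op :: "heis \<Rightarrow> (nat \<times> nat) ell2 \<Rightarrow> (nat \<times> nat) ell2" where
  "heis_op X v = fock 0 (heis_term X) False v"

lemma fock_op_heis_term:
  "fock_op 0 (heis_term X) b f p = (if b then -1 else 1) * (fst (disp X) * cre1 f p + snd (disp X) * cre2 f p
    - cnj (fst (disp X)) * ann1 f p - cnj (snd (disp X)) * ann2 f p
    + \<i> * complex_of_real (snd (snd X)) * f p)"
proof -
  obtain p1 p2 q1 q2 t where X: "X = ((p1, p2), (q1, q2), t)" by (metis prod.collapse)
  have C: "Complex a b = complex_of_real a + \<i> * complex_of_real b" for a b by (simp add: complex_eq_iff)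
  show ?thesis by (cases b) (simp_all add: X disp_def C field_simps)
qed

lemma Rep_heis_op:
  "v \<in> rapidly_decreasing \<Longrightarrow> Rep_ell2 (heis_op X v) p =
    fst (disp X) * cre1 (Rep_ell2 v) p + snd (disp X) * cre2 (Rep_ell2 v) p
    - cnj (fst (disp X)) * ann1 (Rep_ell2 v) p - cnj (snd (disp X)) * ann2 (Rep_ell2 v) p
    + \<i> * complex_of_real (snd (snd X)) * Rep_ell2 v p"
  by (simp add: heis_op_def Rep_fock fock_op_heis_term)

lemma heis_op_rapidly_decreasing: "v \<in> rapidly_decreasing \<Longrightarrow> heis_op X v \<in> rapidly_decreasing"
  by (simp add: heis_op_def fock_rapidly_decreasing)

lemma heis_op_linear:
  assumes "v \<in> rapidly_decreasing"
  shows "heis_op (X + Y) v = heis_op X v + heis_op Y v" "heis_op (r *\<^sub>R X) v = r *\<^sub>R heis_op X v"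
    "heis_op (X - Y) v = heis_op X v - heis_op Y v" "heis_op heis_Z v = \<i> *\<^sub>C v"
    "heis_op X (c *\<^sub>C v) = c *\<^sub>C heis_op X v"
  using assms
  by (auto intro!: ell2_eqI simp: Rep_heis_op Rep_ell2_simps Rep_ell2_scaleC rapidly_decreasing_scale
      ladder_linear algebra_simps scaleR_conv_of_real) (simp_all add: heis_Z_def)

lemma heis_op_skew:
  assumes "u \<in> rapidly_decreasing" "v \<in> rapidly_decreasing"
  shows "cinner (heis_op X u) v = - cinner u (heis_op X v)"
proof -
  have "fock 0 (heis_term X) True v = (-1) *\<^sub>C heis_op X v"
    using assms(2) by (intro ell2_eqI) (simp add: heis_op_def Rep_fock fock_op_heis_term Rep_ell2_scaleC)
  then show ?thesis
    using fock_adjoint[OF assms, of 0 "heis_term X" False] by (simp add: heis_op_def cinner_simps)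
qed

lemma ann_cohf: "ann1 (cohf w) p = fst w * cohf w p" "ann2 (cohf w) p = snd w * cohf w p"
proof -
  obtain m n where p: "p = (m, n)" by (cases p)
  have r: "complex_of_real (sqrt (real (Suc k))) / complex_of_real (sqrt (fact (Suc k) * c))
      = 1 / complex_of_real (sqrt (fact k * c))" "complex_of_real (sqrt (real (Suc k))) / complex_of_real (sqrt (c * fact (Suc k)))
      = 1 / complex_of_real (sqrt (c * fact k))" for k c
    by (simp_all add: real_sqrt_mult)
  show "ann1 (cohf w) p = fst w * cohf w p"
    using arg_cong[OF r(1)[of m "fact n"], of "\<lambda>z. z * (fst w ^ Suc m * snd w ^ n)"]
    by (simp add: ann1_def cohf_def p mult_ac del: of_nat_Suc fact_Suc)
  show "ann2 (cohf w) p = snd w * cohf w p"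
    using arg_cong[OF r(2)[of n "fact m"], of "\<lambda>z. z * (fst w ^ m * snd w ^ Suc n)"]
    by (simp add: ann2_def cohf_def p mult_ac del: of_nat_Suc fact_Suc)
qed

lemma heis_op_coh:
  "heis_op X (coh w) = (\<i> * complex_of_real (snd (snd X)) - hip (disp X) w) *\<^sub>C coh w
    + (fst (disp X) *\<^sub>C coh_deriv (Suc 0) 0 w + snd (disp X) *\<^sub>C coh_deriv 0 (Suc 0) w)"
  by (rule ell2_eqI, subst Rep_heis_op[OF coh_rapidly_decreasing])
    (simp add: Rep_ell2_simps Rep_ell2_scaleC Rep_coh Rep_coh_deriv coh_ladder_def ann_cohf hip_def algebra_simps)

text \<open>The inverse \<open>- h\<close> appears because \<open>weyl y v\<close> is differentiated
  through \<open>cinner a (weyl y v) = cinner (weyl (- y) a) v\<close>, where the operator acts on a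
  coherent vector only.\<close>

lemma has_derivative_weyl_coh:
  "((\<lambda>h. weyl (- h) (coh w)) has_derivative (\<lambda>h. - heis_op h (coh w))) (at 0)"
proof -
  have dd: "(disp has_derivative disp) (at x)" for x
    by (rule bounded_linear_imp_has_derivative[OF bounded_linear_disp])
  have dc: "(coh has_derivative (\<lambda>h. fst h *\<^sub>C coh_deriv (Suc 0) 0 w + snd h *\<^sub>C coh_deriv 0 (Suc 0) w)) (at w)"
    using has_derivative_coh_deriv[of 0 0 w] by (simp add: coh_def[abs_def])
  have "((\<lambda>h. w - disp h) has_derivative (\<lambda>h. - disp h)) (at 0)"
    using has_derivative_diff[OF has_derivative_const[of w] dd] by simp
  moreover have "(coh has_derivative (\<lambda>h. fst h *\<^sub>C coh_deriv (Suc 0) 0 w + snd h *\<^sub>C coh_deriv 0 (Suc 0) w)) (at (w - disp 0))"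
    using dc by simp
  ultimately have 1: "((\<lambda>h. coh (w - disp h)) has_derivative
      (\<lambda>h. fst (- disp h) *\<^sub>C coh_deriv (Suc 0) 0 w + snd (- disp h) *\<^sub>C coh_deriv 0 (Suc 0) w)) (at 0)"
    using diff_chain_at by (fastforce simp: o_def)
  have t: "((\<lambda>h. snd (snd h)) has_derivative (\<lambda>h. snd (snd h))) (at (0 :: heis))"
    by (intro has_derivative_snd has_derivative_ident)
  have hh: "((\<lambda>h. hip (disp h) (disp h)) has_derivative (\<lambda>h. hip (disp 0) (disp h) + hip (disp h) (disp 0))) (at 0)"
    by (rule bounded_bilinear.FDERIV[OF bounded_bilinear_hip dd dd])
  have hw: "((\<lambda>h. hip (disp h) w) has_derivative (\<lambda>h. hip (disp 0) 0 + hip (disp h) w)) (at 0)"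
    by (rule bounded_bilinear.FDERIV[OF bounded_bilinear_hip dd has_derivative_const])
  have ph: "((\<lambda>h. - \<i> * complex_of_real (snd (snd h)) - 1 / 2 * hip (disp h) (disp h) + hip (disp h) w) has_derivative
      (\<lambda>h. - \<i> * complex_of_real (snd (snd h)) - 1 / 2 * (hip (disp 0) (disp h) + hip (disp h) (disp 0))
        + (hip (disp 0) 0 + hip (disp h) w))) (at 0)"
    by (intro has_derivative_add has_derivative_diff has_derivative_mult_right has_derivative_of_real t hh hw)
  have "(*) (1 :: complex) = (\<lambda>z. z)" by auto
  then have "(exp has_derivative (\<lambda>z. z)) (at (0 :: complex))"
    using DERIV_exp[of "0 :: complex"] by (simp add: has_field_derivative_def)
  then have "(exp has_derivative (\<lambda>z. z))
      (at (- \<i> * complex_of_real (snd (snd (0 :: heis))) - 1 / 2 * hip (disp 0) (disp 0) + hip (disp 0) w))"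
    by simp
  from diff_chain_at[OF ph this]
  have 2: "((\<lambda>h. weyl_phase (- h) w) has_derivative (\<lambda>h. - \<i> * complex_of_real (snd (snd h)) + hip (disp h) w)) (at 0)"
    by (simp add: weyl_phase_def o_def)
  have "weyl_phase (- 0) w = 1" by (simp add: weyl_phase_def)
  with bounded_bilinear.FDERIV[OF bounded_bilinear_scaleC 2 1]
  show ?thesis
    by (simp add: weyl_props heis_op_coh) (simp add: scaleC_minus_left scaleC_diff_left scaleC_add_left algebra_simps)
qed

lemma heis_translate: "g + h = heis_mult g (h - (omega g h / 2) *\<^sub>R heis_Z)"
  by (simp add: heis_mult_eq algebra_simps)

lemma has_derivative_weyl:
  assumes v: "v \<in> rapidly_decreasing"
  shows "((\<lambda>g. weyl g v) has_derivative
    (\<lambda>h. weyl g (heis_op h v) - (omega g h / 2) *\<^sub>R (\<i> *\<^sub>C weyl g v))) (at g)"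
proof (rule has_derivative_weakI[OF total_coh])
  fix a g assume "a \<in> range coh"
  then obtain w where a: "a = coh w" by blast
  define \<kappa> where "\<kappa> = weyl_phase (- g) w"
  define w' where "w' = w - disp g"
  \<comment> \<open>Since \<open>g + h = heis_mult g (L h)\<close>, the derivative at
    \<open>g\<close> is reduced to the one at the identity; the central component of
    \<open>L h\<close> accounts for the term with \<open>omega g h / 2\<close>.\<close>
  define L where "L h = h - (omega g h / 2) *\<^sub>R heis_Z" for h
  have \<kappa>: "weyl (- g) (coh w) = \<kappa> *\<^sub>C coh w'" by (simp add: weyl_props \<kappa>_def w'_def)
  have L: "bounded_linear L"
    unfolding L_def
    by (intro linear_conv_bounded_linear[THEN iffD1] linearI)
      (simp_all add: algebra_simps add_divide_distrib scaleR_add_left)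
  have "((\<lambda>y. L (y - g)) has_derivative (\<lambda>h. L (h - 0))) (at g)"
    by (intro bounded_linear.has_derivative[OF L] has_derivative_diff has_derivative_ident has_derivative_const)
  moreover have "L (g - g) = 0" by (simp add: L_def)
  ultimately have "((\<lambda>y. weyl (- L (y - g)) (coh w')) has_derivative (\<lambda>h. - heis_op (L h) (coh w'))) (at g)"
    using diff_chain_at[of "\<lambda>y. L (y - g)" "\<lambda>h. L (h - 0)" g "\<lambda>h. weyl (- h) (coh w')"]
      has_derivative_weyl_coh[of w'] by (simp add: o_def)
  then have "((\<lambda>y. cinner (\<kappa> *\<^sub>C weyl (- L (y - g)) (coh w')) v) has_derivative
      (\<lambda>h. cinner (\<kappa> *\<^sub>C (- heis_op (L h) (coh w'))) v)) (at g)"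
    by (intro bounded_linear.has_derivative[OF bounded_linear_cinner_left]
        bounded_linear.has_derivative[OF bounded_linear_scaleC_right])
  moreover have "cinner (\<kappa> *\<^sub>C weyl (- L (y - g)) (coh w')) v = cinner a (weyl y v)" for y
  proof -
    have y: "y = heis_mult g (L (y - g))" using heis_translate[of g "y - g"] by (simp add: L_def)
    have "cinner a (weyl y v) = cinner a (weyl g (weyl (L (y - g)) v))"
      by (subst y) (simp add: weyl_rep(2))
    also have "\<dots> = cinner (weyl (- L (y - g)) (\<kappa> *\<^sub>C coh w')) v"
      by (simp add: weyl_rep(7) a \<kappa>)
    finally show ?thesis by (simp add: isometricD(2)[OF weyl_props(1)])
  qed
  moreover have "cinner (\<kappa> *\<^sub>C (- heis_op (L h) (coh w'))) v =
      cinner a (weyl g (heis_op h v) - (omega g h / 2) *\<^sub>R (\<i> *\<^sub>C weyl g v))" for h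
  proof -
    have "weyl g (heis_op h v) - (omega g h / 2) *\<^sub>R (\<i> *\<^sub>C weyl g v) = weyl g (heis_op (L h) v)"
      using isometricD[OF weyl_props(1), of g] by (simp add: L_def heis_op_linear v scaleR_scaleC)
    then have "cinner a (weyl g (heis_op h v) - (omega g h / 2) *\<^sub>R (\<i> *\<^sub>C weyl g v))
        = cinner (\<kappa> *\<^sub>C coh w') (heis_op (L h) v)"
      by (simp add: weyl_rep(7) a \<kappa>)
    then show ?thesis
      by (simp add: cinner_simps heis_op_skew[OF coh_rapidly_decreasing v])
  qed
  ultimately show "((\<lambda>y. cinner a (weyl y v)) has_derivative
      (\<lambda>h. cinner a (weyl g (heis_op h v) - (omega g h / 2) *\<^sub>R (\<i> *\<^sub>C weyl g v)))) (at g)" by simp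
next
  show "linear (\<lambda>h. weyl g (heis_op h v) - (omega g h / 2) *\<^sub>R (\<i> *\<^sub>C weyl g v))" for g
    using isometricD[OF weyl_props(1), of g]
    by (intro linearI)
      (simp_all add: heis_op_linear v scaleR_scaleC algebra_simps add_divide_distrib scaleR_add_left
        scaleC_add_left scaleC_scaleC scaleC_diff_right)
  show "continuous_on UNIV (\<lambda>g. weyl g (heis_op h v) - (omega g h / 2) *\<^sub>R (\<i> *\<^sub>C weyl g v))" for h
    by (intro continuous_intros weyl_rep(3)) simp
qed

text \<open>The derivative of an orbit map is built from orbit maps of rapidly decreasing vectors
  with coefficients linear in \<open>g\<close>, so the induction reproduces its own
  hypothesis.\<close>

lemma rapidly_decreasing_smooth: "rapidly_decreasing \<subseteq> smooth_vectors weyl"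
proof -
  have "C_k k (\<lambda>g. weyl g v)" if "v \<in> rapidly_decreasing" for k v
    using that
  proof (induction k arbitrary: v)
    case 0
    then show ?case by (simp add: weyl_rep(3))
  next
    case (Suc k)
    show ?case
    proof (rule C_k_SucI[OF has_derivative_weyl[OF Suc.prems]])
      fix h
      have "bounded_linear (\<lambda>g. - (omega g h / 2))"
        by (intro bounded_linear_minus bounded_linear_divide bounded_linear_omega bounded_linear_compose[OF bounded_linear_divide])
      then have "C_k k (\<lambda>g. weyl g (heis_op h v) + (- (omega g h / 2)) *\<^sub>R (\<i> *\<^sub>C weyl g v))"
        by (intro C_k_add C_k_scale_linear C_k_bounded_linear[OF bounded_linear_scaleC_right] Suc
            heis_op_rapidly_decreasing)
      then show "C_k k (\<lambda>g. weyl g (heis_op h v) - (omega g h / 2) *\<^sub>R (\<i> *\<^sub>C weyl g v))" by simp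
    qed
  qed
  then show ?thesis by (auto simp: smooth_vectors_def)
qed

section \<open>Smooth vectors and the differential of a unitary representation\<close>

lemma smooth_vectorsD:
  assumes "v \<in> smooth_vectors U"
  shows "C_k k (\<lambda>g. U g v)"
    "((\<lambda>g. U g v) has_derivative frechet_derivative (\<lambda>g. U g v) (at g)) (at g)"
proof -
  show *: "C_k k (\<lambda>g. U g v)" for k using assms by (simp add: smooth_vectors_def)
  show "((\<lambda>g. U g v) has_derivative frechet_derivative (\<lambda>g. U g v) (at g)) (at g)"
    using C_k_SucD(1)[OF *] .
qed

lemma heis_differential_eq:
  assumes "((\<lambda>g. U g v) has_derivative D) (at 0)"
  shows "((\<lambda>s. U (s *\<^sub>R X) v) has_vector_derivative D X) (at 0)" "heis_differential U X v = D X"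
proof -
  have "((\<lambda>s. s *\<^sub>R X) has_derivative (\<lambda>s. s *\<^sub>R X)) (at (0 :: real))"
    by (intro bounded_linear_imp_has_derivative bounded_linear_scaleR_left)
  moreover have "((\<lambda>g. U g v) has_derivative D) (at (0 *\<^sub>R X))" using assms by simp
  ultimately have "((\<lambda>g. U g v) \<circ> (\<lambda>s. s *\<^sub>R X) has_derivative D \<circ> (\<lambda>s. s *\<^sub>R X)) (at 0)"
    by (rule diff_chain_at)
  moreover have "linear D" using assms has_derivative_linear by blast
  ultimately show *: "((\<lambda>s. U (s *\<^sub>R X) v) has_vector_derivative D X) (at 0)"
    by (simp add: has_vector_derivative_def o_def linear_scale)
  then show "heis_differential U X v = D X"
    unfolding heis_differential_def by (rule vector_derivative_at)
qed

lemma complex_subspace_smooth_vectors: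
  assumes "heis_unitary_rep U"
  shows "complex_subspace (smooth_vectors U)"
proof -
  note I = isometricD[OF heis_unitary_repD(1)[OF assms]]
  have "C_k k (\<lambda>g :: heis. 0 :: 'a)" for k
  proof (induction k)
    case (Suc k)
    then show ?case by (rule C_k_SucI[OF has_derivative_const])
  qed simp
  then show ?thesis
    by (auto simp: complex_subspace_def smooth_vectors_def I
        intro!: C_k_add C_k_bounded_linear[OF bounded_linear_scaleC_right])
qed

text \<open>Right translation by \<open>h\<close> is affine in \<open>h\<close>, with coefficients affine in the group element.\<close>

lemma smooth_vectors_differential:
  assumes U: "heis_unitary_rep U" and v: "v \<in> smooth_vectors U"
  shows "heis_differential U X v \<in> smooth_vectors U"
proof -
  define D where "D g = frechet_derivative (\<lambda>g. U g v) (at g)" for g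
  have D: "((\<lambda>g. U g v) has_derivative D g) (at g)" for g
    unfolding D_def by (rule smooth_vectorsD(2)[OF v])
  have "U g (D 0 X) = D g X + (omega g X / 2) *\<^sub>R D g heis_Z" for g
  proof -
    define M where "M h = h + (omega g h / 2) *\<^sub>R heis_Z" for h
    have M: "bounded_linear M"
      unfolding M_def
      by (intro linear_conv_bounded_linear[THEN iffD1] linearI)
        (simp_all add: algebra_simps add_divide_distrib scaleR_add_left)
    have "((\<lambda>h. g + M h) has_derivative (\<lambda>h. 0 + M h)) (at 0)"
      by (intro has_derivative_add has_derivative_const bounded_linear_imp_has_derivative M)
    moreover have "((\<lambda>g. U g v) has_derivative D g) (at (g + M 0))"
      using D[of g] by (simp add: M_def)
    ultimately have "((\<lambda>g. U g v) \<circ> (\<lambda>h. g + M h) has_derivative D g \<circ> (\<lambda>h. 0 + M h)) (at 0)"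
      by (rule diff_chain_at)
    moreover have "(\<lambda>g. U g v) \<circ> (\<lambda>h. g + M h) = (\<lambda>h. U g (U h v))"
      using heis_unitary_repD(2)[OF U] by (simp add: fun_eq_iff M_def heis_mult_eq add.assoc)
    moreover have "((\<lambda>h. U g (U h v)) has_derivative (\<lambda>h. U g (D 0 h))) (at 0)"
      by (rule bounded_linear.has_derivative[OF isometricD(7)[OF heis_unitary_repD(1)[OF U]] D])
    ultimately have "(\<lambda>h. U g (D 0 h)) = D g \<circ> (\<lambda>h. 0 + M h)"
      using has_derivative_unique by metis
    from fun_cong[OF this, of X] have "U g (D 0 X) = D g (M X)" by simp
    then show ?thesis
      using has_derivative_linear[OF D[of g]] by (simp add: M_def linear_add linear_scale)
  qed
  moreover have "C_k k (\<lambda>g. D g X + (omega g X / 2) *\<^sub>R D g heis_Z)" for k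
  proof -
    have "C_k k (\<lambda>g. D g Y)" for Y
      unfolding D_def using C_k_SucD(2)[OF smooth_vectorsD(1)[OF v]] by simp
    moreover have "bounded_linear (\<lambda>g. omega g X / 2)"
      by (intro bounded_linear_compose[OF bounded_linear_divide] bounded_linear_omega)
    ultimately show ?thesis by (intro C_k_add C_k_scale_linear)
  qed
  ultimately show ?thesis
    by (simp add: heis_differential_eq(2)[where U = U and v = v and D = "D 0", OF D] smooth_vectors_def)
qed

lemma heis_differential_weyl:
  "v \<in> rapidly_decreasing \<Longrightarrow> heis_differential weyl X v = heis_op X v"
  using heis_differential_eq(2)[where U = weyl and v = v and X = X
      and D = "\<lambda>h. weyl 0 (heis_op h v) - (omega 0 h / 2) *\<^sub>R (\<i> *\<^sub>C weyl 0 v)"]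
    has_derivative_weyl[of v 0] weyl_rep(4) by simp

lemma cinner_ladder_ket:
  "cinner (fock 0 (Gen G1) False (ket p)) v = ann1 (Rep_ell2 v) p"
  "cinner (fock 0 (Gen G2) False (ket p)) v = ann2 (Rep_ell2 v) p"
  "cinner (fock 0 (Gen G1) True (ket p)) v = cre1 (Rep_ell2 v) p"
  "cinner (fock 0 (Gen G2) True (ket p)) v = cre2 (Rep_ell2 v) p"
proof -
  obtain m n where p: "p = (m, n)" by (cases p)
  have "fock 0 (Gen G1) False (ket p) = complex_of_real (sqrt (Suc m)) *\<^sub>C ket (Suc m, n)"
    "fock 0 (Gen G2) False (ket p) = complex_of_real (sqrt (Suc n)) *\<^sub>C ket (m, Suc n)"
    "fock 0 (Gen G1) True (ket p) = complex_of_real (sqrt m) *\<^sub>C ket (m - 1, n)"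
    "fock 0 (Gen G2) True (ket p) = complex_of_real (sqrt n) *\<^sub>C ket (m, n - 1)"
    by (rule ell2_eqI, subst Rep_fock[OF ket_rapidly_decreasing],
      auto simp: p Rep_ell2_scaleC Rep_ket ladder_defs split: prod.split)+
  then show "cinner (fock 0 (Gen G1) False (ket p)) v = ann1 (Rep_ell2 v) p"
    "cinner (fock 0 (Gen G2) False (ket p)) v = ann2 (Rep_ell2 v) p"
    "cinner (fock 0 (Gen G1) True (ket p)) v = cre1 (Rep_ell2 v) p"
    "cinner (fock 0 (Gen G2) True (ket p)) v = cre2 (Rep_ell2 v) p"
    by (simp_all only: cinner_scaleC_left cinner_ket, simp_all add: p ladder_defs)
qed

lemma heis_op_ket: "cinner (heis_op X (ket p)) v = - (fst (disp X) * cre1 (Rep_ell2 v) p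
    + snd (disp X) * cre2 (Rep_ell2 v) p - cnj (fst (disp X)) * ann1 (Rep_ell2 v) p
    - cnj (snd (disp X)) * ann2 (Rep_ell2 v) p + \<i> * complex_of_real (snd (snd X)) * Rep_ell2 v p)"
proof -
  note r = ket_rapidly_decreasing[of p]
  have "heis_op X (ket p) = fst (disp X) *\<^sub>C fock 0 (Gen G1) False (ket p) + snd (disp X) *\<^sub>C fock 0 (Gen G2) False (ket p)
    - cnj (fst (disp X)) *\<^sub>C fock 0 (Gen G1) True (ket p) - cnj (snd (disp X)) *\<^sub>C fock 0 (Gen G2) True (ket p)
    + (\<i> * complex_of_real (snd (snd X))) *\<^sub>C ket p"
    by (rule ell2_eqI, subst Rep_heis_op[OF r])
      (simp only: Rep_ell2_simps Rep_ell2_scaleC Rep_fock[OF r], simp)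
  then show ?thesis
    by (simp only: cinner_simps cinner_ladder_ket cinner_ket) (simp add: algebra_simps)
qed

lemma smooth_vectors_weyl: "smooth_vectors weyl = rapidly_decreasing"
proof (intro equalityI rapidly_decreasing_smooth subsetI)
  fix v assume v: "v \<in> smooth_vectors weyl"
  note sub = complex_subspaceD[OF complex_subspace_smooth_vectors[OF heis_unitary_rep_weyl]]
  \<comment> \<open>No decay of \<open>u\<close> is known yet, so the Lie algebra element is moved
    onto \<open>ket p\<close>, where it acts as a finite combination. The right side is thereby the
    family of coordinates of an actual vector, although it was formed formally.\<close>
  have Rep: "Rep_ell2 (heis_differential weyl X u) p = fst (disp X) * cre1 (Rep_ell2 u) p
      + snd (disp X) * cre2 (Rep_ell2 u) p - cnj (fst (disp X)) * ann1 (Rep_ell2 u) p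
      - cnj (snd (disp X)) * ann2 (Rep_ell2 u) p + \<i> * complex_of_real (snd (snd X)) * Rep_ell2 u p"
    if u: "u \<in> smooth_vectors weyl" for u X p
  proof -
    note d = smooth_vectorsD(2)[OF u, of 0]
    let ?D = "frechet_derivative (\<lambda>g. weyl g u) (at 0)"
    have "((\<lambda>g. cinner (ket p) (weyl g u)) has_derivative (\<lambda>h. cinner (ket p) (?D h))) (at 0)"
      by (rule bounded_linear.has_derivative[OF bounded_linear_cinner_right d])
    moreover have "((\<lambda>g. cinner (weyl (- g) (ket p)) u) has_derivative (\<lambda>h. cinner (- heis_op h (ket p)) u)) (at 0)"
    proof (rule bounded_linear.has_derivative[OF bounded_linear_cinner_left])
      have "((\<lambda>g. weyl g (ket p)) has_derivative (\<lambda>h. heis_op h (ket p))) (at (- 0))"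
        using has_derivative_weyl[OF ket_rapidly_decreasing[of p], of 0] by (simp add: weyl_rep(4))
      from diff_chain_at[OF has_derivative_minus[OF has_derivative_ident] this]
      have "((\<lambda>g. weyl (- g) (ket p)) has_derivative (\<lambda>h. heis_op (- h) (ket p))) (at 0)"
        by (simp add: o_def)
      moreover have "heis_op (- h) (ket p) = - heis_op h (ket p)" for h
        using heis_op_linear(2)[OF ket_rapidly_decreasing[of p], of "-1" h] by simp
      ultimately show "((\<lambda>g. weyl (- g) (ket p)) has_derivative (\<lambda>h. - heis_op h (ket p))) (at 0)" by simp
    qed
    ultimately have "(\<lambda>h. cinner (ket p) (?D h)) = (\<lambda>h. cinner (- heis_op h (ket p)) u)"
      unfolding weyl_rep(7)[of "ket p"] by (rule has_derivative_unique)
    then have "cinner (ket p) (?D X) = cinner (- heis_op X (ket p)) u" by (rule fun_cong)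
    then show ?thesis
      by (simp add: heis_differential_eq(2)[where U = weyl and v = u and D = ?D, OF d] cinner_ket cinner_simps heis_op_ket)
  qed
  have ladder: "\<exists>w\<in>smooth_vectors weyl. Rep_ell2 w = T (Rep_ell2 u)"
    if u: "u \<in> smooth_vectors weyl" and T: "T \<in> {cre1, cre2, ann1, ann2}" for u T
  proof -
    define P1 P2 Q1 Q2 :: heis where "P1 = ((1, 0), (0, 0), 0)" and "P2 = ((0, 1), (0, 0), 0)"
      and "Q1 = ((0, 0), (1, 0), 0)" and "Q2 = ((0, 0), (0, 1), 0)"
    let ?r = "complex_of_real (1 / sqrt 2)"
    \<comment> \<open>The ladder operators in terms of the momentum and position directions:
      \<open>s = - 1\<close> gives the creation operator and \<open>s = 1\<close> the annihilation
      operator.\<close>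
    let ?w = "\<lambda>s X Y. ?r *\<^sub>C (s *\<^sub>C heis_differential weyl X u + (- \<i>) *\<^sub>C heis_differential weyl Y u)"
    have mem: "?w s X Y \<in> smooth_vectors weyl" for s X Y
      by (intro sub(2,3) smooth_vectors_differential[OF heis_unitary_rep_weyl u])
    have rr: "complex_of_real (sqrt 2) * complex_of_real (sqrt 2) = 2" by (simp flip: of_real_mult)
    have "Rep_ell2 (?w (-1) P1 Q1) = cre1 (Rep_ell2 u)" "Rep_ell2 (?w (-1) P2 Q2) = cre2 (Rep_ell2 u)"
      "Rep_ell2 (?w 1 P1 Q1) = ann1 (Rep_ell2 u)" "Rep_ell2 (?w 1 P2 Q2) = ann2 (Rep_ell2 u)"
      by (simp_all add: fun_eq_iff Rep_ell2_scaleC Rep_ell2_simps Rep[OF u] disp_def P1_def P2_def Q1_def Q2_def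
          Complex_eq field_simps rr)
    then show ?thesis using T mem by (elim insertE emptyE) blast+
  qed
  \<comment> \<open>The identity plus the two products of a creation with its annihilation operator
    is diagonal with entries 1 + m + n, exactly the weight in
    \<open>rapidly_decreasing\<close>.\<close>
  have number: "\<exists>w\<in>smooth_vectors weyl. \<forall>m n. Rep_ell2 w (m, n) = of_nat (1 + m + n) * Rep_ell2 u (m, n)"
    if u: "u \<in> smooth_vectors weyl" for u
  proof -
    obtain a1 a2 where a: "a1 \<in> smooth_vectors weyl" "Rep_ell2 a1 = ann1 (Rep_ell2 u)"
      "a2 \<in> smooth_vectors weyl" "Rep_ell2 a2 = ann2 (Rep_ell2 u)" using ladder[OF u] by (metis insertCI)
    obtain b1 b2 where b: "b1 \<in> smooth_vectors weyl" "Rep_ell2 b1 = cre1 (ann1 (Rep_ell2 u))"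
      "b2 \<in> smooth_vectors weyl" "Rep_ell2 b2 = cre2 (ann2 (Rep_ell2 u))"
      using ladder[OF a(1)] ladder[OF a(3)] a by (metis insertCI)
    have "Rep_ell2 (u + (b1 + b2)) (m, n) = of_nat (1 + m + n) * Rep_ell2 u (m, n)" for m n
      by (cases m; cases n) (simp_all add: Rep_ell2_simps b ladder_defs sqrt_self_mult del: of_nat_Suc,
        simp_all add: algebra_simps)
    then show ?thesis using sub(2) u b by blast
  qed
  have "\<exists>w\<in>smooth_vectors weyl. \<forall>m n. Rep_ell2 w (m, n) = of_nat (1 + m + n) ^ k * Rep_ell2 v (m, n)" for k
  proof (induction k)
    case 0
    then show ?case using v by (intro bexI[of _ v]) auto
  next
    case (Suc k)
    then obtain w where w: "w \<in> smooth_vectors weyl" "\<forall>m n. Rep_ell2 w (m, n) = of_nat (1 + m + n) ^ k * Rep_ell2 v (m, n)" by blast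
    show ?case using number[OF w(1)] by (simp add: w(2) mult.assoc)
  qed
  then have "\<exists>w. \<forall>m n. Rep_ell2 w (m, n) = of_nat (1 + m + n) ^ k * Rep_ell2 v (m, n)" for k by blast
  then obtain w where w: "\<And>k m n. Rep_ell2 (w k) (m, n) = of_nat (1 + m + n) ^ k * Rep_ell2 v (m, n)" by metis
  have "(1 + real m + real n) ^ k * cmod (Rep_ell2 v (m, n)) \<le> norm (w k)" for k m n
  proof -
    have "(1 + real m + real n) ^ k * cmod (Rep_ell2 v (m, n)) = cmod (Rep_ell2 (w k) (m, n))"
      unfolding w norm_mult norm_power norm_of_nat by (simp add: add.assoc)
    then show ?thesis using cmod_Rep_le_norm[of "w k" "(m, n)"] by simp
  qed
  then show "v \<in> rapidly_decreasing" unfolding rapidly_decreasing_iff rdf_def by blast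
qed

section \<open>The Fock representation for parameter x as a pullback\<close>

lemma fock_op_bogoliubov:
  "fock_op 0 (subst (bogoliubov (complex_of_real (sqrt (1 + (cmod x)\<^sup>2))) x) s) b f = fock_op x s b f"
proof (induction s arbitrary: b f)
  case (Gen g)
  then show ?case by (cases g; cases b) simp_all
qed simp_all

lemma star_algebra_iso_inv:
  assumes "star_algebra_iso A B \<Phi>" and "u \<in> carrier B"
  shows "inv_into (carrier A) \<Phi> u \<in> carrier A" "\<Phi> (inv_into (carrier A) \<Phi> u) = u"
proof -
  have b: "bij_betw \<Phi> (carrier A) (carrier B)" using assms(1) by (simp add: star_algebra_iso_def)
  show "inv_into (carrier A) \<Phi> u \<in> carrier A"
    using bij_betw_imp_surj_on[OF b] assms(2) by (auto intro: inv_into_into)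
  show "\<Phi> (inv_into (carrier A) \<Phi> u) = u" by (rule bij_betw_inv_into_right[OF b assms(2)])
qed

lemma fock_rep_pullback:
  assumes iso: "star_algebra_iso (A2 x) (A2 0) \<Phi>"
    and \<Phi>: "\<And>s. \<Phi> (term_class (A2_relations x) s) =
      term_class (A2_relations 0) (subst (bogoliubov (complex_of_real (sqrt (1 + (cmod x)\<^sup>2))) x) s)"
    and u: "u \<in> carrier (A2 0)"
  shows "fock_rep x (inv_into (carrier (A2 x)) \<Phi> u) = fock_rep 0 u"
proof -
  obtain s where s: "inv_into (carrier (A2 x)) \<Phi> u = term_class (A2_relations x) s"
    using star_algebra_iso_inv(1)[OF iso u] by (auto simp: A2_def presented_star_algebra_simps)
  have "u = term_class (A2_relations 0) (subst (bogoliubov (complex_of_real (sqrt (1 + (cmod x)\<^sup>2))) x) s)"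
    using star_algebra_iso_inv(2)[OF iso u] by (simp add: s \<Phi>)
  then show ?thesis
    unfolding s by (simp only: fun_eq_iff fock_rep_term_class fock_def) (simp add: fun_eq_iff fock_rep_term_class fock_def fock_op_bogoliubov)
qed

lemma star_rep_cong:
  assumes ring: "ring A" and "\<And>u. u \<in> carrier A \<Longrightarrow> \<pi> u = \<rho> u"
    and "\<And>u. u \<in> carrier A \<Longrightarrow> star A u \<in> carrier A"
    and "\<And>c u. u \<in> carrier A \<Longrightarrow> c \<odot>\<^bsub>A\<^esub> u \<in> carrier A"
    and "star_rep A D \<rho>"
  shows "star_rep A D \<pi>"
proof -
  interpret ring A by (rule ring)
  show ?thesis using assms(5) unfolding star_rep_def by (simp add: assms(2-4))
qed

lemma A2_closed:
  "ring (A2 x)" "u \<in> carrier (A2 x) \<Longrightarrow> star (A2 x) u \<in> carrier (A2 x)"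
  "u \<in> carrier (A2 x) \<Longrightarrow> c \<odot>\<^bsub>A2 x\<^esub> u \<in> carrier (A2 x)"
  by (auto simp: A2_def ring_presented_star_algebra presented_star_algebra_simps)

lemma fock_rep_well_behaved: "well_behaved_rep x rapidly_decreasing (fock_rep x)"
proof -
  obtain \<Phi> where \<Phi>: "star_algebra_iso (A2 x) (A2 0) \<Phi>" "\<Phi> (A2_gen x G1) = A2_gen 0 G1"
    "\<Phi> (A2_gen x G2) = complex_of_real (sqrt (1 + (cmod x)\<^sup>2)) \<odot>\<^bsub>A2 0\<^esub> A2_gen 0 G2
       \<oplus>\<^bsub>A2 0\<^esub> x \<odot>\<^bsub>A2 0\<^esub> star (A2 0) (A2_gen 0 G1)"
    "\<And>s. \<Phi> (term_class (A2_relations x) s) =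
      term_class (A2_relations 0) (subst (bogoliubov (complex_of_real (sqrt (1 + (cmod x)\<^sup>2))) x) s)"
    using A2_iso[of x thesis] by blast
  note pb = fock_rep_pullback[OF \<Phi>(1,4)]
  have H: "heis_to_CCR X \<in> carrier (A2 0)" for X
    by (auto simp: heis_to_CCR_def A2_def presented_star_algebra_simps)
  have "integrable_rep rapidly_decreasing (\<lambda>u. fock_rep x (inv_into (carrier (A2 x)) \<Phi> u))"
    unfolding integrable_rep_def
  proof (intro conjI exI[of _ weyl] allI ballI)
    show "star_rep (A2 0) rapidly_decreasing (\<lambda>u. fock_rep x (inv_into (carrier (A2 x)) \<Phi> u))"
      by (rule star_rep_cong[OF A2_closed(1) pb A2_closed(2,3) star_rep_fock])
    show "heis_unitary_rep weyl" by (rule heis_unitary_rep_weyl)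
    show "rapidly_decreasing = smooth_vectors weyl" by (rule smooth_vectors_weyl[symmetric])
    fix X v assume v: "v \<in> rapidly_decreasing"
    show "fock_rep x (inv_into (carrier (A2 x)) \<Phi> (heis_to_CCR X)) v = heis_differential weyl X v"
      unfolding pb[OF H] heis_differential_weyl[OF v]
      by (simp add: heis_to_CCR_def fock_rep_term_class heis_op_def)
  qed
  then show ?thesis
    unfolding well_behaved_rep_def using star_rep_fock \<Phi>(1-3) by blast
qed

section \<open>Gaussian averages\<close>

type_synonym plane = "(real \<times> real) \<times> (real \<times> real)"

lemma integrable_lborel_prod:
  fixes f :: "'a::euclidean_space \<Rightarrow> real" and g :: "'b::euclidean_space \<Rightarrow> real"
  assumes f: "integrable lborel f" and g: "integrable lborel g"
  shows "integrable lborel (\<lambda>z. f (fst z) * g (snd z))"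
proof -
  have [measurable]: "f \<in> borel_measurable lborel" "g \<in> borel_measurable lborel" using f g by auto
  have "integrable (lborel \<Otimes>\<^sub>M lborel) (\<lambda>z. f (fst z) * g (snd z))"
  proof (rule lborel_pair.Fubini_integrable)
    show "integrable lborel (\<lambda>x. LINT y|lborel. norm (f (fst (x, y)) * g (snd (x, y))))"
      using f by (simp add: abs_mult)
    show "AE x in lborel. integrable lborel (\<lambda>y. f (fst (x, y)) * g (snd (x, y)))"
      using g by simp
  qed simp
  then show ?thesis by (simp add: lborel_prod)
qed

lemma integrable_exp_neg_square:
  assumes "c > 0"
  shows "integrable lborel (\<lambda>x :: real. exp (- c * x\<^sup>2))"
proof -
  define s where "s = sqrt (1 / (2 * c))"
  have s: "s > 0" "s\<^sup>2 = 1 / (2 * c)" using assms by (simp_all add: s_def)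
  have "integrable lborel (\<lambda>x. sqrt (2 * pi * s\<^sup>2) * normal_density 0 s x)"
    using s by (intro integrable_mult_right integrable_normal_density)
  moreover have "sqrt (2 * pi * s\<^sup>2) * normal_density 0 s x = exp (- c * x\<^sup>2)" for x
    using s assms by (simp add: normal_density_def)
  ultimately show ?thesis by simp
qed

lemma norm_plane_square: "(norm z)\<^sup>2 = ((fst (fst z))\<^sup>2 + (snd (fst z))\<^sup>2) + ((fst (snd z))\<^sup>2 + (snd (snd z))\<^sup>2)"
  for z :: plane
  by (simp add: norm_prod_def)

lemma integrable_plane_gauss:
  assumes "c > 0"
  shows "integrable lborel (\<lambda>z :: plane. exp (- c * (norm z)\<^sup>2))"
proof -
  have "integrable lborel (\<lambda>p :: real \<times> real. exp (- c * (fst p)\<^sup>2) * exp (- c * (snd p)\<^sup>2))"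
    by (intro integrable_lborel_prod integrable_exp_neg_square assms)
  from integrable_lborel_prod[OF this this]
  show ?thesis by (simp add: norm_plane_square exp_add[symmetric] algebra_simps)
qed

definition gauss :: "plane \<Rightarrow> real" where
  "gauss z = exp (- (norm z)\<^sup>2 / 4)"

lemma gauss_measurable [measurable]: "gauss \<in> borel_measurable borel"
  unfolding gauss_def[abs_def] by measurable

lemma integrable_gauss_exp: "integrable lborel (\<lambda>z. gauss z * exp (m * norm z))"
proof (rule Bochner_Integration.integrable_bound)
  show "integrable lborel (\<lambda>z :: plane. exp (2 * m\<^sup>2) * exp (- (1 / 8) * (norm z)\<^sup>2))"
    by (intro integrable_mult_right integrable_plane_gauss) simp
  have "gauss z * exp (m * norm z) \<le> exp (2 * m\<^sup>2) * exp (- (1 / 8) * (norm z)\<^sup>2)" for z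
  proof -
    \<comment> \<open>Completing the square gives up half of the Gaussian exponent in exchange for
      the exponential growth; this produces the constants 1 / 8 and
      \<open>2 * m\<^sup>2\<close>.\<close>
    have "0 \<le> (norm z - 4 * m)\<^sup>2 / 8" by simp
    then show ?thesis
      unfolding gauss_def exp_add[symmetric] exp_le_cancel_iff
      by (simp add: power2_eq_square algebra_simps)
  qed
  then show "AE z in lborel. norm (gauss z * exp (m * norm z)) \<le> norm (exp (2 * m\<^sup>2) * exp (- (1 / 8) * (norm z)\<^sup>2))"
    by (simp add: gauss_def)
qed simp

lemma integrable_gauss: "integrable lborel gauss"
  using integrable_gauss_exp[of 0] by simp

lemma integrable_gauss_bounded:
  assumes [measurable]: "b \<in> borel_measurable borel" and b: "\<And>z. cmod (b z) \<le> B * exp (m * norm z)"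
  shows "integrable lborel (\<lambda>z. complex_of_real (gauss z) * b z)"
proof (rule Bochner_Integration.integrable_bound)
  show "integrable lborel (\<lambda>z. B * (gauss z * exp (m * norm z)))"
    by (intro integrable_mult_right integrable_gauss_exp)
  have "gauss z * cmod (b z) \<le> \<bar>B * (gauss z * exp (m * norm z))\<bar>" for z
    using mult_left_mono[OF b[of z], of "gauss z"]
    by (intro order_trans[OF _ abs_ge_self]) (simp add: gauss_def mult_ac)
  then show "AE z in lborel. norm (complex_of_real (gauss z) * b z) \<le> norm (B * (gauss z * exp (m * norm z)))"
    by (simp add: norm_mult gauss_def)
qed simp

section \<open>The symplectic form on phase space and holomorphic averages\<close>

definition om :: "plane \<Rightarrow> plane \<Rightarrow> real" where
  "om w z = fst w \<bullet> snd z - snd w \<bullet> fst z"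

text \<open>Half of a Hermitian form with Euclidean real part and symplectic imaginary part. It is
  the exponent that remains when a translation by \<open>w\<close> is moved from the group onto the
  Gaussian weight, see \<open>average_translate\<close>.\<close>

definition kap :: "plane \<Rightarrow> plane \<Rightarrow> complex" where
  "kap w z = (complex_of_real (w \<bullet> z) + \<i> * complex_of_real (om w z)) / 2"

lemma om_simps [simp]: "om z z = 0" "om (- w) z = - om w z" "om w (- z) = - om w z"
  "om w (z + z') = om w z + om w z'" "om w (z - z') = om w z - om w z'" "om (w + w') z = om w z + om w' z"
  by (simp_all add: om_def inner_commute inner_add_left inner_add_right inner_diff_right)

lemma cmod_kap_le: "cmod (kap w z) \<le> 2 * norm w * norm z"
proof -
  have "\<bar>fst w \<bullet> snd z\<bar> \<le> norm w * norm z" "\<bar>snd w \<bullet> fst z\<bar> \<le> norm w * norm z"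
    using norm_fst_le[of "fst w" "snd w"] norm_snd_le[of "snd w" "fst w"]
      norm_fst_le[of "fst z" "snd z"] norm_snd_le[of "snd z" "fst z"]
    by (auto intro!: order_trans[OF Cauchy_Schwarz_ineq2] mult_mono)
  moreover have "cmod (kap w z) \<le> (\<bar>w \<bullet> z\<bar> + \<bar>om w z\<bar>) / 2"
    unfolding kap_def norm_divide
    using norm_triangle_ineq[of "complex_of_real (w \<bullet> z)" "\<i> * complex_of_real (om w z)"]
    by (simp add: norm_mult)
  ultimately show ?thesis
    using Cauchy_Schwarz_ineq2[of w z] mult_nonneg_nonneg[OF norm_ge_zero[of w] norm_ge_zero[of z]]
    by (simp add: om_def)
qed

lemma kap_measurable [measurable]: "kap w \<in> borel_measurable borel"
  unfolding kap_def[abs_def] om_def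
  by (intro borel_measurable_continuous_onI continuous_intros) simp

text \<open>Expanding the exponential gives a power series in \<open>c\<close>. As
  \<open>kap w z\<close> grows at most linearly in \<open>z\<close>, all partial sums are dominated
  by a multiple of \<open>gauss z * exp (m * norm z)\<close>, so the series may be integrated term
  by term for every \<open>c\<close>.\<close>

lemma holomorphic_gauss_average:
  assumes [measurable]: "b \<in> borel_measurable borel" and b: "\<And>z. cmod (b z) \<le> B"
  shows "(\<lambda>c. LINT z|lborel. complex_of_real (gauss z) * (exp (c * kap w z) * b z)) holomorphic_on UNIV"
proof -
  define a where "a n = (LINT z|lborel. complex_of_real (gauss z) * (kap w z ^ n / fact n * b z))" for n
  have B: "B \<ge> 0" using b[of 0] norm_ge_zero order_trans by blast
  have sums: "(\<lambda>n. a n * c ^ n) sums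
      (LINT z|lborel. complex_of_real (gauss z) * (exp (c * kap w z) * b z))" for c
  proof -
    define f where "f n z = complex_of_real (gauss z) * ((c * kap w z) ^ n /\<^sub>R fact n * b z)" for n z
    define m where "m = cmod c * (2 * norm w)"
    have lk: "cmod (c * kap w z) \<le> m * norm z" for z
      using mult_left_mono[OF cmod_kap_le[of w z], of "cmod c"] by (simp add: m_def norm_mult mult_ac)
    have part: "(\<Sum>n<N. norm (f n z)) \<le> B * (gauss z * exp (m * norm z))" for N z
    proof -
      have "(\<Sum>n<N. norm ((c * kap w z) ^ n /\<^sub>R fact n)) = (\<Sum>n<N. (cmod (c * kap w z)) ^ n /\<^sub>R fact n)"
        by (simp add: norm_power)
      also have "\<dots> \<le> (\<Sum>n. (cmod (c * kap w z)) ^ n /\<^sub>R fact n)"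
        by (rule sum_le_suminf[OF summable_exp_generic]) auto
      also have "\<dots> = exp (cmod (c * kap w z))" by (simp add: exp_def)
      also have "\<dots> \<le> exp (m * norm z)" using lk by simp
      finally have "gauss z * (\<Sum>n<N. norm ((c * kap w z) ^ n /\<^sub>R fact n)) * cmod (b z) \<le>
          gauss z * exp (m * norm z) * B"
        using b[of z] B by (intro mult_mono mult_nonneg_nonneg sum_nonneg) (auto simp: gauss_def)
      moreover have "(\<Sum>n<N. norm (f n z)) = gauss z * (\<Sum>n<N. norm ((c * kap w z) ^ n /\<^sub>R fact n)) * cmod (b z)"
        unfolding sum_distrib_left sum_distrib_right
        by (rule sum.cong) (simp_all add: f_def norm_mult gauss_def)
      ultimately show ?thesis by (simp add: mult_ac)
    qed
    have part': "(\<Sum>n\<le>N. norm (f n z)) \<le> B * (gauss z * exp (m * norm z))" for N z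
      using part[where N = "Suc N" and z = z] by (simp add: lessThan_Suc_atMost)
    have single: "norm (f n z) \<le> B * (gauss z * exp (m * norm z))" for n z
      using member_le_sum[of n "{..n}" "\<lambda>n. norm (f n z)"] part'[where N = n and z = z] by simp
    have [measurable]: "f n \<in> borel_measurable borel" for n unfolding f_def[abs_def] by measurable
    have int: "integrable lborel (f n)" for n
      by (rule Bochner_Integration.integrable_bound[OF integrable_mult_right[OF integrable_gauss_exp[of m], of B]])
        (use single[where n = n] in \<open>auto intro!: AE_I2 order_trans[OF _ abs_ge_self] simp: split_paired_all\<close>)
    have "(\<lambda>n. integral\<^sup>L lborel (f n)) sums (LINT z|lborel. (\<Sum>n. f n z))"
    proof (rule sums_integral[OF int])
      show "AE z in lborel. summable (\<lambda>n. norm (f n z))"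
        by (intro AE_I2, rule bounded_imp_summable[OF _ part']) simp
      show "summable (\<lambda>n. LINT z|lborel. norm (f n z))"
      proof (rule bounded_imp_summable)
        fix N
        have "(\<Sum>n\<le>N. LINT z|lborel. norm (f n z)) = (LINT z|lborel. (\<Sum>n\<le>N. norm (f n z)))"
          by (subst Bochner_Integration.integral_sum) (simp_all add: int)
        also have "\<dots> \<le> (LINT z|lborel. B * (gauss z * exp (m * norm z)))"
          by (intro integral_mono Bochner_Integration.integrable_sum integrable_norm int part'
              integrable_mult_right integrable_gauss_exp)
        finally show "(\<Sum>n\<le>N. LINT z|lborel. norm (f n z)) \<le> (LINT z|lborel. B * (gauss z * exp (m * norm z)))" .
      qed simp
    qed
    moreover have "(\<Sum>n. f n z) = complex_of_real (gauss z) * (exp (c * kap w z) * b z)" for z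
      unfolding f_def exp_def
      by (subst suminf_mult, (intro summable_mult2 summable_exp_generic)?, subst suminf_mult2)
        (auto intro: summable_exp_generic summable_mult2)
    moreover have "integral\<^sup>L lborel (f n) = a n * c ^ n" for n
      unfolding a_def f_def
      by (subst integral_mult_left_zero[symmetric], rule Bochner_Integration.integral_cong)
        (simp_all add: power_mult_distrib scaleR_conv_of_real field_simps)
    ultimately show ?thesis by simp
  qed
  have "(\<lambda>c. LINT z|lborel. complex_of_real (gauss z) * (exp (c * kap w z) * b z)) holomorphic_on ball 0 r" for r
    by (rule power_series_holomorphic[of 0 r a]) (simp add: sums)
  then have "(\<lambda>c. LINT z|lborel. complex_of_real (gauss z) * (exp (c * kap w z) * b z))
      holomorphic_on (\<Union>r. ball 0 r)"
    by (intro holomorphic_on_UN_open) auto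
  moreover have "(\<Union>r. ball 0 r) = (UNIV :: complex set)"
    by (auto simp: gt_ex)
  ultimately show ?thesis by simp
qed

section \<open>Entire functions with a symmetry\<close>

lemma real_valued_entire_constant:
  assumes f: "f holomorphic_on UNIV" and "\<And>z. Im (f z) = 0"
  shows "f z = f 0"
proof -
  \<comment> \<open>On real values of \<open>f\<close> this function has modulus one, so Liouville's
    theorem applies; its derivative is a nonvanishing factor times \<open>deriv f\<close>.\<close>
  have g: "(\<lambda>z. exp (\<i> * f z)) holomorphic_on UNIV" by (intro holomorphic_intros f)
  moreover have "bounded (range (\<lambda>z. exp (\<i> * f z)))"
    unfolding bounded_iff using assms(2) by (intro exI[of _ 1]) auto
  ultimately have "(\<lambda>z. exp (\<i> * f z)) constant_on UNIV" by (rule Liouville_theorem)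
  then obtain c where c: "\<And>z. exp (\<i> * f z) = c" by (auto simp: constant_on_def)
  have "(f has_field_derivative 0) (at z)" for z
  proof -
    have d: "(f has_field_derivative deriv f z) (at z)"
      using f by (simp add: holomorphic_derivI)
    have "((\<lambda>z. exp (\<i> * f z)) has_field_derivative (exp (\<i> * f z) * (\<i> * deriv f z))) (at z)"
      by (rule DERIV_fun_exp[THEN DERIV_cong]) (auto intro!: DERIV_cmult d)
    then have "((\<lambda>z. c) has_field_derivative (exp (\<i> * f z) * (\<i> * deriv f z))) (at z)"
      by (simp only: c)
    then have "exp (\<i> * f z) * (\<i> * deriv f z) = 0" using DERIV_unique DERIV_const by blast
    then show ?thesis using d by simp
  qed
  then have "\<exists>c. \<forall>z\<in>UNIV. f z = c" by (intro has_field_derivative_zero_constant) auto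
  then show ?thesis by auto
qed

text \<open>The symmetry turns \<open>f z + f (- z)\<close> into \<open>2 * Re (f z)\<close> and
  \<open>\<i> * (f z - f (- z))\<close> into \<open>- 2 * Im (f z)\<close>: two real-valued entire
  functions.\<close>

lemma entire_constant_of_symmetry:
  assumes f: "f holomorphic_on UNIV" and sym: "\<And>z. f z = cnj (f (- z))"
  shows "f z = f 0"
proof -
  have fm: "(\<lambda>z. f (- z)) holomorphic_on UNIV"
    using holomorphic_on_compose_gen[OF holomorphic_on_minus[OF holomorphic_on_ident] f] by (simp add: o_def)
  have s: "Re (f (- z)) = Re (f z)" "Im (f (- z)) = - Im (f z)" for z
    using arg_cong[OF sym[of z], of Re] arg_cong[OF sym[of z], of Im] by simp_all
  have "f z + f (- z) = f 0 + f (- 0)"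
    by (rule real_valued_entire_constant[of "\<lambda>z. f z + f (- z)"]) (auto intro!: holomorphic_intros f fm simp: s)
  moreover have "\<i> * (f z - f (- z)) = \<i> * (f 0 - f (- 0))"
    by (rule real_valued_entire_constant[of "\<lambda>z. \<i> * (f z - f (- z))"]) (auto intro!: holomorphic_intros f fm simp: s)
  ultimately show ?thesis by simp
qed

text \<open>Averaging the phase over a normally distributed frequency.\<close>

lemma fourier_zero_gauss:
  fixes f :: "plane \<Rightarrow> complex" and l :: "plane \<Rightarrow> real"
  assumes f: "integrable lborel f" and [measurable]: "l \<in> borel_measurable borel"
    and zero: "\<And>s. (LINT z|lborel. f z * exp (\<i> * complex_of_real (s * l z))) = 0"
  shows "(LINT z|lborel. f z * complex_of_real (exp (- (l z)\<^sup>2 / 2))) = 0"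
proof -
  have [measurable]: "f \<in> borel_measurable borel" using f by auto
  have "(CLINT x|density lborel std_normal_density. iexp (t * x)) = complex_of_real (exp (- (t\<^sup>2) / 2))" for t
    using fun_cong[OF char_std_normal_distribution, of t] by (simp add: char_def)
  then have ch: "(LINT s|lborel. std_normal_density s *\<^sub>R iexp (t * s)) = complex_of_real (exp (- (t\<^sup>2) / 2))" for t
    by (subst (asm) integral_density) auto
  define F where "F z s = f z * (std_normal_density s *\<^sub>R iexp (l z * s))" for z s
  have "integrable (lborel \<Otimes>\<^sub>M lborel) (case_prod F)"
  proof (rule lborel_pair.Fubini_integrable)
    show "case_prod F \<in> borel_measurable (lborel \<Otimes>\<^sub>M lborel)" unfolding F_def by measurable
    have n: "norm (case (z, s) of (z, s) \<Rightarrow> F z s) = cmod (f z) * std_normal_density s" for z s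
      by (simp add: F_def norm_mult)
    show "integrable lborel (\<lambda>z. LINT s|lborel. norm (case (z, s) of (z, s) \<Rightarrow> F z s))"
      unfolding n using f by simp
    show "AE z in lborel. integrable lborel (\<lambda>s. case (z, s) of (z, s) \<Rightarrow> F z s)"
    proof (rule AE_I2)
      fix z
      show "integrable lborel (\<lambda>s. case (z, s) of (z, s) \<Rightarrow> F z s)"
      proof (rule Bochner_Integration.integrable_bound)
        show "integrable lborel (\<lambda>s. cmod (f z) * std_normal_density s)" by (intro integrable_mult_right integrable_normal_density) simp
        show "(\<lambda>s. case (z, s) of (z, s) \<Rightarrow> F z s) \<in> borel_measurable lborel"
          unfolding F_def prod.case by measurable
        show "AE s in lborel. norm (case (z, s) of (z, s) \<Rightarrow> F z s) \<le> norm (cmod (f z) * std_normal_density s)"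
          unfolding n by simp
      qed
    qed
  qed
  then have "(LINT z|lborel. LINT s|lborel. F z s) = (LINT s|lborel. LINT z|lborel. F z s)"
    by (rule lborel_pair.Fubini_integral[symmetric])
  also have "\<dots> = (LINT s|lborel. complex_of_real (std_normal_density s) * (LINT z|lborel. f z * exp (\<i> * complex_of_real (s * l z))))"
    unfolding integral_mult_right_zero[symmetric] F_def
    by (intro Bochner_Integration.integral_cong[OF HOL.refl]) (simp add: scaleR_conv_of_real mult_ac)
  also have "\<dots> = 0" by (simp only: zero) simp
  finally show ?thesis unfolding F_def by (simp only: integral_mult_right_zero ch)
qed

text \<open>For large \<open>k\<close> the last factor concentrates at the origin. The ball of
  radius \<open>\<delta> / 2\<close> contributes to the real part at least \<open>C1\<close> times
  \<open>exp (- k\<^sup>2 * \<delta>\<^sup>2 / 8)\<close>, the exterior of the ball of radius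
  \<open>\<delta>\<close> at least \<open>- C2\<close> times
  \<open>exp (- k\<^sup>2 * \<delta>\<^sup>2 / 2)\<close>, and the shell between them a nonnegative
  amount; the first bound wins.\<close>

lemma gauss_concentration:
  fixes b :: "plane \<Rightarrow> complex"
  assumes cont: "continuous_on UNIV b" and bound: "\<And>z. cmod (b z) \<le> \<beta>" and b0: "b 0 = complex_of_real \<beta>"
    and \<beta>: "\<beta> > 0"
  shows "\<exists>k. (LINT z|lborel. complex_of_real (gauss z) * b z * complex_of_real (exp (- (k\<^sup>2 * (norm z)\<^sup>2 / 2)))) \<noteq> 0"
proof (rule ccontr)
  assume "\<not> ?thesis"
  then have zero: "(LINT z|lborel. complex_of_real (gauss z) * b z * complex_of_real (exp (- (k\<^sup>2 * (norm z)\<^sup>2 / 2)))) = 0" for k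
    by blast
  have [measurable]: "b \<in> borel_measurable borel" using cont by (rule borel_measurable_continuous_onI)
  have "isCont b 0" by (rule continuous_on_interior[OF cont]) simp
  then obtain \<delta> where \<delta>: "\<delta> > 0" "\<And>z. dist z 0 < \<delta> \<Longrightarrow> dist (b z) (b 0) < \<beta> / 2"
    using \<beta> unfolding continuous_at_eps_delta by (metis half_gt_zero)
  have Re: "Re (b z) \<ge> \<beta> / 2" if "norm z < \<delta>" for z
    using \<delta>(2)[of z] that abs_Re_le_cmod[of "b z - b 0"] by (simp add: dist_norm b0)
  have fin: "emeasure lborel (ball (0 :: plane) (\<delta> / 2)) < \<top>"
    using emeasure_bounded_finite[OF bounded_ball, of "0 :: plane" "\<delta> / 2"] by simp
  define C1 where "C1 = \<beta> / 2 * exp (- \<delta>\<^sup>2 / 16) * measure lborel (ball (0 :: plane) (\<delta> / 2))"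
  define C2 where "C2 = \<beta> * integral\<^sup>L lborel gauss"
  have C1: "C1 > 0" using \<beta> \<delta>(1) by (simp add: C1_def)
  have main: "C1 * exp (- (k\<^sup>2 / 2) * \<delta>\<^sup>2 / 4) \<le> C2 * exp (- (k\<^sup>2 / 2) * \<delta>\<^sup>2)" for k
  proof -
    define c where "c = k\<^sup>2 / 2"
    have c: "c \<ge> 0" by (simp add: c_def)
    let ?f = "\<lambda>z. gauss z * Re (b z) * exp (- c * (norm z)\<^sup>2)"
    let ?g = "\<lambda>z :: plane. \<beta> / 2 * exp (- \<delta>\<^sup>2 / 16) * exp (- c * \<delta>\<^sup>2 / 4) * indicator (ball 0 (\<delta> / 2)) z
      - \<beta> * exp (- c * \<delta>\<^sup>2) * gauss z"
    have int: "integrable lborel (\<lambda>z. complex_of_real (gauss z) * (b z * complex_of_real (exp (- c * (norm z)\<^sup>2))))"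
    proof (rule integrable_gauss_bounded[where B = \<beta> and m = 0])
      fix z
      have "cmod (b z) * exp (- c * (norm z)\<^sup>2) \<le> \<beta> * 1"
        using bound[of z] c \<beta> by (intro mult_mono) auto
      then show "cmod (b z * complex_of_real (exp (- c * (norm z)\<^sup>2))) \<le> \<beta> * exp (0 * norm z)"
        by (simp add: norm_mult)
    qed measurable
    have "(LINT z|lborel. ?f z) = Re (LINT z|lborel. complex_of_real (gauss z) * (b z * complex_of_real (exp (- c * (norm z)\<^sup>2))))"
      by (subst integral_Re[OF int, symmetric], rule Bochner_Integration.integral_cong[OF HOL.refl]) (simp add: mult.assoc)
    also have "\<dots> = 0" using zero[of k] by (simp add: c_def mult.assoc)
    finally have f0: "(LINT z|lborel. ?f z) = 0" .
    have "(LINT z|lborel. ?g z) \<le> (LINT z|lborel. ?f z)"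
    proof (rule integral_mono)
      show "integrable lborel ?g"
        by (intro Bochner_Integration.integrable_diff integrable_mult_right integrable_gauss)
          (simp add: integrable_indicator_iff fin)
      have "integrable lborel (\<lambda>z. Re (complex_of_real (gauss z) * (b z * complex_of_real (exp (- c * (norm z)\<^sup>2)))))"
        by (rule integrable_Re[OF int])
      then show "integrable lborel ?f" by (simp add: mult.assoc)
      fix z :: plane
      have g: "gauss z > 0" by (simp add: gauss_def)
      consider "norm z < \<delta> / 2" | "\<delta> / 2 \<le> norm z" "norm z < \<delta>" | "\<delta> \<le> norm z" by linarith
      then show "?g z \<le> ?f z"
      proof cases
        case 1
        then have n: "(norm z)\<^sup>2 \<le> (\<delta> / 2)\<^sup>2" by (intro power_mono) auto
        have e: "exp (- \<delta>\<^sup>2 / 16) \<le> gauss z" using n by (simp add: gauss_def power_divide)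
        have "c * (norm z)\<^sup>2 \<le> c * (\<delta> / 2)\<^sup>2" by (rule mult_left_mono[OF n c])
        then have e': "exp (- c * \<delta>\<^sup>2 / 4) \<le> exp (- c * (norm z)\<^sup>2)" by (simp add: power_divide)
        have "\<beta> / 2 * exp (- \<delta>\<^sup>2 / 16) * exp (- c * \<delta>\<^sup>2 / 4) \<le> Re (b z) * gauss z * exp (- c * (norm z)\<^sup>2)"
          using Re[of z] 1 \<delta>(1) \<beta> e e' g by (intro mult_mono) auto
        moreover have "0 \<le> \<beta> * exp (- c * \<delta>\<^sup>2) * gauss z" using \<beta> g by simp
        ultimately show ?thesis using 1 by (simp add: mult.commute mult.left_commute)
      next
        case 2
        have "0 \<le> ?f z" using Re[OF 2(2)] \<beta> g by simp
        moreover have "0 \<le> \<beta> * exp (- c * \<delta>\<^sup>2) * gauss z" using \<beta> g by simp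
        ultimately show ?thesis using 2 by simp
      next
        case 3
        then have "\<delta>\<^sup>2 \<le> (norm z)\<^sup>2" using \<delta>(1) by (intro power_mono) auto
        then have "c * \<delta>\<^sup>2 \<le> c * (norm z)\<^sup>2" by (rule mult_left_mono[OF _ c])
        then have "\<bar>Re (b z)\<bar> * exp (- c * (norm z)\<^sup>2) \<le> \<beta> * exp (- c * \<delta>\<^sup>2)"
          using order_trans[OF abs_Re_le_cmod bound[of z]] \<beta> by (intro mult_mono) auto
        then have "- (\<beta> * exp (- c * \<delta>\<^sup>2)) \<le> Re (b z) * exp (- c * (norm z)\<^sup>2)"
          using abs_ge_minus_self[of "Re (b z) * exp (- c * (norm z)\<^sup>2)"] by (simp only: abs_mult abs_exp_cancel)
        from mult_right_mono[OF this, of "gauss z"] g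
        have "- (\<beta> * exp (- c * \<delta>\<^sup>2) * gauss z) \<le> Re (b z) * exp (- c * (norm z)\<^sup>2) * gauss z" by simp
        then show ?thesis using 3 \<delta>(1) by (simp add: mult_ac)
      qed
    qed
    also have "(LINT z|lborel. ?g z) = C1 * exp (- c * \<delta>\<^sup>2 / 4) - C2 * exp (- c * \<delta>\<^sup>2)"
      by (subst Bochner_Integration.integral_diff)
        (simp_all add: integrable_indicator_iff fin integrable_gauss C1_def C2_def)
    finally have "C1 * exp (- c * \<delta>\<^sup>2 / 4) - C2 * exp (- c * \<delta>\<^sup>2) \<le> 0" unfolding f0 .
    then show ?thesis unfolding c_def[symmetric] by linarith
  qed
  \<comment> \<open>The quotient is what makes \<open>C2 \<le> C1 * y\<close> for
    \<open>y = 3 * k\<^sup>2 * \<delta>\<^sup>2 / 8\<close>, the difference of the two decay rates;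
    the maximum with 1 provides \<open>k \<le> k\<^sup>2\<close>. This contradicts
    \<open>1 + y \<le> exp y\<close>.\<close>
  define k where "k = max 1 (8 * C2 / (3 * \<delta>\<^sup>2 * C1))"
  have k: "k \<ge> 1" "8 * C2 / (3 * \<delta>\<^sup>2 * C1) \<le> k" by (simp_all add: k_def)
  have "k * 1 \<le> k\<^sup>2" unfolding power2_eq_square using k(1) by (intro mult_left_mono) auto
  then have kk: "8 * C2 / (3 * \<delta>\<^sup>2 * C1) \<le> k\<^sup>2" using k(2) by linarith
  define y where "y = 3 * k\<^sup>2 * \<delta>\<^sup>2 / 8"
  have "C1 * exp y = C1 * exp (- (k\<^sup>2 / 2) * \<delta>\<^sup>2 / 4) * exp ((k\<^sup>2 / 2) * \<delta>\<^sup>2)"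
    unfolding mult.assoc exp_add[symmetric] by (simp add: y_def field_simps)
  also have "\<dots> \<le> C2 * exp (- (k\<^sup>2 / 2) * \<delta>\<^sup>2) * exp ((k\<^sup>2 / 2) * \<delta>\<^sup>2)"
    by (intro mult_right_mono main) simp
  also have "\<dots> = C2" unfolding mult.assoc exp_add[symmetric] by simp
  finally have "C1 * exp y \<le> C2" .
  moreover have "C1 * (1 + y) \<le> C1 * exp y" using C1 by (intro mult_left_mono exp_ge_add_one_self) auto
  moreover have "C2 \<le> C1 * y" using kk C1 \<delta>(1) by (simp add: y_def field_simps)
  ultimately show False using C1 by (simp add: distrib_left)
qed

section \<open>Representations with fixed central character and their averages\<close>

definition plane_elt :: "plane \<Rightarrow> heis" where
  "plane_elt z = (fst z, snd z, 0)"

lemma plane_elt_simps [simp]: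
  "plane_elt (z + w) = plane_elt z + plane_elt w" "plane_elt (- z) = - plane_elt z" "plane_elt 0 = 0"
  "plane_elt (r *\<^sub>R z) = r *\<^sub>R plane_elt z" "omega (plane_elt w) (plane_elt z) = om w z"
  by (simp_all add: plane_elt_def omega_def om_def zero_prod_def)

lemma bounded_linear_plane_elt: "bounded_linear plane_elt"
  by (intro linear_conv_bounded_linear[THEN iffD1] linearI) simp_all

text \<open>The complex structure that makes \<open>kap\<close> complex linear in its first
  argument; the sign is dictated by that of \<open>om\<close>.\<close>

definition plane_J :: "plane \<Rightarrow> plane" where
  "plane_J w = (snd w, - fst w)"

lemma kap_complex_structure:
  "kap (a *\<^sub>R w + b *\<^sub>R plane_J w) z = Complex a b * kap w z"
  "(norm (a *\<^sub>R w + b *\<^sub>R plane_J w))\<^sup>2 = (a\<^sup>2 + b\<^sup>2) * (norm w)\<^sup>2"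
  by (simp_all add: kap_def om_def plane_J_def complex_eq_iff inner_prod_def norm_plane_square)
    (simp_all add: power2_eq_square algebra_simps add_divide_distrib diff_divide_distrib)

text \<open>Once the centre acts by a fixed character, \<open>U\<close> amounts to a projective
  representation of phase space: \<open>U_mult\<close> gives its cocycle, and \<open>U_heis\<close>
  recovers \<open>U\<close> from the operators \<open>U (plane_elt z)\<close>.\<close>

locale central_heis_rep =
  fixes U :: "heis \<Rightarrow> 'h::complex_hilbert \<Rightarrow> 'h"
  assumes rep: "heis_unitary_rep U"
    and central: "U (t *\<^sub>R heis_Z) v = exp (\<i> * complex_of_real t) *\<^sub>C v"
begin

lemmas repD = heis_unitary_repD[OF rep]
lemmas isoD = isometricD[OF repD(1)]

lemma U_mult: "U g (U h v) = exp (\<i> * complex_of_real (omega g h / 2)) *\<^sub>C U (g + h) v"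
proof -
  have "heis_mult g h = heis_mult (g + h) ((omega g h / 2) *\<^sub>R heis_Z)"
    by (simp add: heis_mult_eq)
  then have "U g (U h v) = U (g + h) (U ((omega g h / 2) *\<^sub>R heis_Z) v)"
    by (simp only: repD(2)[symmetric])
  then show ?thesis by (simp only: central isoD)
qed

lemma U_heis: "U g v = exp (\<i> * complex_of_real (snd (snd g))) *\<^sub>C U (plane_elt (fst g, fst (snd g))) v"
proof -
  have "g = heis_mult (plane_elt (fst g, fst (snd g))) (snd (snd g) *\<^sub>R heis_Z)"
    by (simp add: heis_mult_eq) (simp add: plane_elt_def heis_Z_def prod_eq_iff)
  then have "U g v = U (plane_elt (fst g, fst (snd g))) (U (snd (snd g) *\<^sub>R heis_Z) v)"
    by (simp only: repD(2)[symmetric])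
  then show ?thesis by (simp only: central isoD)
qed

lemma continuous_matrix_coeff: "continuous_on UNIV (\<lambda>z. cinner u (U (plane_elt z) v))"
  by (intro continuous_on_cinner continuous_on_const continuous_on_compose2[OF repD(3)]
      linear_continuous_on bounded_linear_plane_elt) simp

lemma matrix_coeff_measurable [measurable]: "(\<lambda>z. cinner u (U (plane_elt z) v)) \<in> borel_measurable borel"
  by (rule borel_measurable_continuous_onI[OF continuous_matrix_coeff])

lemma matrix_coeff_bound: "cmod (cinner u (U g v)) \<le> norm u * norm v"
  using cinner_Cauchy_Schwarz[of u "U g v"] by (simp add: isoD)

lemma integrable_matrix_coeff: "integrable lborel (\<lambda>z. complex_of_real (gauss z) * cinner u (U (plane_elt z) v))"
  by (rule integrable_gauss_bounded[where B = "norm u * norm v" and m = 0])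
    (use matrix_coeff_bound in auto)

text \<open>The integral is taken weakly, since the Hilbert space need not be separable and the Bochner
  integral is available for second countable spaces only.\<close>

definition average :: "'h \<Rightarrow> 'h \<Rightarrow> bool" where
  "average v \<Omega> \<longleftrightarrow>
     (\<forall>u. cinner u \<Omega> = (LINT z|lborel. complex_of_real (gauss z) * cinner u (U (plane_elt z) v)))"

text \<open>The integral is antilinear in \<open>u\<close> and bounded by \<open>norm u\<close>
  times the mass of the weight, so its conjugate falls under the Riesz theorem.\<close>

lemma average_exists: "\<exists>\<Omega>. average v \<Omega>"
proof -
  define l where "l u = cnj (LINT z|lborel. complex_of_real (gauss z) * cinner u (U (plane_elt z) v))" for u
  have sc: "l (c *\<^sub>C u) = c * l u" for c u
  proof -
    have "(LINT z|lborel. complex_of_real (gauss z) * cinner (c *\<^sub>C u) (U (plane_elt z) v))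
        = (LINT z|lborel. cnj c * (complex_of_real (gauss z) * cinner u (U (plane_elt z) v)))"
      by (simp add: cinner_scaleC_left mult.left_commute)
    then show ?thesis by (simp add: l_def)
  qed
  have "bounded_linear l"
  proof (rule bounded_linear_intro)
    show "l (u + u') = l u + l u'" for u u'
      by (simp add: l_def cinner_add_left distrib_left Bochner_Integration.integral_add integrable_matrix_coeff)
    show "l (r *\<^sub>R u) = r *\<^sub>R l u" for r u
      by (simp add: scaleR_scaleC sc scaleR_conv_of_real)
    show "norm (l u) \<le> norm u * (norm v * integral\<^sup>L lborel gauss)" for u
    proof -
      have "norm (l u) \<le> (LINT z|lborel. norm (complex_of_real (gauss z) * cinner u (U (plane_elt z) v)))"
        unfolding l_def complex_mod_cnj by (rule integral_norm_bound)
      also have "\<dots> \<le> (LINT z|lborel. gauss z * (norm u * norm v))"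
        by (intro integral_mono integrable_norm integrable_matrix_coeff integrable_mult_left integrable_gauss)
          (auto simp: norm_mult gauss_def intro!: mult_left_mono matrix_coeff_bound)
      finally show ?thesis by (simp add: mult_ac)
    qed
  qed
  then obtain w where "\<And>u. l u = cinner w u" using sc by (rule Riesz_representation) blast
  then have "cinner u w = cnj (l u)" for u using cinner_commute[of u w] by simp
  then show ?thesis unfolding average_def l_def by auto
qed

text \<open>Replacing \<open>z\<close> by \<open>w + z\<close> merges the phase of the Weyl relation
  with the shifted Gaussian into \<open>exp (kap w z)\<close>. Apart from the real factor in front,
  the result thus depends on \<open>w\<close> holomorphically with respect to
  \<open>plane_J\<close>, for every fixed \<open>u\<close>.\<close>

lemma average_translate:
  assumes "average v \<Omega>"
  shows "cinner u (U (plane_elt w) \<Omega>) = complex_of_real (exp (- (norm w)\<^sup>2 / 4)) *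
    (LINT z|lborel. complex_of_real (gauss z) * (exp (kap w z) * cinner u (U (plane_elt z) v)))"
proof -
  define G where "G y = complex_of_real (exp (- (norm w)\<^sup>2 / 4)) *
    (complex_of_real (gauss y) * (exp (kap w y) * cinner u (U (plane_elt y) v)))" for y
  have [measurable]: "G \<in> borel_measurable borel" unfolding G_def[abs_def] by measurable
  have "cinner u (U (plane_elt w) \<Omega>) =
      (LINT z|lborel. complex_of_real (gauss z) * cinner (U (- plane_elt w) u) (U (plane_elt z) v))"
    using assms unfolding average_def repD(7)[of u "plane_elt w"] by blast
  also have "\<dots> = (LINT z|lborel. G (w + z))"
  proof (rule Bochner_Integration.integral_cong[OF HOL.refl])
    fix z
    have e: "complex_of_real (gauss z) * exp (\<i> * complex_of_real (om w z / 2)) =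
      complex_of_real (exp (- (norm w)\<^sup>2 / 4)) * (complex_of_real (gauss (w + z)) * exp (kap w (w + z)))"
      unfolding gauss_def exp_of_real[symmetric] exp_add[symmetric]
      by (intro arg_cong[of _ _ exp])
        (simp add: kap_def complex_eq_iff power2_norm_eq_inner inner_add_left inner_add_right inner_commute field_simps)
    have "cinner (U (- plane_elt w) u) (U (plane_elt z) v) = cinner u (U (plane_elt w) (U (plane_elt z) v))"
      by (simp only: repD(7)[of u "plane_elt w"])
    also have "\<dots> = exp (\<i> * complex_of_real (om w z / 2)) * cinner u (U (plane_elt (w + z)) v)"
      by (simp only: U_mult cinner_scaleC_right plane_elt_simps)
    finally show "complex_of_real (gauss z) * cinner (U (- plane_elt w) u) (U (plane_elt z) v) = G (w + z)"
      using arg_cong[OF e, of "\<lambda>c. c * cinner u (U (plane_elt (w + z)) v)"] by (simp add: G_def mult.assoc)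
  qed
  also have "\<dots> = integral\<^sup>L (distr lborel borel ((+) w)) G"
    by (subst integral_distr) simp_all
  also have "\<dots> = integral\<^sup>L lborel G" by (simp only: lborel_distr_plus)
  finally show ?thesis unfolding G_def[abs_def] integral_mult_right_zero .
qed

lemma average_gaussian_state:
  assumes av: "average v \<Omega>"
  shows "cinner \<Omega> (U (plane_elt w) \<Omega>) = complex_of_real (exp (- (norm w)\<^sup>2 / 4) * (norm \<Omega>)\<^sup>2)"
proof -
  define \<phi> where "\<phi> c = (LINT z|lborel. complex_of_real (gauss z) * (exp (c * kap w z) * cinner \<Omega> (U (plane_elt z) v)))" for c
  have hol: "\<phi> holomorphic_on UNIV"
    unfolding \<phi>_def by (rule holomorphic_gauss_average[OF matrix_coeff_measurable matrix_coeff_bound])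
  \<comment> \<open>The complex line through \<open>w\<close> for the structure
    \<open>plane_J\<close>: along it the exponent is \<open>c * kap w z\<close>, so
    \<open>\<phi> c\<close> is the matrix coefficient at \<open>y c\<close> up to a Gaussian
    factor.\<close>
  define y where "y c = Re c *\<^sub>R w + Im c *\<^sub>R plane_J w" for c
  have \<phi>: "\<phi> c = complex_of_real (exp ((norm (y c))\<^sup>2 / 4)) * cinner \<Omega> (U (plane_elt (y c)) \<Omega>)" for c
  proof -
    have "complex_of_real (exp (- (norm (y c))\<^sup>2 / 4)) * \<phi> c = cinner \<Omega> (U (plane_elt (y c)) \<Omega>)"
      unfolding average_translate[OF av] \<phi>_def y_def kap_complex_structure(1) by simp
    then have "complex_of_real (exp ((norm (y c))\<^sup>2 / 4)) * (complex_of_real (exp (- (norm (y c))\<^sup>2 / 4)) * \<phi> c)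
      = complex_of_real (exp ((norm (y c))\<^sup>2 / 4)) * cinner \<Omega> (U (plane_elt (y c)) \<Omega>)" by simp
    then show ?thesis
      unfolding mult.assoc[symmetric] of_real_mult[symmetric] exp_add[symmetric] by simp
  qed
  \<comment> \<open>The map \<open>y\<close> is odd, and the adjoint of a unitary group element is
    the operator of its inverse.\<close>
  have "\<phi> c = cnj (\<phi> (- c))" for c
  proof -
    have ym: "y (- c) = - y c" by (simp add: y_def)
    have "cnj (cinner \<Omega> (U (- plane_elt (y c)) \<Omega>)) = cinner (U (- plane_elt (y c)) \<Omega>) \<Omega>"
      by (rule cinner_commute[symmetric])
    also have "\<dots> = cinner \<Omega> (U (plane_elt (y c)) \<Omega>)" by (rule repD(7)[symmetric])
    finally show ?thesis unfolding \<phi>[of c] \<phi>[of "- c"] ym by simp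
  qed
  then have "\<phi> 1 = \<phi> 0" by (rule entire_constant_of_symmetry[OF hol])
  then have "complex_of_real (exp ((norm w)\<^sup>2 / 4)) * cinner \<Omega> (U (plane_elt w) \<Omega>) = complex_of_real ((norm \<Omega>)\<^sup>2)"
    by (simp add: \<phi> y_def repD(4) cinner_self)
  then have "complex_of_real (exp (- (norm w)\<^sup>2 / 4)) * (complex_of_real (exp ((norm w)\<^sup>2 / 4)) * cinner \<Omega> (U (plane_elt w) \<Omega>))
      = complex_of_real (exp (- (norm w)\<^sup>2 / 4)) * complex_of_real ((norm \<Omega>)\<^sup>2)" by simp
  then show ?thesis
    unfolding mult.assoc[symmetric] of_real_mult[symmetric] exp_add[symmetric] by simp
qed

text \<open>If all averages of the translates of \<open>v\<close> vanish, so does the symplectic Fourier transform of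
  the integrable function \<open>gauss z * \<langle>v, U z v\<rangle>\<close>; but its value at the origin is not zero.\<close>

lemma average_nonzero:
  fixes v :: 'h
  assumes v: "v \<noteq> 0"
  obtains v' \<Omega> where "average v' \<Omega>" "\<Omega> \<noteq> 0"
proof (rule ccontr)
  assume neg: "\<not> thesis"
  have all0: "\<Omega> = 0" if "average v' \<Omega>" for v' \<Omega> using that neg \<open>\<And>v' \<Omega>. average v' \<Omega> \<Longrightarrow> \<Omega> \<noteq> 0 \<Longrightarrow> thesis\<close> by blast
  have av0: "average v' 0" for v' using average_exists[of v'] all0 by blast
  define b where "b z = cinner v (U (plane_elt z) v)" for z
  define f where "f z = complex_of_real (gauss z) * b z" for z
  have f: "integrable lborel f" unfolding f_def b_def by (rule integrable_matrix_coeff)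
  \<comment> \<open>Conjugating \<open>U (plane_elt z)\<close> by \<open>U (plane_elt w)\<close>
    multiplies it by a character of \<open>z\<close>. Pairing the average of the translate of
    \<open>v\<close> with that translate therefore computes the Fourier transform of the fixed
    function \<open>f\<close> at \<open>w\<close>.\<close>
  have conj: "cinner (U (plane_elt w) v) (U (plane_elt z) (U (plane_elt w) v))
      = exp (\<i> * complex_of_real (om z w)) * b z" for z w
  proof -
    have "omega (plane_elt w) (plane_elt z + plane_elt w) = om w z" by simp
    moreover have "om w z = - om z w" by (simp add: om_def inner_commute)
    moreover have "U (plane_elt z) (U (plane_elt w) v) = exp (\<i> * complex_of_real (om z w)) *\<^sub>C U (plane_elt w) (U (plane_elt z) v)"
      using \<open>om w z = - om z w\<close>
      by (simp add: U_mult scaleC_scaleC exp_add[symmetric] add.commute)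
    ultimately show ?thesis by (simp only: cinner_scaleC_right isoD(3) b_def)
  qed
  have zero: "(LINT z|lborel. f z * exp (\<i> * complex_of_real (om z w))) = 0" for w
  proof -
    have "0 = (LINT z|lborel. complex_of_real (gauss z) * cinner (U (plane_elt w) v) (U (plane_elt z) (U (plane_elt w) v)))"
      using av0[of "U (plane_elt w) v"] unfolding average_def by (metis cinner_zero_right)
    then show ?thesis unfolding conj by (simp add: f_def mult_ac)
  qed
  \<comment> \<open>The class \<open>S\<close> is stable under multiplication by a Gaussian in one
    linear form. Four such factors, one for each coordinate, make up the radial Gaussian of
    \<open>gauss_concentration\<close>.\<close>
  define S where "S f \<longleftrightarrow> integrable lborel f \<and>
    (\<forall>w. (LINT z|lborel. f z * exp (\<i> * complex_of_real (om z w))) = 0)" for f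
  have om_meas [measurable]: "(\<lambda>z. om z e) \<in> borel_measurable borel" for e
    unfolding om_def by (intro borel_measurable_continuous_onI continuous_intros)
  have step: "S (\<lambda>z. f z * complex_of_real (exp (- (om z e)\<^sup>2 / 2)))" if "S f" for f e
  proof -
    have f: "integrable lborel f" and z: "\<And>w. (LINT z|lborel. f z * exp (\<i> * complex_of_real (om z w))) = 0"
      using that by (auto simp: S_def)
    have [measurable]: "f \<in> borel_measurable borel" using f by auto
    have "integrable lborel (\<lambda>z. f z * complex_of_real (exp (- (om z e)\<^sup>2 / 2)))"
      by (rule Bochner_Integration.integrable_bound[OF f]) (auto simp: norm_mult intro!: AE_I2 mult_left_le)
    moreover have "(LINT z|lborel. f z * complex_of_real (exp (- (om z e)\<^sup>2 / 2)) * exp (\<i> * complex_of_real (om z w))) = 0" for w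
    proof -
      have "(LINT z|lborel. f z * exp (\<i> * complex_of_real (om z w)) * complex_of_real (exp (- (om z e)\<^sup>2 / 2))) = 0"
      proof (rule fourier_zero_gauss)
        show "integrable lborel (\<lambda>z. f z * exp (\<i> * complex_of_real (om z w)))"
          by (rule Bochner_Integration.integrable_bound[OF f]) (auto simp: norm_mult)
        fix s
        have "f z * exp (\<i> * complex_of_real (om z w)) * exp (\<i> * complex_of_real (s * om z e)) =
            f z * exp (\<i> * complex_of_real (om z (w + s *\<^sub>R e)))" for z
          by (simp add: om_def mult.assoc exp_add[symmetric] algebra_simps inner_add_right)
        then show "(LINT z|lborel. f z * exp (\<i> * complex_of_real (om z w)) * exp (\<i> * complex_of_real (s * om z e))) = 0"
          by (simp only: z)
      qed measurable
      then show ?thesis by (simp add: mult_ac)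
    qed
    ultimately show ?thesis by (simp add: S_def)
  qed
  have "S f" using f zero by (simp add: S_def)
  have "(LINT z|lborel. complex_of_real (gauss z) * b z * complex_of_real (exp (- (k\<^sup>2 * (norm z)\<^sup>2 / 2)))) = 0" for k
  proof -
    have "S (\<lambda>z. f z * complex_of_real (exp (- (om z ((k, 0), (0, 0)))\<^sup>2 / 2)) * complex_of_real (exp (- (om z ((0, k), (0, 0)))\<^sup>2 / 2))
        * complex_of_real (exp (- (om z ((0, 0), (k, 0)))\<^sup>2 / 2)) * complex_of_real (exp (- (om z ((0, 0), (0, k)))\<^sup>2 / 2)))"
      by (intro step \<open>S f\<close>)
    moreover have "exp (- (om z ((k, 0), (0, 0)))\<^sup>2 / 2) * exp (- (om z ((0, k), (0, 0)))\<^sup>2 / 2)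
        * exp (- (om z ((0, 0), (k, 0)))\<^sup>2 / 2) * exp (- (om z ((0, 0), (0, k)))\<^sup>2 / 2) = exp (- (k\<^sup>2 * (norm z)\<^sup>2 / 2))" for z
      unfolding exp_add[symmetric]
      by (intro arg_cong[of _ _ exp]) (simp add: om_def inner_prod_def norm_plane_square power_mult_distrib field_simps)
    ultimately have "S (\<lambda>z. f z * complex_of_real (exp (- (k\<^sup>2 * (norm z)\<^sup>2 / 2))))"
      by (simp only: mult.assoc of_real_mult[symmetric])
    then have "(LINT z|lborel. f z * complex_of_real (exp (- (k\<^sup>2 * (norm z)\<^sup>2 / 2))) * exp (\<i> * complex_of_real (om z 0))) = 0"
      unfolding S_def by blast
    then show ?thesis by (simp add: f_def om_def)
  qed
  moreover have "\<exists>k. (LINT z|lborel. complex_of_real (gauss z) * b z * complex_of_real (exp (- (k\<^sup>2 * (norm z)\<^sup>2 / 2)))) \<noteq> 0"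
  proof (rule gauss_concentration)
    show "continuous_on UNIV b" unfolding b_def by (rule continuous_matrix_coeff)
    show "cmod (b z) \<le> (norm v)\<^sup>2" for z
      using matrix_coeff_bound[of v "plane_elt z" v] by (simp add: b_def power2_eq_square)
    show "b 0 = complex_of_real ((norm v)\<^sup>2)" by (simp add: b_def repD(4) cinner_self)
    show "(norm v)\<^sup>2 > 0" using v by simp
  qed
  ultimately show False by blast
qed

end

section \<open>Uniqueness\<close>

text \<open>On a smooth vector the product of \<open>exp (- \<i> * complex_of_real t)\<close> with
  the orbit along the centre has zero derivative in \<open>t\<close> and so stays at
  \<open>v\<close>. Both sides of the claim are continuous in \<open>v\<close>, and smooth vectors
  are dense.\<close>

lemma central_heis_repI:
  assumes U: "heis_unitary_rep U" and dense: "closure (smooth_vectors U) = UNIV"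
    and Z: "\<And>v. v \<in> smooth_vectors U \<Longrightarrow> heis_differential U heis_Z v = \<i> *\<^sub>C v"
  shows "central_heis_rep U"
proof (rule central_heis_rep.intro[OF U])
  fix t and v :: 'a
  note repD = heis_unitary_repD[OF U]
  note isoD = isometricD[OF repD(1)]
  have sm: "U (t *\<^sub>R heis_Z) v = exp (\<i> * complex_of_real t) *\<^sub>C v" if v: "v \<in> smooth_vectors U" for v t
  proof -
    have u: "((\<lambda>s. U (s *\<^sub>R heis_Z) v) has_vector_derivative U (t *\<^sub>R heis_Z) (\<i> *\<^sub>C v)) (at t)" for t
    proof -
      have "((\<lambda>s. U (s *\<^sub>R heis_Z) v) has_vector_derivative \<i> *\<^sub>C v) (at 0)"
        using heis_differential_eq[where U = U and v = v, OF smooth_vectorsD(2)[OF v], of heis_Z] Z[OF v] by simp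
      then have "((\<lambda>s. U (s *\<^sub>R heis_Z) v) has_derivative (\<lambda>s. s *\<^sub>R (\<i> *\<^sub>C v))) (at (t - t))"
        by (simp add: has_vector_derivative_def)
      moreover have "((\<lambda>s. s - t) has_derivative (\<lambda>s. s)) (at t)"
        by (auto intro!: derivative_eq_intros)
      ultimately have "((\<lambda>s. U (s *\<^sub>R heis_Z) v) \<circ> (\<lambda>s. s - t) has_derivative (\<lambda>s. s *\<^sub>R (\<i> *\<^sub>C v)) \<circ> (\<lambda>s. s)) (at t)"
        by (rule diff_chain_at[rotated])
      from bounded_linear.has_derivative[OF isoD(7)[of "t *\<^sub>R heis_Z"] this]
      have "((\<lambda>s. U (t *\<^sub>R heis_Z) (U ((s - t) *\<^sub>R heis_Z) v)) has_derivative
          (\<lambda>s. s *\<^sub>R U (t *\<^sub>R heis_Z) (\<i> *\<^sub>C v))) (at t)"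
        by (simp add: o_def linear_scale[OF bounded_linear.linear[OF isoD(7)]])
      moreover have "heis_mult (t *\<^sub>R heis_Z) ((s - t) *\<^sub>R heis_Z) = s *\<^sub>R heis_Z" for s
        by (simp add: heis_mult_eq algebra_simps)
      ultimately show ?thesis
        by (simp add: has_vector_derivative_def repD(2)[symmetric])
    qed
    have e: "((\<lambda>s. exp (- \<i> * complex_of_real s)) has_vector_derivative (- \<i> * exp (- \<i> * complex_of_real t))) (at t)" for t
      by (rule has_vector_derivative_real_field[of "\<lambda>z. exp (- \<i> * z)"]) (auto intro!: derivative_eq_intros)
    have "((\<lambda>s. exp (- \<i> * complex_of_real s) *\<^sub>C U (s *\<^sub>R heis_Z) v) has_derivative (\<lambda>h. 0)) (at t within UNIV)" for t
      using bounded_bilinear.has_vector_derivative[OF bounded_bilinear_scaleC e u]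
      by (simp add: has_vector_derivative_def isoD(2) scaleC_scaleC scaleC_minus_left mult.commute)
    then have "\<exists>c. \<forall>t\<in>UNIV. exp (- \<i> * complex_of_real t) *\<^sub>C U (t *\<^sub>R heis_Z) v = c"
      by (intro has_derivative_zero_constant) auto
    then obtain c where c: "\<And>t. exp (- \<i> * complex_of_real t) *\<^sub>C U (t *\<^sub>R heis_Z) v = c" by blast
    have "c = v" using c[of 0] by (simp add: repD(4))
    then have "exp (\<i> * complex_of_real t) *\<^sub>C (exp (- \<i> * complex_of_real t) *\<^sub>C U (t *\<^sub>R heis_Z) v)
        = exp (\<i> * complex_of_real t) *\<^sub>C v" using c by simp
    then show ?thesis unfolding scaleC_scaleC exp_add[symmetric] by simp
  qed
  have "closed {v. U (t *\<^sub>R heis_Z) v = exp (\<i> * complex_of_real t) *\<^sub>C v}"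
    by (rule closed_Collect_eq[OF linear_continuous_on[OF isoD(7)]])
      (intro continuous_on_scaleC continuous_on_const continuous_on_id)
  then have "closure (smooth_vectors U) \<subseteq> {v. U (t *\<^sub>R heis_Z) v = exp (\<i> * complex_of_real t) *\<^sub>C v}"
    using sm by (intro closure_minimal) auto
  then show "U (t *\<^sub>R heis_Z) v = exp (\<i> * complex_of_real t) *\<^sub>C v" using dense by auto
qed

lemma hip_disp_self: "hip (disp g) (disp g) = complex_of_real ((norm (fst g, fst (snd g)))\<^sup>2 / 2)"
  by (simp add: hip_def disp_def complex_eq_iff norm_plane_square power_divide)
    (simp add: power2_eq_square field_simps)

lemma disp_surj: "\<exists>g. disp g = w"
proof -
  have "disp ((- sqrt 2 * Re (fst w), - sqrt 2 * Re (snd w)), (sqrt 2 * Im (fst w), sqrt 2 * Im (snd w)), 0) = w"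
    by (simp add: disp_def prod_eq_iff complex_eq_iff)
  then show ?thesis by blast
qed

lemma total_weyl_vacuum: "total (range (\<lambda>g. weyl g (coh 0)))"
proof (rule totalI)
  fix v assume z: "\<And>a. a \<in> range (\<lambda>g. weyl g (coh 0)) \<Longrightarrow> cinner a v = 0"
  have "cinner (coh w) v = 0" for w
  proof -
    obtain g where "disp g = w" using disp_surj by blast
    moreover have "cinner (weyl g (coh 0)) v = 0" using z by blast
    ultimately show ?thesis by (simp add: weyl_props cinner_scaleC_left weyl_phase_def)
  qed
  then have "cinner a v = 0" if "a \<in> range coh" for a using that by auto
  then show "v = 0" by (rule total_orthogonal_zero[OF total_coh])
qed

text \<open>The Gaussian found for the normalised average in \<open>average_gaussian_state\<close>;
  equality of these two matrix coefficients is what allows the orbits to be compared.\<close>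

lemma weyl_vacuum_state:
  "cinner (coh 0) (weyl g (coh 0)) = exp (\<i> * complex_of_real (snd (snd g))) *
    complex_of_real (exp (- (norm (fst g, fst (snd g)))\<^sup>2 / 4))"
proof -
  have "cinner (coh 0) (weyl g (coh 0)) = weyl_phase g 0"
    by (simp add: weyl_props cinner_scaleC_right cinner_coh)
  also have "\<dots> = exp (\<i> * complex_of_real (snd (snd g)) +
      complex_of_real (- (norm (fst g, fst (snd g)))\<^sup>2 / 4))"
    unfolding weyl_phase_def hip_disp_self by (intro arg_cong[of _ _ exp]) simp
  finally show ?thesis unfolding exp_add exp_of_real .
qed

text \<open>The Gram matrix of an orbit depends only on the matrix coefficient of its vector, as
  \<open>shift\<close> shows, and that coefficient is the vacuum one once the averaged vector is
  normalised. The isometry so obtained maps orbit to orbit, hence it intertwines on a total set and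
  everywhere.\<close>

lemma (in central_heis_rep) fock_embedding:
  assumes "v \<noteq> (0 :: 'h)"
  obtains J :: "(nat \<times> nat) ell2 \<Rightarrow> 'h" where "isometric J" "\<And>g u. J (weyl g u) = U g (J u)"
proof -
  obtain v' \<Omega>' where av: "average v' \<Omega>'" "\<Omega>' \<noteq> 0" using average_nonzero[OF assms] by blast
  define \<Omega> where "\<Omega> = complex_of_real (1 / norm \<Omega>') *\<^sub>C \<Omega>'"
  have state: "cinner \<Omega> (U g \<Omega>) = cinner (coh 0) (weyl g (coh 0))" for g
  proof -
    have "cinner \<Omega>' (U g \<Omega>') = exp (\<i> * complex_of_real (snd (snd g))) *
        complex_of_real (exp (- (norm (fst g, fst (snd g)))\<^sup>2 / 4) * (norm \<Omega>')\<^sup>2)"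
      by (simp only: U_heis[of g] cinner_scaleC_right average_gaussian_state[OF av(1)])
    then show ?thesis
      using av(2) unfolding weyl_vacuum_state \<Omega>_def
      by (simp add: isoD(2) cinner_simps power2_eq_square)
  qed
  have shift: "cinner (W g u) (W h u) = cinner u (W (heis_mult (- g) h) u)"
    if "heis_unitary_rep W" for W :: "heis \<Rightarrow> 'b::complex_hilbert \<Rightarrow> 'b" and g h u
    using heis_unitary_repD(7)[OF that, of u "- g" "W h u"] heis_unitary_repD(2)[OF that] by simp
  have "cinner (weyl g (coh 0)) (weyl h (coh 0)) = cinner (U g \<Omega>) (U h \<Omega>)" for g h
    by (simp only: shift[OF heis_unitary_rep_weyl] shift[OF rep] state)
  then obtain J where J: "isometric J" "\<And>g. J (weyl g (coh 0)) = U g \<Omega>"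
    using isometry_of_Gram[OF total_weyl_vacuum, of "\<lambda>g. U g \<Omega>"] by blast
  have "J \<circ> weyl k = U k \<circ> J" for k
  proof (rule total_linear_eq[OF total_weyl_vacuum])
    note i = isometricD[OF isometric_comp[OF J(1) weyl_props(1)]] isometricD[OF isometric_comp[OF repD(1) J(1)]]
    show "bounded_linear (J \<circ> weyl k)" "bounded_linear (U k \<circ> J)" by (rule i)+
    show "(J \<circ> weyl k) (c *\<^sub>C u) = c *\<^sub>C (J \<circ> weyl k) u" "(U k \<circ> J) (c *\<^sub>C u) = c *\<^sub>C (U k \<circ> J) u" for c u
      by (rule i)+
    fix a assume "a \<in> range (\<lambda>g. weyl g (coh 0))"
    then obtain g where "a = weyl g (coh 0)" by blast
    then show "(J \<circ> weyl k) a = (U k \<circ> J) a"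
      by (simp add: J(2) weyl_rep(2)[symmetric] repD(2)[symmetric])
  qed
  then have "J (weyl g u) = U g (J u)" for g u by (metis comp_apply)
  with J(1) show thesis by (rule that)
qed

text \<open>\<open>K\<close> is invariant under the inverses \<open>U (- g)\<close> too, so its
  orthogonal complement is invariant and the projection commutes with the group. Uniqueness of the
  decomposition, stated as \<open>uniq\<close>, yields all properties of \<open>P\<close>.\<close>

lemma invariant_projection:
  fixes K :: "'a::complex_hilbert set"
  assumes K: "complex_subspace K" "closed K" and U: "heis_unitary_rep U"
    and inv: "\<And>g k. k \<in> K \<Longrightarrow> U g k \<in> K"
  obtains P where "bounded_linear P" "\<And>v. P v \<in> K" "\<And>v m. m \<in> K \<Longrightarrow> cinner m (v - P v) = 0"
    "\<And>g v. P (U g v) = U g (P v)" "\<And>v. v \<in> K \<Longrightarrow> P v = v" "\<And>v. (\<And>m. m \<in> K \<Longrightarrow> cinner m v = 0) \<Longrightarrow> P v = 0"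
proof -
  note S = complex_subspaceD[OF K(1)]
  note repD = heis_unitary_repD[OF U]
  note isoD = isometricD[OF repD(1)]
  have "\<forall>v. \<exists>k. k \<in> K \<and> (\<forall>m\<in>K. cinner m (v - k) = 0)"
    using orthogonal_decomposition[OF K] by blast
  then obtain P where "\<forall>v. P v \<in> K \<and> (\<forall>m\<in>K. cinner m (v - P v) = 0)" by metis
  then have P: "\<And>v. P v \<in> K" "\<And>v m. m \<in> K \<Longrightarrow> cinner m (v - P v) = 0" by blast+
  have uniq: "P v = k" if k: "k \<in> K" and o: "\<And>m. m \<in> K \<Longrightarrow> cinner m (v - k) = 0" for v k
  proof -
    have m: "P v - k \<in> K" using P(1) k S(4) by blast
    have "cinner (P v - k) (v - k) - cinner (P v - k) (v - P v) = 0" using o[OF m] P(2)[OF m] by simp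
    then have "cinner (P v - k) (P v - k) = 0" by (simp add: cinner_simps algebra_simps)
    then show ?thesis by simp
  qed
  have "bounded_linear P"
  proof (rule bounded_linear_intro[of _ 1])
    show "P (u + v) = P u + P v" for u v
    proof (rule uniq)
      show "P u + P v \<in> K" using P(1) S(2) by blast
      show "cinner m (u + v - (P u + P v)) = 0" if "m \<in> K" for m
        using P(2)[OF that, of u] P(2)[OF that, of v] by (simp add: cinner_simps)
    qed
    show "P (r *\<^sub>R v) = r *\<^sub>R P v" for r v
    proof (rule uniq)
      show "r *\<^sub>R P v \<in> K" using P(1) S(5) by blast
      show "cinner m (r *\<^sub>R v - r *\<^sub>R P v) = 0" if "m \<in> K" for m
        using P(2)[OF that, of v] by (simp add: cinner_simps cinner_scaleR_right)
    qed
    show "norm (P v) \<le> norm v * 1" for v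
    proof -
      have "(norm v)\<^sup>2 = (norm (P v))\<^sup>2 + (norm (v - P v))\<^sup>2"
        using norm_add_square[of "P v" "v - P v"] P(2)[OF P(1)[of v], of v] by simp
      then have "(norm (P v))\<^sup>2 \<le> (norm v)\<^sup>2" by simp
      then have "norm (P v) \<le> norm v" by (rule power2_le_imp_le) simp
      then show ?thesis by simp
    qed
  qed
  moreover have "P (U g v) = U g (P v)" for g v
  proof (rule uniq)
    show "U g (P v) \<in> K" using inv P(1) by blast
    show "cinner m (U g v - U g (P v)) = 0" if "m \<in> K" for m
      using P(2)[OF inv[OF that, of "- g"], of v] by (simp add: repD(7) flip: isoD(6))
  qed
  moreover have "P v = v" if "v \<in> K" for v by (rule uniq[OF that]) simp
  moreover have "P v = 0" if "\<And>m. m \<in> K \<Longrightarrow> cinner m v = 0" for v by (rule uniq[OF S(1)]) (simp add: that)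
  ultimately show thesis using P that[of P] by blast
qed

section \<open>Recovering the algebra from the differential of the group\<close>

lemma star_rep_term:
  assumes "star_rep (A2 x) D \<pi>" and "v \<in> D"
  shows "\<pi> (term_class (A2_relations x) s) v \<in> D"
    "\<pi> (term_class (A2_relations x) One) v = v"
    "\<pi> (term_class (A2_relations x) (Add s t)) v = \<pi> (term_class (A2_relations x) s) v + \<pi> (term_class (A2_relations x) t) v"
    "\<pi> (term_class (A2_relations x) (Mult s t)) v = \<pi> (term_class (A2_relations x) s) (\<pi> (term_class (A2_relations x) t) v)"
    "\<pi> (term_class (A2_relations x) (Scale c s)) v = c *\<^sub>C \<pi> (term_class (A2_relations x) s) v"
  using assms unfolding star_rep_def A2_def
  by (auto simp: presented_star_algebra_simps)

lemma free_star_zero_one: "free_star 0 = (0 :: 'g free_star_algebra)" "free_star 1 = (1 :: 'g free_star_algebra)"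
proof -
  show "free_star 0 = (0 :: 'g free_star_algebra)" using free_scale_simps(8)[of 0 "0 :: 'g free_star_algebra"] by simp
  have "free_star (free_star 1 * 1) = free_star 1 * (1 :: 'g free_star_algebra)"
    by (simp only: free_scale_simps(7,9))
  then show "free_star 1 = (1 :: 'g free_star_algebra)" by (simp add: free_scale_simps(7))
qed

text \<open>Stars can be pushed to the generators, so that a property of operators that is stable under
  linear combinations and products needs to be checked on the generators and their stars only.\<close>

lemma sterm_generated:
  assumes gen: "\<And>g. C (Gen g)" "\<And>g. C (Gen_star g)" and one: "C One"
    and add: "\<And>s t. C s \<Longrightarrow> C t \<Longrightarrow> C (Add s t)" and mult: "\<And>s t. C s \<Longrightarrow> C t \<Longrightarrow> C (Mult s t)"
    and scale: "\<And>c s. C s \<Longrightarrow> C (Scale c s)"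
    and cong: "\<And>s t. star_cong R s t \<Longrightarrow> C s \<Longrightarrow> C t"
  shows "C s"
proof -
  have c: "C t" if "C s" "abs_free_star_algebra s = abs_free_star_algebra t" for s t
    using cong[OF star_cong_freeI[OF that(2)]] that(1) by blast
  \<comment> \<open>The zero term is congruent to \<open>Scale 0 One\<close>.\<close>
  have zero: "C Zero"
    by (rule c[OF scale[OF one, of 0]]) (simp add: abs_free_simps free_scale_minus)
  \<comment> \<open>The claim is doubled because the case \<open>Star\<close> exchanges the two
    halves, up to a double star.\<close>
  have "C s \<and> C (Star s)"
  proof (induction s)
    case Zero
    then show ?case using zero c[OF zero, of "Star Zero"] by (simp add: abs_free_simps free_star_zero_one)
  next
    case One
    then show ?case using one c[OF one, of "Star One"] by (simp add: abs_free_simps free_star_zero_one)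
  next
    case (Add s t)
    then show ?case using add cong[OF star_cong.sym[OF star_cong.star_add]] by blast
  next
    case (Mult s t)
    then show ?case using mult cong[OF star_cong.sym[OF star_cong.star_mult]] by blast
  next
    case (Scale c s)
    then show ?case using scale cong[OF star_cong.sym[OF star_cong.star_scale]] by blast
  next
    case (Star s)
    then show ?case using cong[OF star_cong.sym[OF star_cong.star_star]] by blast
  qed (use gen in blast)
  then show ?thesis ..
qed

fun heis_P :: "two \<Rightarrow> heis" where
  "heis_P G1 = ((1, 0), (0, 0), 0)" | "heis_P G2 = ((0, 1), (0, 0), 0)"

fun heis_Q :: "two \<Rightarrow> heis" where
  "heis_Q G1 = ((0, 0), (1, 0), 0)" | "heis_Q G2 = ((0, 0), (0, 1), 0)"

text \<open>Over the complex numbers the momentum and position directions determine the generators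
  and their adjoints. Combined with \<open>sterm_generated\<close>, this carries statements about
  the differential to the whole algebra.\<close>

lemma generators_from_differential:
  assumes sr: "star_rep (A2 0) D \<pi>" and v: "v \<in> D"
  shows "\<pi> (term_class (A2_relations 0) (Gen g)) v = complex_of_real (1 / sqrt 2) *\<^sub>C
      ((- 1) *\<^sub>C \<pi> (heis_to_CCR (heis_P g)) v + (- \<i>) *\<^sub>C \<pi> (heis_to_CCR (heis_Q g)) v)"
    "\<pi> (term_class (A2_relations 0) (Gen_star g)) v = complex_of_real (1 / sqrt 2) *\<^sub>C
      (1 *\<^sub>C \<pi> (heis_to_CCR (heis_P g)) v + (- \<i>) *\<^sub>C \<pi> (heis_to_CCR (heis_Q g)) v)"
    "\<pi> (heis_to_CCR heis_Z) v = \<i> *\<^sub>C v"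
proof -
  define A B where "A = \<pi> (term_class (A2_relations 0) (Gen g)) v"
    and "B = \<pi> (term_class (A2_relations 0) (Gen_star g)) v"
  note ev = star_rep_term[OF sr v]
  have P: "\<pi> (heis_to_CCR (heis_P g)) v = complex_of_real (1 / sqrt 2) *\<^sub>C (B - A)"
    by (cases g) (simp_all add: heis_to_CCR_def ev A_def B_def scaleC_minus_left scaleC_diff_right)
  have Q: "\<pi> (heis_to_CCR (heis_Q g)) v = (\<i> * complex_of_real (1 / sqrt 2)) *\<^sub>C (B + A)"
    by (cases g) (simp_all add: heis_to_CCR_def ev A_def B_def)
  have r: "complex_of_real (1 / sqrt 2) * complex_of_real (1 / sqrt 2) = 1 / 2"
    by (subst of_real_mult[symmetric]) simp
  have half: "(1 / 2 :: complex) *\<^sub>C u + (1 / 2) *\<^sub>C u = u" for u :: 'a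
    by (simp flip: scaleC_add_left)
  define c where "c = complex_of_real (1 / sqrt 2)"
  have cc: "c *\<^sub>C (c *\<^sub>C (u + u)) = u" for u :: 'a
    unfolding scaleC_scaleC scaleC_add_right using r half by (simp only: c_def)
  have ic: "(- \<i>) *\<^sub>C ((\<i> * c) *\<^sub>C u) = c *\<^sub>C u" for u :: 'a
    by (simp add: scaleC_scaleC)
  have "A = c *\<^sub>C ((- 1) *\<^sub>C (c *\<^sub>C (B - A)) + (- \<i>) *\<^sub>C ((\<i> * c) *\<^sub>C (B + A)))"
  proof -
    have "(- 1) *\<^sub>C (c *\<^sub>C (B - A)) + c *\<^sub>C (B + A) = c *\<^sub>C ((B + A) - (B - A))"
      unfolding scaleC_minus_one scaleC_diff_right[of c "B + A"] by simp
    also have "(B + A) - (B - A) = A + A" by simp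
    finally show ?thesis unfolding ic by (simp only: cc)
  qed
  then show "A = complex_of_real (1 / sqrt 2) *\<^sub>C
      ((- 1) *\<^sub>C \<pi> (heis_to_CCR (heis_P g)) v + (- \<i>) *\<^sub>C \<pi> (heis_to_CCR (heis_Q g)) v)"
    unfolding P Q c_def[symmetric] .
  have "B = c *\<^sub>C (1 *\<^sub>C (c *\<^sub>C (B - A)) + (- \<i>) *\<^sub>C ((\<i> * c) *\<^sub>C (B + A)))"
  proof -
    have "1 *\<^sub>C (c *\<^sub>C (B - A)) + c *\<^sub>C (B + A) = c *\<^sub>C ((B - A) + (B + A))"
      unfolding scaleC_add_right[of c "B - A"] by simp
    also have "(B - A) + (B + A) = B + B" by simp
    finally show ?thesis unfolding ic by (simp only: cc)
  qed
  then show "B = complex_of_real (1 / sqrt 2) *\<^sub>C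
      (1 *\<^sub>C \<pi> (heis_to_CCR (heis_P g)) v + (- \<i>) *\<^sub>C \<pi> (heis_to_CCR (heis_Q g)) v)"
    unfolding P Q c_def[symmetric] .
  show "\<pi> (heis_to_CCR heis_Z) v = \<i> *\<^sub>C v"
    by (simp add: heis_to_CCR_def heis_Z_def ev)
qed

text \<open>The isomorphism in \<open>well_behaved_rep\<close> is only asserted to exist; its values
  on the generators pin it down as the substitution isomorphism of \<open>A2_iso\<close>.\<close>

lemma iso_on_terms:
  assumes iso: "star_algebra_iso (A2 x) (A2 0) \<Phi>" and g1: "\<Phi> (A2_gen x G1) = A2_gen 0 G1"
    and g2: "\<Phi> (A2_gen x G2) = complex_of_real (sqrt (1 + (cmod x)\<^sup>2)) \<odot>\<^bsub>A2 0\<^esub> A2_gen 0 G2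
       \<oplus>\<^bsub>A2 0\<^esub> x \<odot>\<^bsub>A2 0\<^esub> star (A2 0) (A2_gen 0 G1)"
  shows "\<Phi> (term_class (A2_relations x) s) =
    term_class (A2_relations 0) (subst (bogoliubov (complex_of_real (sqrt (1 + (cmod x)\<^sup>2))) x) s)"
proof -
  have op: "\<Phi> (term_class (A2_relations x) (Add s t)) = \<Phi> (term_class (A2_relations x) s) \<oplus>\<^bsub>A2 0\<^esub> \<Phi> (term_class (A2_relations x) t)"
    "\<Phi> (term_class (A2_relations x) (Mult s t)) = \<Phi> (term_class (A2_relations x) s) \<otimes>\<^bsub>A2 0\<^esub> \<Phi> (term_class (A2_relations x) t)"
    "\<Phi> (term_class (A2_relations x) (Scale c s)) = c \<odot>\<^bsub>A2 0\<^esub> \<Phi> (term_class (A2_relations x) s)"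
    "\<Phi> (term_class (A2_relations x) (Star s)) = star (A2 0) (\<Phi> (term_class (A2_relations x) s))"
    "\<Phi> (term_class (A2_relations x) One) = term_class (A2_relations 0) One" for s t c
  proof -
    have c: "term_class (A2_relations x) s \<in> carrier (A2 x)" for s
      by (simp add: A2_def presented_star_algebra_simps)
    note S = presented_star_algebra_simps(2,4-7)[of "A2_relations x", folded A2_def]
    note I = iso[unfolded star_algebra_iso_def]
    show "\<Phi> (term_class (A2_relations x) (Add s t)) = \<Phi> (term_class (A2_relations x) s) \<oplus>\<^bsub>A2 0\<^esub> \<Phi> (term_class (A2_relations x) t)"
      using I c unfolding S(3)[symmetric] by blast
    show "\<Phi> (term_class (A2_relations x) (Mult s t)) = \<Phi> (term_class (A2_relations x) s) \<otimes>\<^bsub>A2 0\<^esub> \<Phi> (term_class (A2_relations x) t)"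
      using I c unfolding S(2)[symmetric] by blast
    show "\<Phi> (term_class (A2_relations x) (Scale c s)) = c \<odot>\<^bsub>A2 0\<^esub> \<Phi> (term_class (A2_relations x) s)"
      using I c unfolding S(4)[symmetric] by blast
    show "\<Phi> (term_class (A2_relations x) (Star s)) = star (A2 0) (\<Phi> (term_class (A2_relations x) s))"
      using I c unfolding S(5)[symmetric] by blast
    have "\<Phi> (term_class (A2_relations x) One) = \<one>\<^bsub>A2 0\<^esub>"
      using I unfolding S(1)[symmetric] by blast
    then show "\<Phi> (term_class (A2_relations x) One) = term_class (A2_relations 0) One"
      by (simp add: A2_def presented_star_algebra_simps)
  qed
  \<comment> \<open>\<open>star_algebra_iso\<close> has no clause for the zero element; written as 0
    times the unit, it falls under the clause for scalars.\<close>
  have z: "term_class R Zero = term_class R (Scale 0 One)" for R :: "(two sterm \<times> two sterm) set"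
    unfolding term_class_eq_iff by (rule star_cong_freeI) (simp add: abs_free_simps free_scale_minus)
  show ?thesis
  proof (induction s)
    case (Gen g)
    show ?case
      using g1 g2 by (cases g) (simp_all add: A2_gen_def A2_def presented_star_algebra_simps)
  next
    case Zero
    then show ?case by (simp add: z op) (simp add: A2_def presented_star_algebra_simps)
  qed (simp_all add: op, simp_all add: A2_def presented_star_algebra_simps)
qed

lemma unitarily_equivalent_fock:
  fixes D :: "'h::complex_hilbert set"
  assumes sr: "star_rep (A2 x) D \<rho>" and irr: "irreducible_rep (A2 x) D \<rho>" and wb: "well_behaved_rep x D \<rho>"
  shows "unitarily_equivalent (A2 x) D \<rho> rapidly_decreasing (fock_rep x)"
proof -
  obtain \<Phi> where iso: "star_algebra_iso (A2 x) (A2 0) \<Phi>" and g1: "\<Phi> (A2_gen x G1) = A2_gen 0 G1"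
    and g2: "\<Phi> (A2_gen x G2) = complex_of_real (sqrt (1 + (cmod x)\<^sup>2)) \<odot>\<^bsub>A2 0\<^esub> A2_gen 0 G2
       \<oplus>\<^bsub>A2 0\<^esub> x \<odot>\<^bsub>A2 0\<^esub> star (A2 0) (A2_gen 0 G1)"
    and int: "integrable_rep D (\<lambda>u. \<rho> (inv_into (carrier (A2 x)) \<Phi> u))"
    using wb unfolding well_behaved_rep_def by blast
  define \<rho>0 where "\<rho>0 = (\<lambda>u. \<rho> (inv_into (carrier (A2 x)) \<Phi> u))"
  obtain U where sr0: "star_rep (A2 0) D \<rho>0" and U: "heis_unitary_rep U" and D: "D = smooth_vectors U"
    and diff: "\<And>X v. v \<in> D \<Longrightarrow> \<rho>0 (heis_to_CCR X) v = heis_differential U X v"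
    using int unfolding integrable_rep_def \<rho>0_def by blast
  define R where "R s = \<rho>0 (term_class (A2_relations 0) s)" for s
  have Rcong: "R s = R t" if "star_cong (A2_relations 0) s t" for s t
    using that unfolding R_def term_class_eq_iff[symmetric] by (rule arg_cong)
  have bij: "bij_betw \<Phi> (carrier (A2 x)) (carrier (A2 0))" using iso by (simp add: star_algebra_iso_def)
  have \<rho>R: "\<exists>s. \<Phi> u = term_class (A2_relations 0) s \<and> \<rho> u = R s" if "u \<in> carrier (A2 x)" for u
  proof -
    have "\<Phi> u \<in> carrier (A2 0)" using bij that by (rule bij_betw_apply)
    then obtain s where s: "\<Phi> u = term_class (A2_relations 0) s" by (auto simp: A2_def presented_star_algebra_simps)
    have "\<rho> u = \<rho>0 (\<Phi> u)" by (simp add: \<rho>0_def bij_betw_inv_into_left[OF bij that])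
    then show ?thesis using s by (auto simp: R_def)
  qed
  have dense: "closure D = UNIV" and subD: "complex_subspace D" using sr by (auto simp: star_rep_def)
  note Dsub = complex_subspaceD[OF subD]
  note repD = heis_unitary_repD[OF U]
  note isoD = isometricD[OF repD(1)]
  have "central_heis_rep U"
  proof (rule central_heis_repI[OF U])
    show "closure (smooth_vectors U) = UNIV" using dense D by simp
    show "heis_differential U heis_Z v = \<i> *\<^sub>C v" if "v \<in> smooth_vectors U" for v
      using generators_from_differential(3)[OF sr0] diff that D by simp
  qed
  then interpret central_heis_rep U .
  obtain v0 where "v0 \<in> D" "v0 \<noteq> 0" using irr Dsub(1) unfolding irreducible_rep_def by blast
  obtain J :: "(nat \<times> nat) ell2 \<Rightarrow> 'h" where J: "isometric J" and JU: "\<And>g u. J (weyl g u) = U g (J u)"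
    using fock_embedding[OF \<open>v0 \<noteq> 0\<close>] by blast
  note JD = isometricD[OF J]
  define K where "K = range J"
  have K: "complex_subspace K" "closed K" unfolding K_def using closed_range_isometric[OF J] by auto
  have invK: "U g k \<in> K" if "k \<in> K" for g k
    using that unfolding K_def by (auto simp flip: JU)
  obtain P where Pbl: "bounded_linear P" and PK: "\<And>v. P v \<in> K" and Po: "\<And>v m. m \<in> K \<Longrightarrow> cinner m (v - P v) = 0"
    and PU: "\<And>g v. P (U g v) = U g (P v)" and Pid: "\<And>v. v \<in> K \<Longrightarrow> P v = v"
    and P0: "\<And>v. (\<And>m. m \<in> K \<Longrightarrow> cinner m v = 0) \<Longrightarrow> P v = 0"
    using invariant_projection[OF K U invK] by blast
  \<comment> \<open>\<open>P\<close> is bounded and commutes with the group, so the orbit map of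
    \<open>P v\<close> is the image under \<open>P\<close> of a smooth map.\<close>
  have PD: "P v \<in> D" if "v \<in> D" for v
  proof -
    have "C_k k (\<lambda>g. P (U g v))" for k
      using that unfolding D by (intro C_k_bounded_linear[OF Pbl] smooth_vectorsD(1))
    then show ?thesis unfolding D smooth_vectors_def by (simp add: PU)
  qed
  have dvd: "((\<lambda>s. U (s *\<^sub>R X) v) has_vector_derivative heis_differential U X v) (at 0)" if "v \<in> D" for X v
    using that heis_differential_eq(1,2)[where U = U and v = v and X = X
        and D = "frechet_derivative (\<lambda>g. U g v) (at 0)"] smooth_vectorsD(2)[of v U 0]
    unfolding D by simp
  have dD: "heis_differential U X v \<in> D" if "v \<in> D" for X v
    using smooth_vectors_differential[OF U] that D by blast
  have Pd: "((\<lambda>s. U (s *\<^sub>R X) (P v)) has_vector_derivative P (heis_differential U X v)) (at 0)" if "v \<in> D" for X v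
    using bounded_linear.has_vector_derivative[OF Pbl dvd[OF that]] by (simp add: PU)
  \<comment> \<open>Within \<open>D\<close>, stability under the differential gives stability under
    the generators and their adjoints, and hence under every term.\<close>
  have R_inv: "R s v \<in> E" if E: "complex_subspace E" "E \<subseteq> D"
      and dE: "\<And>X v. v \<in> E \<Longrightarrow> heis_differential U X v \<in> E" and v: "v \<in> E" for E s v
  proof -
    note S = complex_subspaceD[OF E(1)]
    have lin: "\<rho>0 (heis_to_CCR X) v \<in> E" if "v \<in> E" for X v
      using diff[of v X] dE[OF that, of X] that E(2) by auto
    have "\<forall>v\<in>E. R s v \<in> E"
    proof (rule sterm_generated[where R = "A2_relations 0"])
      have "R (Gen g) v \<in> E \<and> R (Gen_star g) v \<in> E" if v: "v \<in> E" for g v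
      proof -
        have "v \<in> D" using v E(2) by blast
        note g = generators_from_differential(1,2)[OF sr0 this, of g]
        show ?thesis unfolding R_def g by (intro conjI S(2,3) lin v)
      qed
      then show "\<forall>v\<in>E. R (Gen g) v \<in> E" "\<forall>v\<in>E. R (Gen_star g) v \<in> E" for g by blast+
      show "\<forall>v\<in>E. R t v \<in> E" if "star_cong (A2_relations 0) s t" "\<forall>v\<in>E. R s v \<in> E" for s t
        using that Rcong by metis
    qed (use E(2) in \<open>auto simp: R_def star_rep_term[OF sr0] subset_iff intro: S(2,3)\<close>)
    then show ?thesis using v by blast
  qed
  \<comment> \<open>The projection splits the domain itself, as irreducibility demands.
    \<open>E1\<close> contains the image of the vacuum, so \<open>E2\<close> vanishes; then
    \<open>D\<close>, and by density the whole space, lies in the range of \<open>J\<close>.\<close>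
  define E1 E2 where "E1 = {v \<in> D. P v = v}" and "E2 = {v \<in> D. P v = 0}"
  have Plin: "P (u + v) = P u + P v" "P (c *\<^sub>C v) = c *\<^sub>C P v" "P 0 = 0" for u v c
  proof -
    show "P (u + v) = P u + P v" "P 0 = 0" using Pbl by (simp_all add: linear_simps)
    have "P (c *\<^sub>C (v - P v)) = 0" by (rule P0) (simp add: cinner_scaleC_right Po)
    moreover have "P (c *\<^sub>C P v) = c *\<^sub>C P v" using PK complex_subspaceD(3)[OF K(1)] Pid by blast
    ultimately show "P (c *\<^sub>C v) = c *\<^sub>C P v"
      using Pbl by (simp add: scaleC_diff_right linear_simps)
  qed
  have E1: "complex_subspace E1" "E1 \<subseteq> D" and E2: "complex_subspace E2" "E2 \<subseteq> D"
    using Dsub by (auto simp: complex_subspace_def E1_def E2_def Plin)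
  have d1: "heis_differential U X v \<in> E1" if "v \<in> E1" for X v
  proof -
    have v: "v \<in> D" "P v = v" using that by (auto simp: E1_def)
    have "P (heis_differential U X v) = heis_differential U X v"
      using vector_derivative_unique_at[OF Pd[OF v(1)]] dvd[OF v(1)] v(2) by metis
    then show ?thesis using dD[OF v(1)] by (simp add: E1_def)
  qed
  have d2: "heis_differential U X v \<in> E2" if "v \<in> E2" for X v
  proof -
    have v: "v \<in> D" "P v = 0" using that by (auto simp: E2_def)
    have "((\<lambda>s. 0) has_vector_derivative P (heis_differential U X v)) (at 0)"
      using Pd[OF v(1), of X] by (simp add: v(2) isoD(5))
    then have "P (heis_differential U X v) = 0"
      using vector_derivative_unique_at has_vector_derivative_const by blast
    then show ?thesis using dD[OF v(1)] by (simp add: E2_def)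
  qed
  have inv1: "invariant_subspace (A2 x) \<rho> E1"
    unfolding invariant_subspace_def using E1(1) \<rho>R R_inv[OF E1 d1] by metis
  have inv2: "invariant_subspace (A2 x) \<rho> E2"
    unfolding invariant_subspace_def using E2(1) \<rho>R R_inv[OF E2 d2] by metis
  have orth: "\<forall>v\<in>E1. \<forall>w\<in>E2. cinner v w = 0"
  proof (intro ballI)
    fix v w assume "v \<in> E1" "w \<in> E2"
    then have "v \<in> K" "P w = 0" using PK[of v] by (auto simp: E1_def E2_def)
    then show "cinner v w = 0" using Po[of v w] by simp
  qed
  have "D = {v + w |v w. v \<in> E1 \<and> w \<in> E2}"
  proof (intro equalityI subsetI)
    fix v assume v: "v \<in> D"
    have "P (v - P v) = 0" using Pbl Pid[OF PK] by (simp add: linear_simps)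
    then have "P v \<in> E1" "v - P v \<in> E2" using PD[OF v] v Dsub(4) Pid[OF PK] by (auto simp: E1_def E2_def)
    moreover have "v = P v + (v - P v)" by simp
    ultimately show "v \<in> {v + w |v w. v \<in> E1 \<and> w \<in> E2}" by blast
  qed (use E1 E2 Dsub(2) in blast)
  with irr inv1 inv2 orth have "E1 = {0} \<or> E2 = {0}" unfolding irreducible_rep_def by blast
  moreover have "J (coh 0) \<in> E1"
  proof -
    have "C_k k (\<lambda>g. J (weyl g (coh 0)))" for k
      using C_k_bounded_linear[OF JD(7)] coh_rapidly_decreasing[of 0]
      unfolding smooth_vectors_weyl[symmetric] smooth_vectors_def by blast
    then have "J (coh 0) \<in> D" unfolding D smooth_vectors_def by (simp add: JU)
    moreover have "P (J (coh 0)) = J (coh 0)" by (rule Pid) (simp add: K_def)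
    ultimately show ?thesis by (simp add: E1_def)
  qed
  moreover have "J (coh 0) \<noteq> 0"
  proof
    assume "J (coh 0) = 0"
    then have "cinner (coh 0) (coh 0) = 0" using JD(3)[of "coh 0" "coh 0"] by simp
    then show False by (simp only: cinner_coh) simp
  qed
  ultimately have "E2 = {0}" by blast
  have "v \<in> K" if v: "v \<in> D" for v
  proof -
    have "P (v - P v) = 0" using Pbl Pid[OF PK] by (simp add: linear_simps)
    then have "v - P v \<in> E2" using PD[OF v] v Dsub(4) by (auto simp: E2_def)
    then have "v = P v" using \<open>E2 = {0}\<close> by simp
    then show ?thesis using PK[of v] by simp
  qed
  then have "closure D \<subseteq> K" by (intro closure_minimal K) auto
  then have surjJ: "surj J" using dense by (auto simp: K_def)
  then have "\<forall>v. \<exists>u. J u = v" by (metis surjD)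
  then obtain T where JT: "\<And>v. J (T v) = v" by metis
  then have TJ: "T (J u) = u" for u using injD[OF JD(8)] by metis
  have T: "isometric T"
    unfolding isometric_def by (metis JT TJ JD(1-3))
  have TU: "T (U g v) = weyl g (T v)" for g v by (metis JT TJ JU)
  have unT: "unitary T" unfolding unitary_iff using T TJ by (metis surjI)
  \<comment> \<open>Both \<open>T\<close> and its inverse \<open>J\<close> are bounded intertwiners,
    so they carry smooth orbit maps to smooth orbit maps and the domains correspond exactly.\<close>
  have TD: "T ` D = rapidly_decreasing"
  proof (intro equalityI subsetI)
    fix u assume "u \<in> T ` D"
    then obtain v where v: "u = T v" "v \<in> D" by blast
    then have "C_k k (\<lambda>g. T (U g v))" for k
      unfolding D by (intro C_k_bounded_linear[OF isometricD(7)[OF T]] smooth_vectorsD(1))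
    then show "u \<in> rapidly_decreasing"
      unfolding smooth_vectors_weyl[symmetric] smooth_vectors_def by (simp add: v(1) TU)
  next
    fix u assume "u \<in> rapidly_decreasing"
    then have "C_k k (\<lambda>g. J (weyl g u))" for k
      unfolding smooth_vectors_weyl[symmetric] by (intro C_k_bounded_linear[OF JD(7)] smooth_vectorsD(1))
    then have "J u \<in> D" unfolding D smooth_vectors_def by (simp add: JU)
    then show "u \<in> T ` D" using TJ by (metis imageI)
  qed
  then have Tr: "T v \<in> rapidly_decreasing" if "v \<in> D" for v using that by blast
  \<comment> \<open>Differentiate
    \<open>T (U (s *\<^sub>R X) v) = weyl (s *\<^sub>R X) (T v)\<close> at
    \<open>s = 0\<close>.\<close>
  have Td: "T (\<rho>0 (heis_to_CCR X) v) = fock_rep 0 (heis_to_CCR X) (T v)" if v: "v \<in> D" for X v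
  proof -
    have "((\<lambda>s. weyl (s *\<^sub>R X) (T v)) has_vector_derivative T (heis_differential U X v)) (at 0)"
      using bounded_linear.has_vector_derivative[OF isometricD(7)[OF T] dvd[OF v]] by (simp add: TU)
    then have "heis_differential weyl X (T v) = T (heis_differential U X v)"
      unfolding heis_differential_def[of weyl] by (rule vector_derivative_at)
    then show ?thesis
      using diff[OF v] heis_differential_weyl[OF Tr[OF v], of X]
      by (simp add: heis_to_CCR_def fock_rep_term_class heis_op_def)
  qed
  note TI = isometricD[OF T]
  have TR: "\<forall>v\<in>D. T (R s v) = fock_rep 0 (term_class (A2_relations 0) s) (T v)" for s
  proof (rule sterm_generated[where R = "A2_relations 0"])
    have "T (R (Gen g) v) = fock_rep 0 (term_class (A2_relations 0) (Gen g)) (T v) \<and>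
        T (R (Gen_star g) v) = fock_rep 0 (term_class (A2_relations 0) (Gen_star g)) (T v)" if v: "v \<in> D" for g v
      unfolding R_def generators_from_differential(1,2)[OF sr0 v]
        generators_from_differential(1,2)[OF star_rep_fock Tr[OF v]] TI(1,2) Td[OF v] by blast
    then show "\<forall>v\<in>D. T (R (Gen g) v) = fock_rep 0 (term_class (A2_relations 0) (Gen g)) (T v)"
      "\<forall>v\<in>D. T (R (Gen_star g) v) = fock_rep 0 (term_class (A2_relations 0) (Gen_star g)) (T v)" for g
      by blast+
    show "\<forall>v\<in>D. T (R t v) = fock_rep 0 (term_class (A2_relations 0) t) (T v)"
      if "star_cong (A2_relations 0) s t" "\<forall>v\<in>D. T (R s v) = fock_rep 0 (term_class (A2_relations 0) s) (T v)" for s t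
      using that Rcong term_class_eq_iff by metis
  qed (simp_all add: R_def star_rep_term[OF sr0] star_rep_term[OF star_rep_fock Tr] TI(1,2))
  have "T (\<rho> u v) = fock_rep x u (T v)" if u: "u \<in> carrier (A2 x)" and v: "v \<in> D" for u v
  proof -
    obtain s where s: "\<Phi> u = term_class (A2_relations 0) s" "\<rho> u = R s" using \<rho>R[OF u] by blast
    have "fock_rep x (inv_into (carrier (A2 x)) \<Phi> (\<Phi> u)) = fock_rep 0 (\<Phi> u)"
      by (rule fock_rep_pullback[OF iso iso_on_terms[OF iso g1 g2] bij_betw_apply[OF bij u]])
    then have "fock_rep x u = fock_rep 0 (\<Phi> u)" by (simp add: bij_betw_inv_into_left[OF bij u])
    then show ?thesis using TR v by (simp add: s)
  qed
  then show ?thesis unfolding unitarily_equivalent_def using unT TD by blast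
qed

theorem theorem1:
  fixes x :: complex
  shows "\<exists>\<pi> :: two sterm set \<Rightarrow> (nat \<times> nat) ell2 \<Rightarrow> (nat \<times> nat) ell2.
    star_rep (A2 x) rapidly_decreasing \<pi> \<and>
    irreducible_rep (A2 x) rapidly_decreasing \<pi> \<and>
    well_behaved_rep x rapidly_decreasing \<pi> \<and>
    (\<forall>v\<in>rapidly_decreasing.
       \<pi> (A2_gen x G1) v = tensor_id creation v \<and>
       \<pi> (A2_gen x G2) v =
         complex_of_real (sqrt (1 + (cmod x)\<^sup>2)) *\<^sub>C id_tensor creation v
         + x *\<^sub>C tensor_id annihilation v) \<and>
    (\<forall>(D :: 'h::complex_hilbert set) (\<rho> :: two sterm set \<Rightarrow> 'h \<Rightarrow> 'h).
       star_rep (A2 x) D \<rho> \<and> irreducible_rep (A2 x) D \<rho> \<and> well_behaved_rep x D \<rho> \<longrightarrow>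
       unitarily_equivalent (A2 x) D \<rho> rapidly_decreasing \<pi>)"
  using star_rep_fock fock_rep_irreducible fock_rep_well_behaved fock_rep_gens unitarily_equivalent_fock
  by (intro exI[of _ "fock_rep x"]) blast

end
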